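(* Let $B_1$ be the unit disc in $\mathbb{C}\cong\mathbb{R}^2$, let $D\ge1$, let $\alpha\in\mathbb{R}$ and let $a_1,\dots,a_D\in B_1$ (not necessarily distinct), and set $$F(z)=e^{i\alpha}\prod_{j=1}^D\frac{z-a_j}{1-\bar a_jz},\qquad g=F|_{\partial B_1}.$$ Then for each $\varepsilon>0$ the map $$U_\varepsilon(z)=|F(z)|^{\varepsilon}\,\frac{F(z)}{|F(z)|}$$ is the unique minimizer of $E_\varepsilon$ over $H^1_g(B_1;\mathbb{R}^2)$.
   Context: $E_\varepsilon(u)=\int_{B_1}\big(|\nabla u|^2+(\tfrac1{\varepsilon^2}-1)|\nabla|u||^2\big)$ and $H^1_g(B_1;\mathbb{R}^2)=\{u\in H^1(B_1;\mathbb{R}^2):u=g\text{ on }\partial B_1\}$. $U_\varepsilon$ is understood to be $0$ at the zeros of $F$. *)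

theory Defs
  imports "HOL-Analysis.Analysis"
begin

text \<open>Elements of $L^2$ and $H^1$ are represented by functions on the whole type; only their values
  almost everywhere in the domain matter. The plane is the type \<^typ>\<open>complex\<close>, whose standard basis
  is $\{1, i\}$ and whose norm is the Euclidean one.\<close>

section \<open>Smooth functions\<close>

text \<open>\<^term>\<open>S\<close> is meant to be open.\<close>

fun Ck_on :: "nat \<Rightarrow> 'a::euclidean_space set \<Rightarrow> ('a \<Rightarrow> 'b::real_normed_vector) \<Rightarrow> bool" where
  "Ck_on 0 S f \<longleftrightarrow> continuous_on S f"
| "Ck_on (Suc k) S f \<longleftrightarrow> (\<forall>x\<in>S. f differentiable (at x)) \<and>
     (\<forall>e\<in>Basis. Ck_on k S (\<lambda>x. frechet_derivative f (at x) e))"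

definition smooth_on :: "'a::euclidean_space set \<Rightarrow> ('a \<Rightarrow> 'b::real_normed_vector) \<Rightarrow> bool" where
  "smooth_on S f \<longleftrightarrow> (\<forall>k. Ck_on k S f)"

definition test_function :: "'a::euclidean_space set \<Rightarrow> ('a \<Rightarrow> real) \<Rightarrow> bool" where
  "test_function \<Omega> \<phi> \<longleftrightarrow> smooth_on UNIV \<phi> \<and>
     compact (closure {x. \<phi> x \<noteq> 0}) \<and> closure {x. \<phi> x \<noteq> 0} \<subseteq> \<Omega>"

section \<open>Weak derivatives and the Sobolev space $H^1$\<close>

definition L2 :: "'a::euclidean_space set \<Rightarrow> ('a \<Rightarrow> 'b::euclidean_space) set" where
  "L2 \<Omega> = {u. u \<in> borel_measurable (lebesgue_on \<Omega>) \<and>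
             integrable (lebesgue_on \<Omega>) (\<lambda>x. (norm (u x))\<^sup>2)}"

definition locally_integrable :: "'a::euclidean_space set \<Rightarrow> ('a \<Rightarrow> 'b::euclidean_space) \<Rightarrow> bool" where
  "locally_integrable \<Omega> u \<longleftrightarrow> (\<forall>K. compact K \<and> K \<subseteq> \<Omega> \<longrightarrow> u absolutely_integrable_on K)"

definition has_weak_deriv ::
  "'a::euclidean_space set \<Rightarrow> 'a \<Rightarrow> ('a \<Rightarrow> 'b::euclidean_space) \<Rightarrow> ('a \<Rightarrow> 'b) \<Rightarrow> bool" where
  "has_weak_deriv \<Omega> e u v \<longleftrightarrow> locally_integrable \<Omega> u \<and> locally_integrable \<Omega> v \<and>
     (\<forall>\<phi>. test_function \<Omega> \<phi> \<longrightarrow>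
        (\<integral>x. frechet_derivative \<phi> (at x) e *\<^sub>R u x \<partial>lebesgue_on \<Omega>)
          = - (\<integral>x. \<phi> x *\<^sub>R v x \<partial>lebesgue_on \<Omega>))"

text \<open>The weak derivative is determined almost everywhere in \<^term>\<open>\<Omega>\<close>; the choice of a
  representative is immaterial in the integrals below.\<close>

definition weak_deriv ::
  "'a::euclidean_space set \<Rightarrow> 'a \<Rightarrow> ('a \<Rightarrow> 'b::euclidean_space) \<Rightarrow> 'a \<Rightarrow> 'b" where
  "weak_deriv \<Omega> e u = (SOME v. has_weak_deriv \<Omega> e u v)"

definition grad_norm_sq :: "'a::euclidean_space set \<Rightarrow> ('a \<Rightarrow> 'b::euclidean_space) \<Rightarrow> 'a \<Rightarrow> real" where
  "grad_norm_sq \<Omega> u x = (\<Sum>e\<in>Basis. (norm (weak_deriv \<Omega> e u x))\<^sup>2)"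

definition H1 :: "'a::euclidean_space set \<Rightarrow> ('a \<Rightarrow> 'b::euclidean_space) set" where
  "H1 \<Omega> = {u \<in> L2 \<Omega>. \<forall>e\<in>Basis. \<exists>v\<in>L2 \<Omega>. has_weak_deriv \<Omega> e u v}"

definition H1_norm :: "'a::euclidean_space set \<Rightarrow> ('a \<Rightarrow> 'b::euclidean_space) \<Rightarrow> real" where
  "H1_norm \<Omega> u = sqrt (\<integral>x. (norm (u x))\<^sup>2 + grad_norm_sq \<Omega> u x \<partial>lebesgue_on \<Omega>)"

section \<open>Boundary values on the unit disc\<close>

text \<open>The trace operator from $H^1(B_1)$ to $L^2(\partial B_1)$ is the continuous extension of
  restriction to the circle, defined on functions smooth up to the boundary, that is, smooth on a
  neighbourhood of the closed disc. The relation below is the closure of the graph of that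
  restriction map, with arc length as measure on the circle.\<close>

definition has_trace :: "(complex \<Rightarrow> complex) \<Rightarrow> (complex \<Rightarrow> complex) \<Rightarrow> bool" where
  "has_trace u g \<longleftrightarrow> u \<in> H1 (ball 0 1) \<and> (\<lambda>\<theta>. g (cis \<theta>)) \<in> L2 {0..2 * pi} \<and>
     (\<exists>\<psi> :: nat \<Rightarrow> complex \<Rightarrow> complex.
        (\<forall>n. \<exists>S. open S \<and> cball 0 1 \<subseteq> S \<and> smooth_on S (\<psi> n)) \<and>
        (\<lambda>n. H1_norm (ball 0 1) (\<lambda>z. \<psi> n z - u z)) \<longlonglongrightarrow> 0 \<and>
        (\<lambda>n. \<integral>\<theta>. (cmod (\<psi> n (cis \<theta>) - g (cis \<theta>)))\<^sup>2 \<partial>lebesgue_on {0..2 * pi}) \<longlonglongrightarrow> 0)"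

definition H1_bdry :: "(complex \<Rightarrow> complex) \<Rightarrow> (complex \<Rightarrow> complex) set" where
  "H1_bdry g = {u \<in> H1 (ball 0 1). has_trace u g}"

section \<open>The energy and the candidate minimizer\<close>

definition energy :: "real \<Rightarrow> (complex \<Rightarrow> complex) \<Rightarrow> real" where
  "energy \<epsilon> u = (\<integral>z. grad_norm_sq (ball 0 1) u z
      + (1 / \<epsilon>\<^sup>2 - 1) * grad_norm_sq (ball 0 1) (\<lambda>w. cmod (u w)) z \<partial>lebesgue_on (ball 0 1))"

definition blaschke :: "real \<Rightarrow> nat \<Rightarrow> (nat \<Rightarrow> complex) \<Rightarrow> complex \<Rightarrow> complex" where
  "blaschke \<alpha> D a z = exp (\<i> * of_real \<alpha>) * (\<Prod>j=1..D. (z - a j) / (1 - cnj (a j) * z))"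

definition U_map :: "real \<Rightarrow> (complex \<Rightarrow> complex) \<Rightarrow> complex \<Rightarrow> complex" where
  "U_map \<epsilon> F z = (if F z = 0 then 0
     else of_real (cmod (F z) powr \<epsilon>) * (F z / of_real (cmod (F z))))"

end

theory Submission
  imports Defs
begin

text \<open>
Where $u\neq 0$ write $u=\rho e^{i\varphi}$. Then $|\nabla u|^2=|\nabla\rho|^2+\rho^2|\nabla\varphi|^2$, so the energy
density is $\varepsilon^{-2}|\nabla\rho|^2+\rho^2|\nabla\varphi|^2$. Completing the square turns it into
$\frac2\varepsilon\det Du$ plus the sum of the squares of $\varepsilon^{-1}\rho_x-\rho\varphi_y$ and
$\varepsilon^{-1}\rho_y+\rho\varphi_x$, the \<open>conformal_defect\<close> (\<open>energy_eq\<close>). The integral of the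
Jacobian is the same for all maps with the same trace (\<open>Jacobian_integral_depends_on_trace\<close>), hence the
energy is bounded below on $H^1_g$ by a constant, and the bound is attained exactly by the maps whose defect
vanishes almost everywhere. These are the maps for which $\frac1\varepsilon\log\rho+i\varphi$ satisfies the
Cauchy-Riemann equations, that is, for which $|u|^{1/\varepsilon-1}u$ is holomorphic. For $U_\varepsilon$ this function
is $F$, so $U_\varepsilon$ is a minimizer (\<open>conformal_defect_power_map\<close>).

Conversely, let $u$ be a minimizer and $W=|u|^{1/\varepsilon-1}u$, or $W=u/|u|$ where $|u|>1$. Both $W$ and $F$
satisfy the Cauchy-Riemann equations, and they have the same trace because $|g|=1$. For $V=W-F$ the Jacobian integrates to zero, as it
does for the zero map. But the Cauchy-Riemann equations say that twice the Jacobian of $V$ is $|\nabla V|^2$.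
So $\nabla V=0$, and $V=0$ by a Poincare inequality (\<open>Cauchy_Riemann_zero_trace\<close>). Since
$|F|<1$ in the disc, $W=F$ means $|u|^{1/\varepsilon-1}u=F$, which is solved by $u=U_\varepsilon$ only.

Two points need care. The first is that the power maps $w\mapsto|w|^{\kappa-1}w$ are not Lipschitz, near $0$ for
$\kappa<1$ and near infinity for $\kappa>1$, so that neither $U_\varepsilon$ nor $W$ is an $H^1$ function by a
chain rule. They are limits of smooth radial maps (\<open>reg_map\<close>) which fix the unit circle pointwise, and
therefore the trace. Convergence in $H^1$ rests on
$\int_{|u|<1}|u|^{2\kappa-2}|\nabla u|^2<\infty$ for $\kappa<1$. For maps whose gradient is controlled by
their Jacobian this follows from the invariance of the Jacobian integral once more
(\<open>weighted_gradient_L2\<close>, \<open>sobolev_limit_power_map\<close>). The same device shows that the gradient of a minimizer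
vanishes where its modulus is at least one (\<open>gradient_zero_outside_disc\<close>).

The second point is to work with traces that are only given as limits in $L^2$ of the circle. All
statements are about \<open>sobolev_limit\<close>, which says that a map, its two partial derivatives and its
trace are simultaneous limits of smooth maps and their derivatives and boundary values. This class is closed
under composition with smooth Lipschitz maps, and Green's formula on the disc passes to it.
\<close>

section \<open>Calculus of continuously differentiable functions\<close>

lemma Ck_on_SucI:
  fixes f :: "'a::euclidean_space \<Rightarrow> 'b::real_normed_vector"
  assumes "\<And>x. x \<in> S \<Longrightarrow> (f has_derivative f' x) (at x)"
    and "\<And>e. e \<in> Basis \<Longrightarrow> Ck_on k S (\<lambda>x. f' x e)"
    and cong: "\<And>g h :: 'a \<Rightarrow> 'b.
       (\<And>x. x \<in> S \<Longrightarrow> g x = h x) \<Longrightarrow> Ck_on k S g \<Longrightarrow> Ck_on k S h"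
  shows "Ck_on (Suc k) S f"
proof -
  have fd: "frechet_derivative f (at x) = f' x" if "x \<in> S" for x
    using frechet_derivative_at[OF assms(1)[OF that]] by simp
  have "Ck_on k S (\<lambda>x. frechet_derivative f (at x) e)" if "e \<in> Basis" for e
    by (rule cong[where g = "\<lambda>x. f' x e"]) (simp_all add: fd assms(2) that)
  then show ?thesis
    using assms(1) by (auto simp: differentiable_def)
qed

lemma Ck_on_cong:
  assumes "open S" "\<And>x. x \<in> S \<Longrightarrow> f x = g x" "Ck_on k S f"
  shows "Ck_on k S g"
  using assms(2,3)
proof (induction k arbitrary: f g)
  case 0
  then show ?case by (auto intro: continuous_on_eq)
next
  case (Suc k)
  have d: "(g has_derivative frechet_derivative f (at x)) (at x)" if "x \<in> S" for x
  proof (rule has_derivative_transform_within_open[OF _ assms(1) that])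
    show "(f has_derivative frechet_derivative f (at x)) (at x)"
      using Suc.prems(2) that by (simp add: frechet_derivative_works[symmetric])
  qed (rule Suc.prems(1))
  show ?case
  proof (rule Ck_on_SucI[OF d])
    fix e :: 'a assume "e \<in> Basis"
    then show "Ck_on k S (\<lambda>x. frechet_derivative f (at x) e)" using Suc.prems(2) by simp
  next
    fix g h :: "'a \<Rightarrow> 'b" assume "\<And>x. x \<in> S \<Longrightarrow> g x = h x" "Ck_on k S g"
    then show "Ck_on k S h" using Suc.IH by blast
  qed
qed

text \<open>Since \<^const>\<open>frechet_derivative\<close> is a choice, the recursion clause is best established from
  derivatives that are already at hand.\<close>

lemma Ck_on_SucI':
  assumes "open S" "\<And>x. x \<in> S \<Longrightarrow> (f has_derivative f' x) (at x)"
    and "\<And>e. e \<in> Basis \<Longrightarrow> Ck_on k S (\<lambda>x. f' x e)"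
  shows "Ck_on (Suc k) S f"
  by (rule Ck_on_SucI[OF assms(2,3)]) (auto intro: Ck_on_cong[OF assms(1)])

lemma Ck_on_SucD:
  assumes "Ck_on (Suc k) S f" 
  shows "x \<in> S \<Longrightarrow> (f has_derivative frechet_derivative f (at x)) (at x)"
    and "e \<in> Basis \<Longrightarrow> Ck_on k S (\<lambda>x. frechet_derivative f (at x) e)"
  using assms by (auto simp: frechet_derivative_works[symmetric])

lemma Ck_on_Suc_imp: "Ck_on (Suc k) S f \<Longrightarrow> Ck_on k S f"
proof (induction k arbitrary: f)
  case 0
  then show ?case
    by (auto intro!: continuous_at_imp_continuous_on differentiable_imp_continuous_within)
next
  case (Suc k)
  then show ?case by (metis Ck_on.simps(2))
qed

lemma Ck_on_le: "Ck_on m S f \<Longrightarrow> k \<le> m \<Longrightarrow> Ck_on k S f"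
  by (induction m) (auto simp: le_Suc_eq simp del: Ck_on.simps intro: Ck_on_Suc_imp)

lemma Ck_on_imp_continuous_on: "Ck_on k S f \<Longrightarrow> continuous_on S f"
  using Ck_on_le[of k S f 0] by simp

lemma Ck_on_subset: "Ck_on k S f \<Longrightarrow> T \<subseteq> S \<Longrightarrow> Ck_on k T f"
  by (induction k arbitrary: f) (auto intro: continuous_on_subset)

lemma Ck_on_const: "Ck_on k S (\<lambda>x. c)"
  by (induction k arbitrary: c) auto

declare Ck_on.simps(2) [simp del]

lemma Ck_on_add:
  assumes "open S"
  shows "Ck_on k S f \<Longrightarrow> Ck_on k S g \<Longrightarrow> Ck_on k S (\<lambda>x. f x + g x)"
proof (induction k arbitrary: f g)
  case (Suc k)
  show ?case
    by (rule Ck_on_SucI'[OF assms has_derivative_add[OF Ck_on_SucD(1)[OF Suc.prems(1)] Ck_on_SucD(1)[OF Suc.prems(2)]]])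
       (rule Suc.IH Ck_on_SucD(2) Suc.prems | assumption)+
qed (auto intro: continuous_intros)

lemma Ck_on_bounded_linear:
  assumes "open S" "bounded_linear L"
  shows "Ck_on k S f \<Longrightarrow> Ck_on k S (\<lambda>x. L (f x))"
proof (induction k arbitrary: f)
  case 0
  then show ?case using assms by (auto intro: bounded_linear.continuous_on)
next
  case (Suc k)
  show ?case
    by (rule Ck_on_SucI'[OF assms(1) bounded_linear.has_derivative[OF assms(2) Ck_on_SucD(1)[OF Suc.prems]]])
       (rule Suc.IH Ck_on_SucD(2) Suc.prems | assumption)+
qed

lemma Ck_on_linear:
  assumes "open S" "bounded_linear L"
  shows "Ck_on k S L"
proof (cases k)
  case 0
  then show ?thesis using assms linear_continuous_on by auto
next
  case (Suc m)
  show ?thesis unfolding Suc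
    by (rule Ck_on_SucI'[OF assms(1) bounded_linear_imp_has_derivative[OF assms(2)]]) (rule Ck_on_const)
qed

lemma Ck_on_bilinear:
  assumes "open S" and bb: "bounded_bilinear pr"
  shows "Ck_on k S f \<Longrightarrow> Ck_on k S g \<Longrightarrow> Ck_on k S (\<lambda>x. pr (f x) (g x))"
proof (induction k arbitrary: f g)
  case 0
  then show ?case using bb by (auto intro: bounded_bilinear.continuous_on)
next
  case (Suc k)
  show ?case
    by (rule Ck_on_SucI'[OF assms(1) bounded_bilinear.FDERIV[OF bb Ck_on_SucD(1)[OF Suc.prems(1)] Ck_on_SucD(1)[OF Suc.prems(2)]]])
       (rule Ck_on_add assms(1) Suc.IH Ck_on_Suc_imp[OF Suc.prems(1)] Ck_on_Suc_imp[OF Suc.prems(2)] Ck_on_SucD(2) Suc.prems | assumption)+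
qed

lemmas Ck_on_mult = Ck_on_bilinear[OF _ bounded_bilinear_mult]
lemmas Ck_on_scaleR = Ck_on_bilinear[OF _ bounded_bilinear_scaleR]
lemmas Ck_on_inner = Ck_on_bilinear[OF _ bounded_bilinear_inner]
lemmas Ck_on_of_real = Ck_on_bounded_linear[OF _ bounded_linear_of_real]

lemma Ck_on_minus: "open S \<Longrightarrow> Ck_on k S f \<Longrightarrow> Ck_on k S (\<lambda>x. - f x)"
  using Ck_on_bounded_linear[OF _ bounded_linear_minus[OF bounded_linear_ident]] by blast

lemma Ck_on_diff: "open S \<Longrightarrow> Ck_on k S f \<Longrightarrow> Ck_on k S g \<Longrightarrow> Ck_on k S (\<lambda>x. f x - g x)"
  using Ck_on_add[of S k f "\<lambda>x. - g x"] Ck_on_minus[of S k g] by simp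

lemma Ck_on_prod:
  fixes f :: "'i \<Rightarrow> 'a::euclidean_space \<Rightarrow> 'b::{real_normed_algebra,comm_ring_1}"
  assumes "open S" "\<And>i. i \<in> I \<Longrightarrow> Ck_on k S (f i)"
  shows "Ck_on k S (\<lambda>x. \<Prod>i\<in>I. f i x)"
  using assms(2)
proof (induction I rule: infinite_finite_induct)
  case (insert i I)
  then show ?case by (simp add: Ck_on_mult[OF assms(1)])
qed (simp_all add: Ck_on_const)

lemma Ck_on_inverse:
  fixes f :: "'a::euclidean_space \<Rightarrow> 'b::real_normed_field"
  assumes "open S" 
  shows "Ck_on k S f \<Longrightarrow> (\<And>x. x \<in> S \<Longrightarrow> f x \<noteq> 0) \<Longrightarrow> Ck_on k S (\<lambda>x. inverse (f x))"
proof (induction k arbitrary: f)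
  case (Suc k)
  have "Ck_on k S (\<lambda>x. inverse (f x))" using Suc Ck_on_Suc_imp by blast
  then show ?case
    by (intro Ck_on_SucI'[OF assms Deriv.has_derivative_inverse[OF Suc.prems(2) Ck_on_SucD(1)[OF Suc.prems(1)]]])
       (rule Ck_on_minus Ck_on_mult assms Ck_on_SucD(2) Suc.prems | assumption)+
qed (auto intro!: continuous_intros)

lemma Ck_on_powr:
  fixes f :: "'a::euclidean_space \<Rightarrow> real"
  assumes "open S" 
  shows "Ck_on k S f \<Longrightarrow> (\<And>x. x \<in> S \<Longrightarrow> f x > 0) \<Longrightarrow> Ck_on k S (\<lambda>x. f x powr p)"
proof (induction k arbitrary: p)
  case 0
  then show ?case by (auto intro!: continuous_on_powr continuous_on_const simp: less_imp_neq[symmetric])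
next
  case (Suc k)
  have d: "((\<lambda>x. f x powr p) has_derivative (\<lambda>v. p * f x powr (p - 1) * frechet_derivative f (at x) v)) (at x)"
    if "x \<in> S" for x
    using has_derivative_compose[OF Ck_on_SucD(1)[OF Suc.prems(1) that], of "\<lambda>t. t powr p"]
      has_real_derivative_powr[OF Suc.prems(2)[OF that], of p] by (auto simp: has_field_derivative_def)
  show ?case
    by (rule Ck_on_SucI'[OF assms d])
       (rule Ck_on_mult assms Ck_on_const Suc.IH Ck_on_Suc_imp[OF Suc.prems(1)] Ck_on_SucD(2) Suc.prems | assumption)+
qed

lemma Ck_on_power:
  fixes f :: "'a::euclidean_space \<Rightarrow> 'b::real_normed_field"
  shows "open S \<Longrightarrow> Ck_on k S f \<Longrightarrow> Ck_on k S (\<lambda>x. f x ^ n)"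
  by (induction n) (simp_all add: Ck_on_const Ck_on_mult)

text \<open>The functions $t^{-j}e^{-1/t}$, extended by $0$. For $j=0$ this is the usual flat function; the whole
  family is closed under differentiation, so that smoothness of all of them is one induction on the order.\<close>

definition flat :: "nat \<Rightarrow> real \<Rightarrow> real" where
  "flat j t = (if t > 0 then exp (- (1 / t)) / t ^ j else 0)"

lemma flat_tendsto_0: "(flat j \<longlongrightarrow> 0) (at 0)"
proof -
  have "((\<lambda>t. (inverse t) ^ j / exp (inverse t)) \<longlongrightarrow> 0) (at_right (0::real))"
    by (rule filterlim_compose[OF tendsto_power_div_exp_0 filterlim_inverse_at_top_right])
  moreover have "\<forall>\<^sub>F t in at_right (0::real). (inverse t) ^ j / exp (inverse t) = flat j t"
    by (auto simp: eventually_at_filter flat_def exp_minus field_simps)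
  ultimately have "(flat j \<longlongrightarrow> 0) (at_right 0)"
    by (rule Lim_transform_eventually)
  moreover have "(flat j \<longlongrightarrow> 0) (at_left 0)"
    by (rule tendsto_eventually) (auto simp: eventually_at_filter flat_def)
  ultimately show ?thesis by (simp add: filterlim_at_split)
qed

lemma flat_has_derivative:
  "(flat j has_field_derivative flat (j + 2) t - real j * flat (j + 1) t) (at t)"
proof (cases t "0::real" rule: linorder_cases)
  case less
  have "((\<lambda>t. 0) has_field_derivative 0) (at t)" by simp
  then have "(flat j has_field_derivative 0) (at t)"
    by (rule has_field_derivative_transform_within_open[of _ _ _ "{..<0}"])
       (use less in \<open>auto simp: flat_def\<close>)
  then show ?thesis using less by (simp add: flat_def)
next
  case equal
  have "\<forall>\<^sub>F h in at (0::real). flat (j + 1) h = (flat j (0 + h) - flat j 0) / h"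
    by (auto simp: eventually_at_filter flat_def)
  then have "((\<lambda>h. (flat j (0 + h) - flat j 0) / h) \<longlongrightarrow> 0) (at 0)"
    by (rule Lim_transform_eventually[OF flat_tendsto_0])
  then show ?thesis unfolding equal by (simp add: DERIV_def flat_def)
next
  case greater
  define E where "E = exp (- (1 / t))"
  have "((\<lambda>t. exp (- (1 / t))) has_field_derivative E * (1 / t^2)) (at t)"
    unfolding E_def using greater by (auto intro!: derivative_eq_intros simp: power2_eq_square)
  then have "((\<lambda>t. exp (- (1 / t)) / t ^ j) has_field_derivative
       (E * (1 / t^2) * t ^ j - E * (real j * t ^ (j - 1))) / (t ^ j * t ^ j)) (at t)"
    using DERIV_divide[OF _ DERIV_pow[of j t], of "\<lambda>t. exp (- (1 / t))" "E * (1 / t^2)"] greater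
    by (simp add: E_def)
  also have "(E * (1 / t^2) * t ^ j - E * (real j * t ^ (j - 1))) / (t ^ j * t ^ j)
      = E / t ^ (j + 2) - real j * (E / t ^ (j + 1))"
    using greater by (cases j) (simp_all add: field_simps power2_eq_square)
  also have "\<dots> = flat (j + 2) t - real j * flat (j + 1) t"
    using greater by (simp add: flat_def E_def)
  finally show ?thesis
    by (rule has_field_derivative_transform_within_open[of _ _ _ "{0<..}"])
       (use greater in \<open>auto simp: flat_def\<close>)
qed

lemma Ck_on_flat:
  fixes f :: "'a::euclidean_space \<Rightarrow> real"
  assumes "open S" 
  shows "Ck_on k S f \<Longrightarrow> Ck_on k S (\<lambda>x. flat j (f x))"
proof (induction k arbitrary: j)
  case 0
  have "continuous_on UNIV (flat j)"
    by (rule DERIV_continuous_on) (rule flat_has_derivative)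
  then show ?case using 0 continuous_on_compose2[of UNIV "flat j" S f] by simp
next
  case (Suc k)
  have d: "((\<lambda>x. flat j (f x)) has_derivative
       (\<lambda>v. (flat (j + 2) (f x) - real j * flat (j + 1) (f x)) * frechet_derivative f (at x) v)) (at x)"
    if "x \<in> S" for x
    using has_derivative_compose[OF Ck_on_SucD(1)[OF Suc.prems that], of "flat j"] 
      flat_has_derivative[of j "f x"] by (auto simp: has_field_derivative_def)
  show ?case
    by (rule Ck_on_SucI'[OF assms d])
       (rule Ck_on_mult Ck_on_diff assms Ck_on_const Suc.IH Ck_on_Suc_imp[OF Suc.prems] Ck_on_SucD(2) Suc.prems | assumption)+
qed

section \<open>Green's formula on the unit disc\<close>

abbreviation dx :: "(complex \<Rightarrow> 'b::real_normed_vector) \<Rightarrow> complex \<Rightarrow> 'b" where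
  "dx f z \<equiv> frechet_derivative f (at z) 1"

abbreviation dy :: "(complex \<Rightarrow> 'b::real_normed_vector) \<Rightarrow> complex \<Rightarrow> 'b" where
  "dy f z \<equiv> frechet_derivative f (at z) \<i>"

lemma Ck_on_differentiable: "Ck_on (Suc k) S f \<Longrightarrow> x \<in> S \<Longrightarrow> f differentiable (at x)"
  by (simp add: Ck_on.simps(2))

lemma Ck_on_dx: "Ck_on (Suc k) S f \<Longrightarrow> Ck_on k S (dx f)"
  and Ck_on_dy: "Ck_on (Suc k) S f \<Longrightarrow> Ck_on k S (dy f)"
  using Ck_on_SucD(2)[of k S f] by (simp_all add: Basis_complex_def)

lemma has_vector_derivative_dx:
  assumes "f differentiable (at (Complex x y))"
  shows "((\<lambda>t. f (Complex t y)) has_vector_derivative dx f (Complex x y)) (at x within U)"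
proof -
  have D: "(f has_derivative frechet_derivative f (at (Complex x y))) (at (Complex x y))"
    using assms by (simp add: frechet_derivative_works[symmetric])
  have "((\<lambda>t. of_real t + \<i> * of_real y) has_derivative of_real) (at x within U)"
    by (auto intro!: derivative_eq_intros)
  then have "((\<lambda>t. Complex t y) has_derivative of_real) (at x within U)"
    by (simp add: Complex_eq)
  from has_derivative_compose[OF this D]
  have "((\<lambda>t. f (Complex t y)) has_derivative (\<lambda>h. frechet_derivative f (at (Complex x y)) (of_real h))) (at x within U)" .
  moreover have "frechet_derivative f (at (Complex x y)) (of_real h) = h *\<^sub>R dx f (Complex x y)" for h
    using linear_scale[OF has_derivative_linear[OF D], of h 1] by (simp add: scaleR_conv_of_real)
  ultimately show ?thesis unfolding has_vector_derivative_def by simp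
qed

lemma has_vector_derivative_dy:
  assumes "f differentiable (at (Complex x y))"
  shows "((\<lambda>t. f (Complex x t)) has_vector_derivative dy f (Complex x y)) (at y within U)"
proof -
  have D: "(f has_derivative frechet_derivative f (at (Complex x y))) (at (Complex x y))"
    using assms by (simp add: frechet_derivative_works[symmetric])
  have "((\<lambda>t. of_real x + \<i> * of_real t) has_derivative (\<lambda>t. t *\<^sub>R \<i>)) (at y within U)"
    by (auto intro!: derivative_eq_intros simp: scaleR_conv_of_real)
  then have "((\<lambda>t. Complex x t) has_derivative (\<lambda>t. t *\<^sub>R \<i>)) (at y within U)"
    by (simp add: Complex_eq)
  from has_derivative_compose[OF this D]
  show ?thesis unfolding has_vector_derivative_def
    using linear_scale[OF has_derivative_linear[OF D], of _ \<i>]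
    by simp
qed

lemma continuous_on_Complex [continuous_intros]:
  "continuous_on A f \<Longrightarrow> continuous_on A g \<Longrightarrow> continuous_on A (\<lambda>t. Complex (f t) (g t))"
  unfolding Complex_eq by (intro continuous_intros)

text \<open>Near the point, \<open>dx f (x,y)\<close> equals \<open>dx f (x,c)\<close> plus the integral of \<open>dx (dy f)\<close> over the vertical
  segment from $c$ to $y$, by the fundamental theorem and differentiation under the integral. Differentiating in
  $y$ gives the claim.\<close>

lemma mixed_derivatives_commute:
  fixes f :: "complex \<Rightarrow> complex"
  assumes "open S" "Ck_on 2 S f" "z \<in> S"
  shows "dx (dy f) z = dy (dx f) z"
proof -
  obtain x0 y0 where z: "z = Complex x0 y0" by (cases z)
  have C2: "Ck_on (Suc (Suc 0)) S f" using assms(2) by (simp add: numeral_2_eq_2)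
  have diff: "f differentiable (at w)" "dx f differentiable (at w)" "dy f differentiable (at w)"
    if "w \<in> S" for w
    using Ck_on_SucD(1)[OF C2 that] Ck_on_SucD(1)[OF Ck_on_dx[OF C2] that] Ck_on_SucD(1)[OF Ck_on_dy[OF C2] that]
    by (auto simp: differentiable_def)
  have cont: "continuous_on S (dy f)" "continuous_on S (dx (dy f))" 
    using Ck_on_imp_continuous_on[OF Ck_on_dy[OF C2]] Ck_on_dx[OF Ck_on_dy[OF C2]] by auto
  obtain R where R: "R > 0" "ball z R \<subseteq> S" using assms(1,3) openE by blast
  define r where "r = R / 3"
  have r: "r > 0" using R by (simp add: r_def)
  have inS: "Complex x y \<in> S" if "x \<in> {x0-r..x0+r}" "y \<in> {y0-r..y0+r}" for x y
  proof -
    have "cmod (Complex x y - z) \<le> \<bar>x - x0\<bar> + \<bar>y - y0\<bar>"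
      using cmod_le[of "Complex x y - z"] by (simp add: z)
    also have "\<dots> < R" using that r by (auto simp: r_def)
    finally show ?thesis using R(2) by (auto simp: dist_norm norm_minus_commute)
  qed
  define c where "c = y0 - r"
  have eq: "dx f (Complex x0 y) = dx f (Complex x0 c) + integral (cbox c y) (\<lambda>t. dx (dy f) (Complex x0 t))"
    if y: "y \<in> {y0-r..y0+r}" for y
  proof -
    let ?U = "{x0-r..x0+r}"
    have mem: "t \<in> {y0-r..y0+r}" if "t \<in> cbox c y" for t using that y by (auto simp: c_def)
    have "continuous_on {c..y} (\<lambda>t. dy f (Complex x t))" if "x \<in> ?U" for x
      by (rule continuous_on_compose2[OF cont(1)]) (use inS that mem in \<open>auto intro!: continuous_intros\<close>)
    then have int: "(\<lambda>t. dy f (Complex x t)) integrable_on cbox c y" if "x \<in> ?U" for x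
      using that integrable_continuous_real by auto
    have "continuous_on (?U \<times> cbox c y) (\<lambda>p. dx (dy f) (Complex (fst p) (snd p)))"
      by (rule continuous_on_compose2[OF cont(2)]) (use inS mem in \<open>auto intro!: continuous_intros\<close>)
    then have c2: "continuous_on (?U \<times> cbox c y) (\<lambda>(x, t). dx (dy f) (Complex x t))"
      by (simp add: case_prod_beta)
    have L: "((\<lambda>x. integral (cbox c y) (\<lambda>t. dy f (Complex x t))) has_vector_derivative
        integral (cbox c y) (\<lambda>t. dx (dy f) (Complex x0 t))) (at x0 within ?U)"
      by (rule leibniz_rule_vector_derivative[OF _ int c2])
         (use inS mem r in \<open>auto intro!: has_vector_derivative_dx diff\<close>)
    have ftc: "integral (cbox c y) (\<lambda>t. dy f (Complex x t)) = f (Complex x y) - f (Complex x c)"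
      if "x \<in> ?U" for x
    proof -
      have "((\<lambda>t. dy f (Complex x t)) has_integral f (Complex x y) - f (Complex x c)) {c..y}"
        by (rule fundamental_theorem_of_calculus)
           (use y that mem in \<open>auto simp: c_def intro!: has_vector_derivative_dy diff inS\<close>)
      then show ?thesis by (simp add: integral_unique)
    qed
    have "((\<lambda>x. f (Complex x y) - f (Complex x c)) has_vector_derivative
        integral (cbox c y) (\<lambda>t. dx (dy f) (Complex x0 t))) (at x0 within ?U)"
      by (rule has_vector_derivative_transform[OF _ _ L]) (use r ftc in auto)
    moreover have "((\<lambda>x. f (Complex x y) - f (Complex x c)) has_vector_derivative
        dx f (Complex x0 y) - dx f (Complex x0 c)) (at x0 within ?U)"
      by (intro has_vector_derivative_diff has_vector_derivative_dx diff inS) (use y r in \<open>auto simp: c_def\<close>)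
    ultimately have "dx f (Complex x0 y) - dx f (Complex x0 c) = integral (cbox c y) (\<lambda>t. dx (dy f) (Complex x0 t))"
      using vector_derivative_unique_within_closed_interval[of "x0-r" "x0+r" x0 "\<lambda>x. f (Complex x y) - f (Complex x c)"] r by simp
    then show ?thesis by (simp add: algebra_simps)
  qed
  have sub: "(\<lambda>t. Complex x0 t) ` {c..y0+r} \<subseteq> S"
    using inS r by (auto simp: c_def)
  have "continuous_on {c..y0+r} (\<lambda>t. dx (dy f) (Complex x0 t))"
    by (rule continuous_on_compose2[OF cont(2) _ sub]) (intro continuous_intros)
  then have "((\<lambda>y. integral {c..y} (\<lambda>t. dx (dy f) (Complex x0 t))) has_vector_derivative dx (dy f) (Complex x0 y0)) (at y0 within {c..y0+r})"
    by (rule integral_has_vector_derivative) (use r in \<open>simp add: c_def\<close>)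
  from has_vector_derivative_add[OF has_vector_derivative_const[of "dx f (Complex x0 c)"] this]
  have V: "((\<lambda>y. dx f (Complex x0 c) + integral {c..y} (\<lambda>t. dx (dy f) (Complex x0 t))) has_vector_derivative dx (dy f) (Complex x0 y0)) (at y0 within {c..y0+r})"
    by simp
  have "((\<lambda>y. dx f (Complex x0 y)) has_vector_derivative dx (dy f) (Complex x0 y0)) (at y0 within {c..y0+r})"
  proof (rule has_vector_derivative_transform[OF _ _ V])
    fix y assume "y \<in> {c..y0+r}"
    then show "dx f (Complex x0 y) = dx f (Complex x0 c) + integral {c..y} (\<lambda>t. dx (dy f) (Complex x0 t))"
      using eq[of y] by (simp add: c_def)
  qed (use r in \<open>simp add: c_def\<close>)
  moreover have "((\<lambda>y. dx f (Complex x0 y)) has_vector_derivative dy (dx f) (Complex x0 y0)) (at y0 within {c..y0+r})"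
    by (intro has_vector_derivative_dy diff inS) (use r in auto)
  ultimately show ?thesis unfolding z
    using vector_derivative_unique_within_closed_interval[of c "y0+r" y0 "\<lambda>y. dx f (Complex x0 y)"] r
    by (simp add: c_def)
qed

lemma lborel_complex: "lborel = distr (lborel \<Otimes>\<^sub>M lborel) borel (\<lambda>(x, y). Complex x y)"
proof (rule lborel_eqI)
  have m[measurable]: "(\<lambda>(x, y). Complex x y) \<in> borel \<rightarrow>\<^sub>M borel"
    unfolding case_prod_beta by (intro borel_measurable_continuous_onI continuous_intros)
  fix l u :: complex
  assume le: "\<And>b. b \<in> Basis \<Longrightarrow> l \<bullet> b \<le> u \<bullet> b"
  have le': "Re l \<le> Re u" "Im l \<le> Im u" using le[of 1] le[of \<i>] by (auto simp: Basis_complex_def)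
  have "(\<lambda>(x, y). Complex x y) -` box l u = box (Re l) (Re u) \<times> box (Im l) (Im u)"
    by (auto simp: box_def Basis_complex_def)
  then have "emeasure (distr (lborel \<Otimes>\<^sub>M lborel) borel (\<lambda>(x, y). Complex x y)) (box l u)
     = emeasure (lborel \<Otimes>\<^sub>M lborel) (box (Re l) (Re u) \<times> box (Im l) (Im u))"
    using m by (subst emeasure_distr) (auto simp: lborel_prod space_pair_measure)
  also have "\<dots> = ennreal (Re u - Re l) * ennreal (Im u - Im l)"
    using le' by (subst lborel.emeasure_pair_measure_Times) auto
  also have "\<dots> = (\<Prod>b\<in>Basis. (u - l) \<bullet> b)"
    using le' by (simp add: Basis_complex_def ennreal_mult')
  finally show "emeasure (distr (lborel \<Otimes>\<^sub>M lborel) borel (\<lambda>(x, y). Complex x y)) (box l u) = (\<Prod>b\<in>Basis. (u - l) \<bullet> b)" .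
qed simp

lemma continuous_on_cball_integrable:
  fixes g :: "complex \<Rightarrow> 'b::euclidean_space"
  assumes "continuous_on (cball 0 1) g"
  shows "set_integrable lborel (cball 0 1) g" "integrable (lebesgue_on (ball 0 1)) g"
    "integral\<^sup>L (lebesgue_on (ball 0 1)) g = (LINT z:cball 0 1|lborel. g z)"
proof -
  show 1: "set_integrable lborel (cball 0 1) g"
    unfolding set_integrable_def by (rule borel_integrable_compact[OF compact_cball assms])
  then have 2: "g absolutely_integrable_on cball 0 1"
    unfolding set_integrable_def by (subst integrable_completion) auto
  then have 3: "g absolutely_integrable_on ball 0 1"
    by (rule set_integrable_subset) auto
  then show 4: "integrable (lebesgue_on (ball 0 1)) g"
    by (simp add: integrable_restrict_space set_integrable_def)
  have "integral\<^sup>L (lebesgue_on (ball 0 1)) g = integral (ball 0 1) g"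
    using 4 by (rule lebesgue_integral_eq_integral) auto
  also have "\<dots> = integral (cball 0 1) g"
    by (rule integral_subset_negligible) (auto intro!: negligible_subset[OF negligible_sphere[of 0 1]])
  also have "\<dots> = (LINT z:cball 0 1|lborel. g z)"
    using set_borel_integral_eq_integral(2)[OF 1] by simp
  finally show "integral\<^sup>L (lebesgue_on (ball 0 1)) g = (LINT z:cball 0 1|lborel. g z)" .
qed

lemma Fubini_disc:
  fixes g :: "complex \<Rightarrow> complex"
  assumes "continuous_on (cball 0 1) g"
  shows "integral\<^sup>L (lebesgue_on (ball 0 1)) g
      = (\<integral>y. (\<integral>x. indicator (cball 0 1) (Complex x y) *\<^sub>R g (Complex x y) \<partial>lborel) \<partial>lborel)"
    "integral\<^sup>L (lebesgue_on (ball 0 1)) g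
      = (\<integral>x. (\<integral>y. indicator (cball 0 1) (Complex x y) *\<^sub>R g (Complex x y) \<partial>lborel) \<partial>lborel)"
proof -
  have m[measurable]: "(\<lambda>(x, y). Complex x y) \<in> lborel \<Otimes>\<^sub>M lborel \<rightarrow>\<^sub>M borel"
    using borel_measurable_continuous_onI[of "\<lambda>p. Complex (fst p) (snd p)"]
    by (simp add: lborel_prod case_prod_beta continuous_on_Complex continuous_on_fst continuous_on_snd continuous_on_id)
  let ?g = "\<lambda>z. indicator (cball 0 1) z *\<^sub>R g z"
  have int: "integrable lborel ?g"
    using continuous_on_cball_integrable(1)[OF assms] by (simp add: set_integrable_def)
  have gm: "?g \<in> borel_measurable borel" using int borel_measurable_integrable by force
  have i2: "integrable (lborel \<Otimes>\<^sub>M lborel) (\<lambda>(x, y). ?g (Complex x y))"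
    using int gm m by (subst (asm) lborel_complex, subst (asm) integrable_distr_eq) (auto simp: case_prod_beta')
  have "integral\<^sup>L (lebesgue_on (ball 0 1)) g = integral\<^sup>L lborel ?g"
    using continuous_on_cball_integrable(3)[OF assms] by (simp add: set_lebesgue_integral_def)
  also have "\<dots> = integral\<^sup>L (lborel \<Otimes>\<^sub>M lborel) (\<lambda>(x, y). ?g (Complex x y))"
    using gm m by (subst lborel_complex, subst integral_distr) (auto simp: case_prod_beta')
  finally have E: "integral\<^sup>L (lebesgue_on (ball 0 1)) g = integral\<^sup>L (lborel \<Otimes>\<^sub>M lborel) (\<lambda>(x, y). ?g (Complex x y))" .
  show "integral\<^sup>L (lebesgue_on (ball 0 1)) g
      = (\<integral>y. (\<integral>x. indicator (cball 0 1) (Complex x y) *\<^sub>R g (Complex x y) \<partial>lborel) \<partial>lborel)"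
    using lborel_pair.integral_snd[OF i2] E by simp
  show "integral\<^sup>L (lebesgue_on (ball 0 1)) g
      = (\<integral>x. (\<integral>y. indicator (cball 0 1) (Complex x y) *\<^sub>R g (Complex x y) \<partial>lborel) \<partial>lborel)"
    using lborel_pair.integral_fst[OF i2] E by simp
qed


lemma Complex_in_cball:
  "Complex x y \<in> cball 0 1 \<longleftrightarrow> \<bar>x\<bar> \<le> 1 \<and> y \<in> {- sqrt (1 - x\<^sup>2)..sqrt (1 - x\<^sup>2)}"
  "Complex y x \<in> cball 0 1 \<longleftrightarrow> \<bar>x\<bar> \<le> 1 \<and> y \<in> {- sqrt (1 - x\<^sup>2)..sqrt (1 - x\<^sup>2)}"
proof -
  have *: "x\<^sup>2 + y\<^sup>2 \<le> 1 \<longleftrightarrow> \<bar>x\<bar> \<le> 1 \<and> y \<in> {- sqrt (1 - x\<^sup>2)..sqrt (1 - x\<^sup>2)}"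
  proof (cases "\<bar>x\<bar> \<le> 1")
    case True
    then have x: "0 \<le> 1 - x\<^sup>2" by (simp add: abs_square_le_1)
    have "x\<^sup>2 + y\<^sup>2 \<le> 1 \<longleftrightarrow> sqrt (y\<^sup>2) \<le> sqrt (1 - x\<^sup>2)"
      by (auto simp only: real_sqrt_le_iff)
    also have "\<dots> \<longleftrightarrow> y \<in> {- sqrt (1 - x\<^sup>2)..sqrt (1 - x\<^sup>2)}" by auto
    finally show ?thesis using True by simp
  next
    case False
    then have "x\<^sup>2 > 1" using abs_square_le_1 not_le by blast
    then have "x\<^sup>2 + y\<^sup>2 > 1" by (smt (verit) zero_le_power2)
    then show ?thesis using False by simp
  qed
  then show "Complex x y \<in> cball 0 1 \<longleftrightarrow> \<bar>x\<bar> \<le> 1 \<and> y \<in> {- sqrt (1 - x\<^sup>2)..sqrt (1 - x\<^sup>2)}"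
    and "Complex y x \<in> cball 0 1 \<longleftrightarrow> \<bar>x\<bar> \<le> 1 \<and> y \<in> {- sqrt (1 - x\<^sup>2)..sqrt (1 - x\<^sup>2)}"
    by (simp_all add: cmod_def add.commute)
qed

text \<open>A semicircle is a graph over a diameter; the two semicircles are traversed in opposite directions,
  whence the two versions of the substitution rule.\<close>

lemma integral_substitution_increasing:
  fixes h :: "real \<Rightarrow> complex"
  assumes "a \<le> b" "g a = -1" "g b = 1" "g ` {a..b} \<subseteq> {-1..1}" "continuous_on {-1..1} h"
    and "\<And>x. x \<in> {a..b} \<Longrightarrow> (g has_field_derivative g' x) (at x within {a..b})"
  shows "((\<lambda>x. g' x *\<^sub>R h (g x)) has_integral integral {-1..1} h) {a..b}"
  using has_integral_substitution[of a b g "-1" 1 h g'] assms by simp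

lemma integral_substitution_decreasing:
  fixes h :: "real \<Rightarrow> complex"
  assumes "a \<le> b" "g a = 1" "g b = -1" "g ` {a..b} \<subseteq> {-1..1}" "continuous_on {-1..1} h"
    and "\<And>x. x \<in> {a..b} \<Longrightarrow> (g has_field_derivative g' x) (at x within {a..b})"
  shows "((\<lambda>x. g' x *\<^sub>R h (g x)) has_integral - integral {-1..1} h) {a..b}"
proof -
  have "continuous_on {a..b} g" by (rule DERIV_continuous_on[OF assms(6)])
  then show ?thesis
    using has_integral_substitution_general[of "{}" a b g "-1" 1 h g'] assms by simp
qed

text \<open>On each vertical chord the fundamental theorem leaves the difference of the end values. The
  substitution $x=\cos\theta$ turns the integrals over the upper and the lower end points into the integrals over
  the two halves of the circle.\<close>

lemma divergence_disc_y:
  fixes f :: "complex \<Rightarrow> complex"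
  assumes S: "open S" "cball 0 1 \<subseteq> S" and f: "Ck_on (Suc 0) S f"
  shows "integral\<^sup>L (lebesgue_on (ball 0 1)) (dy f) = integral {0..2 * pi} (\<lambda>\<theta>. sin \<theta> *\<^sub>R f (cis \<theta>))"
proof -
  have diff: "f differentiable (at z)" if "z \<in> cball 0 1" for z
    using Ck_on_differentiable[OF f] that S by blast
  have cf: "continuous_on (cball 0 1) f" and cdf: "continuous_on (cball 0 1) (dy f)"
    using Ck_on_imp_continuous_on[OF f] Ck_on_imp_continuous_on[OF Ck_on_dy[OF f]] S(2)
    by (auto intro: continuous_on_subset)
  define h1 where "h1 x = f (Complex x (sqrt (1 - x\<^sup>2)))" for x
  define h2 where "h2 x = f (Complex x (- sqrt (1 - x\<^sup>2)))" for x
  have c1: "continuous_on {-1..1} h1"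
    unfolding h1_def
    by (rule continuous_on_compose2[OF cf], intro continuous_intros)
       (auto simp: Complex_in_cball(1) abs_square_le_1 simp del: mem_cball mem_cball_0)
  have c2: "continuous_on {-1..1} h2"
    unfolding h2_def
    by (rule continuous_on_compose2[OF cf], intro continuous_intros)
       (auto simp: Complex_in_cball(1) abs_square_le_1 simp del: mem_cball mem_cball_0)
  have inner: "(\<integral>y. indicator (cball 0 1) (Complex x y) *\<^sub>R dy f (Complex x y) \<partial>lborel)
       = indicator {-1..1} x *\<^sub>R (h1 x - h2 x)" for x
  proof (cases "\<bar>x\<bar> \<le> 1")
    case True
    let ?s = "sqrt (1 - x\<^sup>2)"
    have s: "0 \<le> ?s" using True by (simp add: abs_square_le_1)
    have mem: "Complex x y \<in> cball 0 1" if "y \<in> {-?s..?s}" for y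
      using that True Complex_in_cball(1)[of x y] by blast
    have "(\<integral>y. indicator (cball 0 1) (Complex x y) *\<^sub>R dy f (Complex x y) \<partial>lborel)
        = (\<integral>y. indicator {-?s..?s} y *\<^sub>R dy f (Complex x y) \<partial>lborel)"
      using True by (intro Bochner_Integration.integral_cong) (auto simp: Complex_in_cball(1) indicator_def simp del: mem_cball mem_cball_0)
    also have "\<dots> = h1 x - h2 x" unfolding h1_def h2_def
    proof (rule integral_FTC_atLeastAtMost)
      fix y assume "-?s \<le> y" "y \<le> ?s"
      then show "((\<lambda>y. f (Complex x y)) has_vector_derivative dy f (Complex x y)) (at y within {-?s..?s})"
        by (intro has_vector_derivative_dy diff mem) simp
    next
      have "(\<lambda>y. Complex x y) ` {-?s..?s} \<subseteq> cball 0 1" using mem by blast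
      then show "continuous_on {-?s..?s} (\<lambda>y. dy f (Complex x y))"
        by (intro continuous_on_compose2[OF cdf, of _ "\<lambda>y. Complex x y"] continuous_intros)
    qed (use s in simp)
    finally show ?thesis using True by (simp add: abs_le_iff)
  next
    case False
    then have "indicator (cball 0 1) (Complex x y) = (0::real)" for y
      using Complex_in_cball(1)[of x y] by (simp add: indicator_def del: mem_cball mem_cball_0)
    then show ?thesis using False by (auto simp: indicator_def)
  qed
  have "integral\<^sup>L (lebesgue_on (ball 0 1)) (dy f) = (\<integral>x. indicator {-1..1} x *\<^sub>R (h1 x - h2 x) \<partial>lborel)"
    using Fubini_disc(2)[OF cdf] by (simp add: inner)
  also have "\<dots> = integral {-1..1} (\<lambda>x. h1 x - h2 x)"
    using set_borel_integral_eq_integral(2)[OF borel_integrable_atLeastAtMost'[OF continuous_on_diff[OF c1 c2]]]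
    by (simp add: set_lebesgue_integral_def)
  also have "\<dots> = integral {-1..1} h1 - integral {-1..1} h2"
    by (intro integral_diff integrable_continuous_real c1 c2)
  finally have E: "integral\<^sup>L (lebesgue_on (ball 0 1)) (dy f) = integral {-1..1} h1 - integral {-1..1} h2" .
  have "((\<lambda>\<theta>. - sin \<theta> *\<^sub>R h1 (cos \<theta>)) has_integral - integral {-1..1} h1) {0..pi}"
    by (rule integral_substitution_decreasing[OF _ _ _ _ c1 has_field_derivative_at_within[OF DERIV_cos]]) auto
  then have "((\<lambda>\<theta>. sin \<theta> *\<^sub>R h1 (cos \<theta>)) has_integral integral {-1..1} h1) {0..pi}"
    by (drule_tac has_integral_neg) simp
  moreover have "h1 (cos \<theta>) = f (cis \<theta>)" if "\<theta> \<in> {0..pi}" for \<theta>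
    using sin_ge_zero[of \<theta>] that by (simp add: h1_def cis.ctr sin_squared_eq[symmetric])
  ultimately have I1: "((\<lambda>\<theta>. sin \<theta> *\<^sub>R f (cis \<theta>)) has_integral integral {-1..1} h1) {0..pi}"
    by - (erule has_integral_eq[rotated], simp)
  have "((\<lambda>\<theta>. - sin \<theta> *\<^sub>R h2 (cos \<theta>)) has_integral integral {-1..1} h2) {pi..2*pi}"
    by (rule integral_substitution_increasing[OF _ _ _ _ c2 has_field_derivative_at_within[OF DERIV_cos]]) auto
  then have "((\<lambda>\<theta>. sin \<theta> *\<^sub>R h2 (cos \<theta>)) has_integral - integral {-1..1} h2) {pi..2*pi}"
    by (drule_tac has_integral_neg) simp
  moreover have "h2 (cos \<theta>) = f (cis \<theta>)" if "\<theta> \<in> {pi..2*pi}" for \<theta>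
    using sin_le_zero[of \<theta>] sin_2pi_minus[of \<theta>] sin_ge_zero[of "2*pi - \<theta>"] that by (simp add: h2_def cis.ctr sin_squared_eq[symmetric])
  ultimately have I2: "((\<lambda>\<theta>. sin \<theta> *\<^sub>R f (cis \<theta>)) has_integral - integral {-1..1} h2) {pi..2*pi}"
    by - (erule has_integral_eq[rotated], simp)
  have "((\<lambda>\<theta>. sin \<theta> *\<^sub>R f (cis \<theta>)) has_integral integral {-1..1} h1 + - integral {-1..1} h2) {0..2*pi}"
    by (rule has_integral_combine[OF _ _ I1 I2]) simp_all
  then show ?thesis by (simp add: E integral_unique)
qed

text \<open>The same with horizontal chords and $y=\sin\theta$. Here the natural parameter interval is
  $[-\pi/2,3\pi/2]$, so that finally a part of it is shifted by a period.\<close>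

lemma divergence_disc_x:
  fixes f :: "complex \<Rightarrow> complex"
  assumes S: "open S" "cball 0 1 \<subseteq> S" and f: "Ck_on (Suc 0) S f"
  shows "integral\<^sup>L (lebesgue_on (ball 0 1)) (dx f) = integral {0..2 * pi} (\<lambda>\<theta>. cos \<theta> *\<^sub>R f (cis \<theta>))"
proof -
  have diff: "f differentiable (at z)" if "z \<in> cball 0 1" for z
    using Ck_on_differentiable[OF f] that S by blast
  have cf: "continuous_on (cball 0 1) f" and cdf: "continuous_on (cball 0 1) (dx f)"
    using Ck_on_imp_continuous_on[OF f] Ck_on_imp_continuous_on[OF Ck_on_dx[OF f]] S(2)
    by (auto intro: continuous_on_subset)
  define h1 where "h1 x = f (Complex (sqrt (1 - x\<^sup>2)) x)" for x
  define h2 where "h2 x = f (Complex (- sqrt (1 - x\<^sup>2)) x)" for x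
  have c1: "continuous_on {-1..1} h1"
    unfolding h1_def
    by (rule continuous_on_compose2[OF cf], intro continuous_intros)
       (auto simp: Complex_in_cball(2) abs_square_le_1 simp del: mem_cball mem_cball_0)
  have c2: "continuous_on {-1..1} h2"
    unfolding h2_def
    by (rule continuous_on_compose2[OF cf], intro continuous_intros)
       (auto simp: Complex_in_cball(2) abs_square_le_1 simp del: mem_cball mem_cball_0)
  have inner: "(\<integral>x. indicator (cball 0 1) (Complex x y) *\<^sub>R dx f (Complex x y) \<partial>lborel)
       = indicator {-1..1} y *\<^sub>R (h1 y - h2 y)" for y
  proof (cases "\<bar>y\<bar> \<le> 1")
    case True
    let ?s = "sqrt (1 - y\<^sup>2)"
    have s: "0 \<le> ?s" using True by (simp add: abs_square_le_1)
    have mem: "Complex x y \<in> cball 0 1" if "x \<in> {-?s..?s}" for x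
      using that True Complex_in_cball(2)[of x y] by blast
    have "(\<integral>x. indicator (cball 0 1) (Complex x y) *\<^sub>R dx f (Complex x y) \<partial>lborel)
        = (\<integral>x. indicator {-?s..?s} x *\<^sub>R dx f (Complex x y) \<partial>lborel)"
      using True by (intro Bochner_Integration.integral_cong) (auto simp: Complex_in_cball(2) indicator_def simp del: mem_cball mem_cball_0)
    also have "\<dots> = h1 y - h2 y" unfolding h1_def h2_def
    proof (rule integral_FTC_atLeastAtMost)
      fix x assume "-?s \<le> x" "x \<le> ?s"
      then show "((\<lambda>x. f (Complex x y)) has_vector_derivative dx f (Complex x y)) (at x within {-?s..?s})"
        by (intro has_vector_derivative_dx diff mem) simp
    next
      have "(\<lambda>x. Complex x y) ` {-?s..?s} \<subseteq> cball 0 1" using mem by blast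
      then show "continuous_on {-?s..?s} (\<lambda>x. dx f (Complex x y))"
        by (intro continuous_on_compose2[OF cdf, of _ "\<lambda>x. Complex x y"] continuous_intros)
    qed (use s in simp)
    finally show ?thesis using True by (simp add: abs_le_iff)
  next
    case False
    then have "indicator (cball 0 1) (Complex x y) = (0::real)" for x
      using Complex_in_cball(2)[of x y] by (simp add: indicator_def del: mem_cball mem_cball_0)
    then show ?thesis using False by (auto simp: indicator_def)
  qed
  have "integral\<^sup>L (lebesgue_on (ball 0 1)) (dx f) = (\<integral>y. indicator {-1..1} y *\<^sub>R (h1 y - h2 y) \<partial>lborel)"
    using Fubini_disc(1)[OF cdf] by (simp add: inner)
  also have "\<dots> = integral {-1..1} (\<lambda>x. h1 x - h2 x)"
    using set_borel_integral_eq_integral(2)[OF borel_integrable_atLeastAtMost'[OF continuous_on_diff[OF c1 c2]]]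
    by (simp add: set_lebesgue_integral_def)
  also have "\<dots> = integral {-1..1} h1 - integral {-1..1} h2"
    by (intro integral_diff integrable_continuous_real c1 c2)
  finally have E: "integral\<^sup>L (lebesgue_on (ball 0 1)) (dx f) = integral {-1..1} h1 - integral {-1..1} h2" .
  have "((\<lambda>\<theta>. cos \<theta> *\<^sub>R h1 (sin \<theta>)) has_integral integral {-1..1} h1) {-(pi/2)..pi/2}"
    by (rule integral_substitution_increasing[OF _ _ _ _ c1 has_field_derivative_at_within[OF DERIV_sin]]) auto
  moreover have "h1 (sin \<theta>) = f (cis \<theta>)" if "\<theta> \<in> {-(pi/2)..pi/2}" for \<theta>
    using cos_ge_zero[of \<theta>] that by (simp add: h1_def cis.ctr cos_squared_eq[symmetric])
  ultimately have I1: "((\<lambda>\<theta>. cos \<theta> *\<^sub>R f (cis \<theta>)) has_integral integral {-1..1} h1) {-(pi/2)..pi/2}"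
    by - (erule has_integral_eq[rotated], simp)
  have "sin (3*pi/2) = -1" using sin_periodic_pi[of "pi/2"] by (simp add: field_simps)
  then have "((\<lambda>\<theta>. cos \<theta> *\<^sub>R h2 (sin \<theta>)) has_integral - integral {-1..1} h2) {pi/2..3*pi/2}"
    by (intro integral_substitution_decreasing[OF _ _ _ _ c2 has_field_derivative_at_within[OF DERIV_sin]]) auto
  moreover have "h2 (sin \<theta>) = f (cis \<theta>)" if "\<theta> \<in> {pi/2..3*pi/2}" for \<theta>
    using cos_ge_zero[of "\<theta> - pi"] that by (simp add: h2_def cis.ctr cos_squared_eq[symmetric] cos_diff)
  ultimately have I2: "((\<lambda>\<theta>. cos \<theta> *\<^sub>R f (cis \<theta>)) has_integral - integral {-1..1} h2) {pi/2..3*pi/2}"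
    by - (erule has_integral_eq[rotated], simp)
  have I12: "((\<lambda>\<theta>. cos \<theta> *\<^sub>R f (cis \<theta>)) has_integral integral {-1..1} h1 + - integral {-1..1} h2) {-(pi/2)..3*pi/2}"
    by (rule has_integral_combine[OF _ _ I1 I2]) simp_all
  let ?K = "\<lambda>\<theta>. cos \<theta> *\<^sub>R f (cis \<theta>)"
  have cK: "continuous_on A ?K" for A
    by (intro continuous_intros continuous_on_compose2[OF cf, of _ cis] continuous_on_cis) auto
  have "integral {0..2*pi} ?K = integral {0..3*pi/2} ?K + integral {3*pi/2..2*pi} ?K"
    by (rule Henstock_Kurzweil_Integration.integral_combine[symmetric]) (auto intro: integrable_continuous_real cK)
  also have "integral {3*pi/2..2*pi} ?K = integral {-(pi/2)..0} (?K \<circ> (\<lambda>x. x + 2*pi))"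
    using integral_shift[of "-(pi/2)" "2*pi" 0 ?K] cK by (simp add: algebra_simps)
  also have "?K \<circ> (\<lambda>x. x + 2*pi) = ?K" by (auto simp: fun_eq_iff cis.ctr)
  also have "integral {0..3*pi/2} ?K + integral {-(pi/2)..0} ?K = integral {-(pi/2)..3*pi/2} ?K"
    using Henstock_Kurzweil_Integration.integral_combine[of "-(pi/2)" 0 "3*pi/2" ?K] cK
    by (auto intro: integrable_continuous_real simp: add.commute)
  finally show ?thesis using I12 by (simp add: E integral_unique)
qed


text \<open>The divergence theorem, applied to the field $\psi\nabla^\perp\eta$, whose divergence is the
  Jacobian because mixed derivatives commute.\<close>

lemma Green_disc:
  fixes \<psi> \<eta> :: "complex \<Rightarrow> complex"
  assumes S: "open S" "cball 0 1 \<subseteq> S" and \<psi>: "Ck_on 1 S \<psi>" and \<eta>: "Ck_on 2 S \<eta>"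
  shows "integral\<^sup>L (lebesgue_on (ball 0 1)) (\<lambda>z. dx \<psi> z * dy \<eta> z - dy \<psi> z * dx \<eta> z)
    = integral {0..2 * pi} (\<lambda>\<theta>. \<psi> (cis \<theta>) * (cos \<theta> *\<^sub>R dy \<eta> (cis \<theta>) - sin \<theta> *\<^sub>R dx \<eta> (cis \<theta>)))"
proof -
  have \<psi>1: "Ck_on (Suc 0) S \<psi>" and \<eta>2: "Ck_on (Suc (Suc 0)) S \<eta>"
    using \<psi> \<eta> by (simp_all add: numeral_2_eq_2)
  define f where "f z = \<psi> z * dy \<eta> z" for z
  define h where "h z = \<psi> z * dx \<eta> z" for z
  have f: "Ck_on (Suc 0) S f" and h: "Ck_on (Suc 0) S h"
    unfolding f_def h_def by (intro Ck_on_mult S \<psi>1 Ck_on_dy Ck_on_dx \<eta>2)+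
  have "(f has_derivative (\<lambda>v. \<psi> z * frechet_derivative (dy \<eta>) (at z) v + frechet_derivative \<psi> (at z) v * dy \<eta> z)) (at z)"
    "(h has_derivative (\<lambda>v. \<psi> z * frechet_derivative (dx \<eta>) (at z) v + frechet_derivative \<psi> (at z) v * dx \<eta> z)) (at z)"
    if "z \<in> S" for z
    unfolding f_def[abs_def] h_def[abs_def]
    by (intro has_derivative_mult Ck_on_SucD(1)[OF \<psi>1 that] Ck_on_SucD(1)[OF Ck_on_dy[OF \<eta>2] that] Ck_on_SucD(1)[OF Ck_on_dx[OF \<eta>2] that])+
  note D = this[THEN frechet_derivative_at]
  have eq: "dx \<psi> z * dy \<eta> z - dy \<psi> z * dx \<eta> z = dx f z - dy h z" if "z \<in> ball 0 1" for z
  proof -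
    have "z \<in> S" using that S by auto
    then show ?thesis
      using mixed_derivatives_commute[OF S(1) \<eta>, of z] by (simp add: D[symmetric] algebra_simps)
  qed
  have c: "continuous_on (cball 0 1) (dx f)" "continuous_on (cball 0 1) (dy h)"
    using Ck_on_dx[OF f] Ck_on_dy[OF h] S(2) by (auto intro: continuous_on_subset)
  have sc: "cis ` {0..2*pi} \<subseteq> S" using S by auto
  have "continuous_on {0..2*pi} (\<lambda>\<theta>. f (cis \<theta>))" "continuous_on {0..2*pi} (\<lambda>\<theta>. h (cis \<theta>))"
    using continuous_on_compose2[OF Ck_on_imp_continuous_on[OF f] _ sc] continuous_on_compose2[OF Ck_on_imp_continuous_on[OF h] _ sc]
    by (auto simp: continuous_on_cis continuous_on_id)
  then have i: "(\<lambda>\<theta>. cos \<theta> *\<^sub>R f (cis \<theta>)) integrable_on {0..2*pi}" "(\<lambda>\<theta>. sin \<theta> *\<^sub>R h (cis \<theta>)) integrable_on {0..2*pi}"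
    by (auto intro!: integrable_continuous_real continuous_intros)
  have "integral\<^sup>L (lebesgue_on (ball 0 1)) (\<lambda>z. dx \<psi> z * dy \<eta> z - dy \<psi> z * dx \<eta> z)
      = integral\<^sup>L (lebesgue_on (ball 0 1)) (\<lambda>z. dx f z - dy h z)"
    by (intro Bochner_Integration.integral_cong) (auto simp: eq)
  also have "\<dots> = integral {0..2 * pi} (\<lambda>\<theta>. cos \<theta> *\<^sub>R f (cis \<theta>)) - integral {0..2 * pi} (\<lambda>\<theta>. sin \<theta> *\<^sub>R h (cis \<theta>))"
    using continuous_on_cball_integrable(2)[OF c(1)] continuous_on_cball_integrable(2)[OF c(2)]
      divergence_disc_x[OF S f] divergence_disc_y[OF S h] by simp
  also have "\<dots> = integral {0..2 * pi} (\<lambda>\<theta>. cos \<theta> *\<^sub>R f (cis \<theta>) - sin \<theta> *\<^sub>R h (cis \<theta>))"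
    by (rule integral_diff[symmetric]) (fact i)+
  finally show ?thesis by (simp add: f_def h_def algebra_simps)
qed

section \<open>Uniqueness of weak derivatives\<close>

definition box_bump :: "nat \<Rightarrow> 'a::euclidean_space \<Rightarrow> 'a \<Rightarrow> 'a \<Rightarrow> real" where
  "box_bump k a b x = (\<Prod>e\<in>Basis. flat 0 (real k * (x \<bullet> e - a \<bullet> e)) * flat 0 (real k * (b \<bullet> e - x \<bullet> e)))"

lemma flat_0_bounds: "0 \<le> flat 0 t" "flat 0 t \<le> 1"
  by (auto simp: flat_def)

lemma box_bump_bounds: "0 \<le> box_bump k a b x" "box_bump k a b x \<le> 1"
  unfolding box_bump_def
  by (auto intro!: prod_nonneg prod_le_1 mult_nonneg_nonneg mult_le_one flat_0_bounds)

lemma box_bump_nonzero: 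
  assumes "box_bump k a b x \<noteq> 0" shows "x \<in> box a b"
proof -
  have "a \<bullet> e < x \<bullet> e \<and> x \<bullet> e < b \<bullet> e" if "e \<in> Basis" for e
  proof -
    have "flat 0 (real k * (x \<bullet> e - a \<bullet> e)) \<noteq> 0" "flat 0 (real k * (b \<bullet> e - x \<bullet> e)) \<noteq> 0"
      using assms that unfolding box_bump_def by auto
    then have "real k * (x \<bullet> e - a \<bullet> e) > 0" "real k * (b \<bullet> e - x \<bullet> e) > 0"
      by (auto simp: flat_def split: if_splits)
    then show ?thesis by (auto simp: zero_less_mult_iff)
  qed
  then show ?thesis by (simp add: box_def)
qed

text \<open>This is how smooth test functions reach boxes: the approximation is bounded by $1$ and supported in the
  closed box, so that integrals against test functions determine the integrals over boxes.\<close>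

lemma box_bump_tendsto: "(\<lambda>k. box_bump k a b x) \<longlonglongrightarrow> indicator (box a b) x"
proof (cases "x \<in> box a b")
  case True
  have 1: "(\<lambda>k. flat 0 (real k * t)) \<longlonglongrightarrow> 1" if "t > 0" for t
  proof -
    have "(\<lambda>k. exp (- (inverse (real k) / t))) \<longlonglongrightarrow> exp (- (0 / t))"
      using that by (intro tendsto_intros lim_inverse_n) auto
    moreover have "\<forall>\<^sub>F k in sequentially. exp (- (inverse (real k) / t)) = flat 0 (real k * t)"
      using that by (intro eventually_sequentiallyI[of 1]) (auto simp: flat_def field_simps)
    ultimately show ?thesis using Lim_transform_eventually by fastforce
  qed
  have "(\<lambda>k. box_bump k a b x) \<longlonglongrightarrow> (\<Prod>e\<in>(Basis::'a set). 1 * 1)"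
    unfolding box_bump_def using True
    by (intro tendsto_prod tendsto_mult 1) (auto simp: box_def)
  then show ?thesis using True by simp
next
  case False
  then have "box_bump k a b x = 0" for k using box_bump_nonzero by blast
  then show ?thesis using False by simp
qed

lemma test_function_box_bump:
  assumes "cbox a b \<subseteq> \<Omega>"
  shows "test_function \<Omega> (box_bump k a b)"
proof -
  have sub: "closure {x. box_bump k a b x \<noteq> 0} \<subseteq> cbox a b"
    using box_bump_nonzero box_subset_cbox by (intro closure_minimal closed_cbox) blast
  have "Ck_on m UNIV (box_bump k a b)" for m
    unfolding box_bump_def[abs_def]
    by (intro Ck_on_prod Ck_on_mult Ck_on_flat Ck_on_diff Ck_on_const Ck_on_linear[OF _ bounded_linear_inner_left] open_UNIV)
  then show ?thesis
    unfolding test_function_def smooth_on_def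
    using sub assms compact_cbox[of a b] compact_Int_closed[of "cbox a b" "closure {x. box_bump k a b x \<noteq> 0}"]
    by (auto simp: Int_absorb1)
qed

lemma test_function_Ck: "test_function \<Omega> \<phi> \<Longrightarrow> Ck_on k UNIV \<phi>"
  by (simp add: test_function_def smooth_on_def)

lemma integrable_test_function_times:
  fixes v :: "'a::euclidean_space \<Rightarrow> 'b::euclidean_space"
  assumes cont: "continuous_on UNIV \<eta>" and "compact K" "K \<subseteq> \<Omega>" and zero: "\<And>x. x \<notin> K \<Longrightarrow> \<eta> x = 0"
    and v: "locally_integrable \<Omega> v" and \<Omega>: "open \<Omega>"
  shows "integrable (lebesgue_on \<Omega>) (\<lambda>x. \<eta> x *\<^sub>R v x)"
proof -
  have vK: "integrable lebesgue (\<lambda>x. indicator K x *\<^sub>R v x)"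
    using v assms by (auto simp: locally_integrable_def set_integrable_def)
  have "bounded (\<eta> ` K)"
    using compact_continuous_image[OF continuous_on_subset[OF cont] \<open>compact K\<close>] compact_imp_bounded by blast
  then obtain C where C: "\<And>x. x \<in> K \<Longrightarrow> norm (\<eta> x) \<le> C" by (auto simp: bounded_iff)
  have \<eta>m: "\<eta> \<in> borel_measurable lebesgue"
    using cont by (intro measurable_completion) (simp add: borel_measurable_continuous_onI)
  have "integrable lebesgue (\<lambda>x. \<eta> x *\<^sub>R (indicator K x *\<^sub>R v x))"
  proof (rule Bochner_Integration.integrable_bound)
    show "integrable lebesgue (\<lambda>x. C *\<^sub>R (indicator K x *\<^sub>R v x))"
      by (intro integrable_scaleR_right impI vK)
    show "AE x in lebesgue. norm (\<eta> x *\<^sub>R indicator K x *\<^sub>R v x) \<le> norm (C *\<^sub>R indicator K x *\<^sub>R v x)"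
    proof (rule AE_I2)
      fix x
      show "norm (\<eta> x *\<^sub>R indicator K x *\<^sub>R v x) \<le> norm (C *\<^sub>R indicator K x *\<^sub>R v x)"
        using order_trans[OF C[of x] abs_ge_self] by (auto simp: indicator_def intro!: mult_right_mono)
    qed
    show "(\<lambda>x. \<eta> x *\<^sub>R indicator K x *\<^sub>R v x) \<in> borel_measurable lebesgue"
      using \<eta>m borel_measurable_integrable[OF vK] by measurable
  qed
  also have "(\<lambda>x. \<eta> x *\<^sub>R (indicator K x *\<^sub>R v x)) = (\<lambda>x. indicator \<Omega> x *\<^sub>R (\<eta> x *\<^sub>R v x))"
    using assms zero by (auto simp: indicator_def fun_eq_iff)
  finally show ?thesis using \<Omega> by (subst integrable_restrict_space) auto
qed

lemma integrable_test_function: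
  fixes v :: "'a::euclidean_space \<Rightarrow> 'b::euclidean_space"
  assumes "test_function \<Omega> \<phi>" "locally_integrable \<Omega> v" "open \<Omega>"
  shows "integrable (lebesgue_on \<Omega>) (\<lambda>x. \<phi> x *\<^sub>R v x)"
    and "e \<in> Basis \<Longrightarrow> integrable (lebesgue_on \<Omega>) (\<lambda>x. frechet_derivative \<phi> (at x) e *\<^sub>R v x)"
proof -
  define K where "K = closure {x. \<phi> x \<noteq> 0}"
  have K: "compact K" "K \<subseteq> \<Omega>" using assms(1) by (auto simp: test_function_def K_def)
  have z: "\<phi> x = 0" if "x \<notin> K" for x using that unfolding K_def using closure_subset[of "{x. \<phi> x \<noteq> 0}"] by blast
  show "integrable (lebesgue_on \<Omega>) (\<lambda>x. \<phi> x *\<^sub>R v x)"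
    by (rule integrable_test_function_times[OF _ K z assms(2,3)])
       (use Ck_on_imp_continuous_on[OF test_function_Ck[OF assms(1), of 0]] in auto)
  assume e: "e \<in> Basis"
  have "frechet_derivative \<phi> (at x) e = 0" if "x \<notin> K" for x
  proof -
    have "((\<lambda>x. 0) has_derivative (\<lambda>v. 0)) (at x)" by simp
    then have "(\<phi> has_derivative (\<lambda>v. 0)) (at x)"
      by (rule has_derivative_transform_within_open[of _ _ _ _ "- K"]) (use that z K(1) in \<open>auto simp: compact_imp_closed\<close>)
    from frechet_derivative_at[OF this] show ?thesis by (simp add: fun_eq_iff)
  qed
  then show "integrable (lebesgue_on \<Omega>) (\<lambda>x. frechet_derivative \<phi> (at x) e *\<^sub>R v x)"
    by (rule integrable_test_function_times[OF _ K _ assms(2,3), rotated])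
       (use Ck_on_imp_continuous_on[OF Ck_on_SucD(2)[OF test_function_Ck[OF assms(1)] e, of 0]] in simp_all)
qed

lemma sigma_finite_lebesgue: "sigma_finite_measure (lebesgue :: 'a::euclidean_space measure)"
proof
  obtain A :: "'a set set" where A: "countable A" "A \<subseteq> sets lborel" "\<Union>A = space lborel" "\<forall>a\<in>A. emeasure lborel a \<noteq> \<infinity>"
    using lborel.sigma_finite_countable by blast
  have "\<forall>a\<in>A. emeasure lebesgue a \<noteq> \<infinity>" using A(2,4) by auto
  then show "\<exists>A::'a set set. countable A \<and> A \<subseteq> sets lebesgue \<and> \<Union>A = space lebesgue \<and> (\<forall>a\<in>A. emeasure lebesgue a \<noteq> \<infinity>)"
    using A(1-3) by (intro exI[of _ A]) auto
qed

text \<open>A $\pi$-$\lambda$ argument: the sets over which an integrable function has zero integral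
  form a Dynkin system once the whole space is among them.\<close>

lemma AE_zero_if_box_integrals_zero:
  fixes w :: "'a::euclidean_space \<Rightarrow> 'b::euclidean_space"
  assumes w: "integrable lebesgue w"
    and box: "\<And>a b. (LINT x:box a b|lebesgue. w x) = 0"
  shows "AE x in lebesgue. w x = 0"
proof (rule sigma_finite_measure.density_zero[OF sigma_finite_lebesgue w])
  have si: "set_integrable lebesgue A w" if "A \<in> sets lebesgue" for A
    unfolding set_integrable_def using integrable_mult_indicator[OF that w] .
  \<comment> \<open>the whole space is exhausted by centred boxes\<close>
  have whole: "(LINT x:UNIV|lebesgue. w x) = 0"
  proof -
    have "(\<lambda>n. LINT x:box (- real n *\<^sub>R One) (real n *\<^sub>R One)|lebesgue. w x) \<longlonglongrightarrow> (LINT x:UNIV|lebesgue. w x)"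
      unfolding set_lebesgue_integral_def
    proof (rule integral_dominated_convergence[where w = "\<lambda>x. norm (w x)"])
      show "AE x in lebesgue. (\<lambda>n. indicator (box (- real n *\<^sub>R One) (real n *\<^sub>R One)) x *\<^sub>R w x) \<longlonglongrightarrow> indicator UNIV x *\<^sub>R w x"
      proof (rule AE_I2)
        fix x :: 'a
        obtain N :: nat where N: "real N > norm x" using reals_Archimedean2 by blast
        have "x \<in> box (- real n *\<^sub>R One) (real n *\<^sub>R One)" if "n \<ge> N" for n
        proof -
          have "\<bar>x \<bullet> e\<bar> < real n" if "e \<in> Basis" for e
            using Basis_le_norm[OF that, of x] N \<open>n \<ge> N\<close> by linarith
          then show ?thesis by (auto simp: box_def abs_less_iff minus_less_iff)
        qed
        then show "(\<lambda>n. indicator (box (- real n *\<^sub>R One) (real n *\<^sub>R One)) x *\<^sub>R w x) \<longlonglongrightarrow> indicator UNIV x *\<^sub>R w x"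
          by (intro tendsto_eventually eventually_sequentiallyI[of N]) simp
      qed
      show "AE x in lebesgue. norm (indicator (box (- real n *\<^sub>R One) (real n *\<^sub>R One)) x *\<^sub>R w x) \<le> norm (w x)" for n
        by (intro AE_I2) (simp add: indicator_def)
    qed (use w in \<open>auto intro!: borel_measurable_scaleR borel_measurable_indicator\<close>)
    then show ?thesis unfolding box by (simp add: LIMSEQ_const_iff)
  qed
  have borel: "(LINT x:A|lebesgue. w x) = 0" if "A \<in> sets borel" for A
  proof -
    let ?G = "range (\<lambda>(a, b). box a b :: 'a set)"
    have "Int_stable ?G" by (auto simp: Int_stable_def box_Int_box)
    moreover have "?G \<subseteq> Pow UNIV" by simp
    moreover have "A \<in> sigma_sets UNIV ?G" using that by (simp add: borel_eq_box)
    ultimately show ?thesis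
    proof (induction rule: sigma_sets_induct_disjoint)
      case (basic A)
      then show ?case using box by auto
    next
      case (compl A)
      then have A: "A \<in> sets lebesgue" by (simp add: borel_eq_box)
      have "(LINT x:UNIV|lebesgue. w x) = (LINT x:A \<union> (UNIV - A)|lebesgue. w x)" by simp
      also have "\<dots> = (LINT x:A|lebesgue. w x) + (LINT x:UNIV - A|lebesgue. w x)"
        by (rule set_integral_Un) (use si[OF A] si[OF sets.compl_sets[OF A]] in simp_all)
      finally show ?case using compl whole by simp
    next
      case (union A)
      then have "A i \<in> sets (borel :: 'a measure)" for i by (simp add: borel_eq_box image_subset_iff)
      then have A: "A i \<in> sets lebesgue" for i by (simp add: sets_completionI_sets)
      have "(LINT x:(\<Union>i. A i)|lebesgue. w x) = (\<Sum>i. (LINT x:(A i)|lebesgue. w x))"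
        by (rule lebesgue_integral_countable_add) (use A union si in \<open>auto simp: disjoint_family_on_def\<close>)
      then show ?case using union by simp
    qed (simp add: set_lebesgue_integral_def)
  qed
  fix A :: "'a set" assume "A \<in> sets lebesgue"
  then obtain T N N' where A: "A = T \<union> N" "N \<subseteq> N'" "N' \<in> null_sets lborel" "T \<in> sets lborel"
    by (auto elim: sets_completionE)
  have "N' \<in> null_sets lebesgue" using A(3) by (simp add: null_sets_completionI)
  then have "AE x in lebesgue. x \<notin> N'" by (rule AE_not_in)
  then have "(LINT x:A|lebesgue. w x) = (LINT x:T|lebesgue. w x)"
    unfolding set_lebesgue_integral_def
    by (intro integral_cong_AE borel_measurable_scaleR borel_measurable_indicator borel_measurable_integrable[OF w])
       (use A \<open>A \<in> sets lebesgue\<close> in \<open>auto simp: indicator_def\<close>)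
  then show "(LINT x:A|lebesgue. w x) = 0" using borel[of T] A(4) by simp
qed

text \<open>Integrals over boxes with closure in the domain vanish, by approximation with smooth bumps. This makes
  the function zero almost everywhere in each such closed box, and countably many of them cover the domain.\<close>

lemma fundamental_lemma_variations:
  fixes v :: "'a::euclidean_space \<Rightarrow> 'b::euclidean_space"
  assumes \<Omega>: "open \<Omega>" and v: "locally_integrable \<Omega> v"
    and test: "\<And>\<phi>. test_function \<Omega> \<phi> \<Longrightarrow> (\<integral>x. \<phi> x *\<^sub>R v x \<partial>lebesgue_on \<Omega>) = 0"
  shows "AE x in lebesgue_on \<Omega>. v x = 0"
proof -
  have int: "integrable lebesgue (\<lambda>x. indicator (cbox a b) x *\<^sub>R v x)" if "cbox a b \<subseteq> \<Omega>" for a b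
    using v that by (auto simp: locally_integrable_def set_integrable_def)
  have b0: "(LINT x:box a b|lebesgue. v x) = 0" if sub: "cbox a b \<subseteq> \<Omega>" for a b
  proof -
    have "(\<lambda>k. \<integral>x. box_bump k a b x *\<^sub>R indicator (cbox a b) x *\<^sub>R v x \<partial>lebesgue)
       \<longlonglongrightarrow> (\<integral>x. indicator (box a b) x *\<^sub>R v x \<partial>lebesgue)"
    proof (rule integral_dominated_convergence[where w = "\<lambda>x. norm (indicator (cbox a b) x *\<^sub>R v x)"])
      have "Ck_on 0 UNIV (box_bump k a b)" for k
        using test_function_Ck[OF test_function_box_bump[OF sub]] .
      then have bm: "box_bump k a b \<in> borel_measurable lebesgue" for k
        by (intro measurable_completion) (simp add: borel_measurable_continuous_onI)
      show "(\<lambda>x. box_bump k a b x *\<^sub>R indicator (cbox a b) x *\<^sub>R v x) \<in> borel_measurable lebesgue" for k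
        by (intro borel_measurable_scaleR bm borel_measurable_integrable[OF int[OF sub]])
      have "(\<lambda>x. indicator (box a b) x *\<^sub>R indicator (cbox a b) x *\<^sub>R v x) \<in> borel_measurable lebesgue"
        by (intro borel_measurable_scaleR borel_measurable_indicator borel_measurable_integrable[OF int[OF sub]]) auto
      also have "(\<lambda>x. indicator (box a b) x *\<^sub>R indicator (cbox a b) x *\<^sub>R v x) = (\<lambda>x. indicator (box a b) x *\<^sub>R v x)"
        using box_subset_cbox[of a b] by (auto simp: indicator_def fun_eq_iff)
      finally show "(\<lambda>x. indicator (box a b) x *\<^sub>R v x) \<in> borel_measurable lebesgue" .
      show "integrable lebesgue (\<lambda>x. norm (indicator (cbox a b) x *\<^sub>R v x))" using int[OF sub] by (rule integrable_norm)
      show "AE x in lebesgue. (\<lambda>k. box_bump k a b x *\<^sub>R indicator (cbox a b) x *\<^sub>R v x) \<longlonglongrightarrow> indicator (box a b) x *\<^sub>R v x"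
      proof (rule AE_I2)
        fix x
        have "(\<lambda>k. box_bump k a b x *\<^sub>R indicator (cbox a b) x *\<^sub>R v x) \<longlonglongrightarrow> indicator (box a b) x *\<^sub>R indicator (cbox a b) x *\<^sub>R v x"
          by (intro tendsto_scaleR box_bump_tendsto tendsto_const)
        moreover have "indicator (box a b) x *\<^sub>R indicator (cbox a b) x *\<^sub>R v x = indicator (box a b) x *\<^sub>R v x"
          using box_subset_cbox[of a b] by (auto simp: indicator_def)
        ultimately show "(\<lambda>k. box_bump k a b x *\<^sub>R indicator (cbox a b) x *\<^sub>R v x) \<longlonglongrightarrow> indicator (box a b) x *\<^sub>R v x" by (simp only:)
      qed
      show "AE x in lebesgue. norm (box_bump k a b x *\<^sub>R indicator (cbox a b) x *\<^sub>R v x) \<le> norm (indicator (cbox a b) x *\<^sub>R v x)" for k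
        using box_bump_bounds[of k a b] by (intro AE_I2) (simp add: indicator_def mult_left_le_one_le)
    qed
    moreover have "(\<integral>x. box_bump k a b x *\<^sub>R indicator (cbox a b) x *\<^sub>R v x \<partial>lebesgue) = 0" for k
    proof -
      have "(\<integral>x. box_bump k a b x *\<^sub>R indicator (cbox a b) x *\<^sub>R v x \<partial>lebesgue) = (\<integral>x. indicator \<Omega> x *\<^sub>R (box_bump k a b x *\<^sub>R v x) \<partial>lebesgue)"
      proof (intro Bochner_Integration.integral_cong refl)
        fix x
        show "box_bump k a b x *\<^sub>R indicator (cbox a b) x *\<^sub>R v x = indicator \<Omega> x *\<^sub>R box_bump k a b x *\<^sub>R v x"
          using box_bump_nonzero[of k a b x] box_subset_cbox[of a b] sub by (auto simp: indicator_def)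
      qed
      also have "\<dots> = (\<integral>x. box_bump k a b x *\<^sub>R v x \<partial>lebesgue_on \<Omega>)"
        using \<Omega> by (subst integral_restrict_space) auto
      finally show ?thesis using test[OF test_function_box_bump[OF sub]] by simp
    qed
    ultimately show ?thesis by (simp add: LIMSEQ_const_iff set_lebesgue_integral_def)
  qed
  have cb: "AE x in lebesgue. x \<in> cbox c d \<longrightarrow> v x = 0" if sub: "cbox c d \<subseteq> \<Omega>" for c d
  proof -
    define w where "w x = indicator (box c d) x *\<^sub>R v x" for x
    have "(\<lambda>x. indicator (box c d) x *\<^sub>R indicator (cbox c d) x *\<^sub>R v x) = w"
      using box_subset_cbox[of c d] by (auto simp: w_def indicator_def fun_eq_iff)
    then have wi: "integrable lebesgue w"
      using integrable_mult_indicator[OF _ int[OF sub], of "box c d"] by simp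
    have "(LINT x:box a b|lebesgue. w x) = 0" for a b
    proof -
      obtain a' b' where ab: "box a b \<inter> box c d = box a' b'" by (rule that[OF box_Int_box])
      have "cbox a' b' \<subseteq> \<Omega> \<or> box a' b' = {}"
      proof (cases "box a' b' = {}")
        case False
        have "box a' b' \<subseteq> box c d" unfolding ab[symmetric] by (rule Int_lower2)
        then have "box a' b' \<subseteq> cbox c d" using box_subset_cbox by (rule subset_trans)
        then have "closure (box a' b') \<subseteq> cbox c d" by (rule closure_minimal) (rule closed_cbox)
        then show ?thesis using closure_box[OF False] subset_trans[OF _ sub] by simp
      qed simp
      then have "(LINT x:box a' b'|lebesgue. v x) = 0" 
        by (elim disjE, intro b0) (simp_all only: set_lebesgue_integral_def indicator_def empty_iff of_bool_eq scaleR_zero_left Bochner_Integration.integral_zero)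
      moreover have "(LINT x:box a b|lebesgue. w x) = (LINT x:box a' b'|lebesgue. v x)"
        unfolding set_lebesgue_integral_def w_def
        by (intro Bochner_Integration.integral_cong) (auto simp only: ab[symmetric] indicator_def Int_iff scaleR_one scaleR_zero_left of_bool_def scaleR_zero_right split: if_splits)
      ultimately show ?thesis by simp
    qed
    from AE_zero_if_box_integrals_zero[OF wi this]
    have 1: "AE x in lebesgue. w x = 0" .
    have "cbox c d - box c d \<in> null_sets lebesgue"
      using negligible_frontier_interval[of c d] negligible_iff_null_sets by blast
    then have 2: "AE x in lebesgue. x \<notin> cbox c d - box c d" by (rule AE_not_in)
    show ?thesis using 1 2 by eventually_elim (auto simp: w_def indicator_def split: if_splits)
  qed
  obtain \<D> where \<D>: "countable \<D>" "\<D> \<subseteq> Pow \<Omega>" "\<And>X. X \<in> \<D> \<Longrightarrow> \<exists>a b. X = cbox a b" "\<Union>\<D> = \<Omega>"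
    using open_countable_Union_open_cbox[OF \<Omega>] by blast
  have "AE x in lebesgue. \<forall>X\<in>\<D>. x \<in> X \<longrightarrow> v x = 0"
  proof (subst AE_ball_countable[OF \<D>(1)], intro ballI)
    fix X assume X: "X \<in> \<D>"
    then obtain a b where "X = cbox a b" using \<D>(3) by blast
    then show "AE x in lebesgue. x \<in> X \<longrightarrow> v x = 0" using cb[of a b] X \<D>(2) by auto
  qed
  then have "AE x in lebesgue. x \<in> \<Omega> \<longrightarrow> v x = 0"
    using \<D>(4) by (auto elim!: eventually_mono)
  then show ?thesis using \<Omega> by (subst AE_restrict_space_iff) auto
qed

lemma locally_integrable_diff:
  "locally_integrable \<Omega> u \<Longrightarrow> locally_integrable \<Omega> v \<Longrightarrow> locally_integrable \<Omega> (\<lambda>x. u x - v x)"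
  by (auto simp: locally_integrable_def intro: set_integral_diff)

lemma has_weak_deriv_unique:
  assumes "open \<Omega>" "has_weak_deriv \<Omega> e u v" "has_weak_deriv \<Omega> e u w"
  shows "AE x in lebesgue_on \<Omega>. v x = w x"
proof -
  have l: "locally_integrable \<Omega> v" "locally_integrable \<Omega> w"
    using assms by (auto simp: has_weak_deriv_def)
  have "AE x in lebesgue_on \<Omega>. v x - w x = 0"
  proof (rule fundamental_lemma_variations[OF assms(1) locally_integrable_diff[OF l]])
    fix \<phi> assume t: "test_function \<Omega> \<phi>"
    show "(\<integral>x. \<phi> x *\<^sub>R (v x - w x) \<partial>lebesgue_on \<Omega>) = 0"
      using assms(2,3) t integrable_test_function(1)[OF t l(1) assms(1)] integrable_test_function(1)[OF t l(2) assms(1)]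
      by (auto simp: has_weak_deriv_def scaleR_diff_right)
  qed
  then show ?thesis by simp
qed

lemma weak_deriv_AE_eq:
  assumes "open \<Omega>" "has_weak_deriv \<Omega> e u v"
  shows "AE x in lebesgue_on \<Omega>. weak_deriv \<Omega> e u x = v x"
  using has_weak_deriv_unique[OF assms(1) _ assms(2)] someI[of "has_weak_deriv \<Omega> e u", OF assms(2)]
  unfolding weak_deriv_def by blast

lemma has_weak_deriv_diff:
  assumes "open \<Omega>" "e \<in> Basis" "has_weak_deriv \<Omega> e u1 v1" "has_weak_deriv \<Omega> e u2 v2"
  shows "has_weak_deriv \<Omega> e (\<lambda>x. u1 x - u2 x) (\<lambda>x. v1 x - v2 x)"
proof -
  have l: "locally_integrable \<Omega> u1" "locally_integrable \<Omega> u2" "locally_integrable \<Omega> v1" "locally_integrable \<Omega> v2"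
    using assms(3,4) by (auto simp: has_weak_deriv_def)
  show ?thesis
    unfolding has_weak_deriv_def
    using assms(3,4) l locally_integrable_diff
    by (auto simp: has_weak_deriv_def scaleR_diff_right integrable_test_function[OF _ _ assms(1)] assms(2))
qed

lemma continuous_on_cball_imp_locally_integrable:
  fixes f :: "complex \<Rightarrow> 'b::euclidean_space"
  assumes "continuous_on (cball 0 1) f"
  shows "locally_integrable (ball 0 1) f"
  unfolding locally_integrable_def
proof (intro allI impI)
  fix K :: "complex set" assume K: "compact K \<and> K \<subseteq> ball 0 1"
  then have "continuous_on K f" using assms by (meson ball_subset_cball continuous_on_subset subset_trans)
  then have "integrable lborel (\<lambda>x. indicator K x *\<^sub>R f x)"
    using K borel_integrable_compact by blast
  then show "f absolutely_integrable_on K"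
    unfolding set_integrable_def by (subst integrable_completion) auto
qed

text \<open>For a function which is $C^1$ up to the boundary, the divergence theorem for its product with a test
  function has no boundary term.\<close>

lemma has_weak_deriv_classical:
  fixes f :: "complex \<Rightarrow> complex"
  assumes S: "open S" "cball 0 1 \<subseteq> S" and f: "Ck_on (Suc 0) S f" and e: "e \<in> Basis"
  shows "has_weak_deriv (ball 0 1) e f (\<lambda>z. frechet_derivative f (at z) e)"
proof -
  have cf: "continuous_on (cball 0 1) f" and cdf: "continuous_on (cball 0 1) (\<lambda>z. frechet_derivative f (at z) e)"
    using Ck_on_imp_continuous_on[OF f] Ck_on_imp_continuous_on[OF Ck_on_SucD(2)[OF f e]] S(2)
    by (auto intro: continuous_on_subset)
  note l = continuous_on_cball_imp_locally_integrable[OF cf] continuous_on_cball_imp_locally_integrable[OF cdf]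
  show ?thesis unfolding has_weak_deriv_def
  proof (intro conjI allI impI l)
    fix \<phi> :: "complex \<Rightarrow> real" assume t: "test_function (ball 0 1) \<phi>"
    have \<phi>C: "Ck_on (Suc 0) S \<phi>" using test_function_Ck[OF t] Ck_on_subset by blast
    define p where "p z = \<phi> z *\<^sub>R f z" for z
    have p: "Ck_on (Suc 0) S p" unfolding p_def[abs_def] by (intro Ck_on_scaleR S \<phi>C f)
    have D: "frechet_derivative p (at z) e = frechet_derivative \<phi> (at z) e *\<^sub>R f z + \<phi> z *\<^sub>R frechet_derivative f (at z) e"
      if "z \<in> S" for z
    proof -
      have "(p has_derivative (\<lambda>h. \<phi> z *\<^sub>R frechet_derivative f (at z) h + frechet_derivative \<phi> (at z) h *\<^sub>R f z)) (at z)"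
        unfolding p_def[abs_def]
        by (intro has_derivative_scaleR Ck_on_SucD(1)[OF \<phi>C that] Ck_on_SucD(1)[OF f that])
      from frechet_derivative_at[OF this] show ?thesis by (metis add.commute)
    qed
    have z: "p (cis \<theta>) = 0" for \<theta>
    proof -
      have "cis \<theta> \<notin> closure {x. \<phi> x \<noteq> 0}" using t by (auto simp: test_function_def)
      then have "\<phi> (cis \<theta>) = 0" using closure_subset[of "{x. \<phi> x \<noteq> 0}"] by blast
      then show ?thesis by (simp add: p_def)
    qed
    have "(\<integral>x. frechet_derivative p (at x) e \<partial>lebesgue_on (ball 0 1)) = 0"
      using e divergence_disc_x[OF S p] divergence_disc_y[OF S p] by (auto simp: Basis_complex_def z)
    also have "(\<integral>x. frechet_derivative p (at x) e \<partial>lebesgue_on (ball 0 1))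
       = (\<integral>x. frechet_derivative \<phi> (at x) e *\<^sub>R f x + \<phi> x *\<^sub>R frechet_derivative f (at x) e \<partial>lebesgue_on (ball 0 1))"
      using S by (intro Bochner_Integration.integral_cong) (auto simp: D subset_iff)
    finally show "(\<integral>x. frechet_derivative \<phi> (at x) e *\<^sub>R f x \<partial>lebesgue_on (ball 0 1))
        = - (\<integral>x. \<phi> x *\<^sub>R frechet_derivative f (at x) e \<partial>lebesgue_on (ball 0 1))"
      using integrable_test_function(2)[OF t l(1) open_ball e] integrable_test_function(1)[OF t l(2) open_ball]
      by (simp add: eq_neg_iff_add_eq_0)
  qed
qed

section \<open>Square integrable functions\<close>

abbreviation L2_tendsto :: "'a::euclidean_space set \<Rightarrow> (nat \<Rightarrow> 'a \<Rightarrow> 'b::euclidean_space) \<Rightarrow> ('a \<Rightarrow> 'b) \<Rightarrow> bool" where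
  "L2_tendsto \<Omega> f F \<equiv> (\<lambda>n. \<integral>x. (norm (f n x - F x))\<^sup>2 \<partial>lebesgue_on \<Omega>) \<longlonglongrightarrow> 0"

lemma L2D: "u \<in> L2 \<Omega> \<Longrightarrow> u \<in> borel_measurable (lebesgue_on \<Omega>)"
  "u \<in> L2 \<Omega> \<Longrightarrow> integrable (lebesgue_on \<Omega>) (\<lambda>x. (norm (u x))\<^sup>2)"
  by (auto simp: L2_def)

lemma L2_bound:
  assumes "v \<in> borel_measurable (lebesgue_on \<Omega>)" "u \<in> L2 \<Omega>"
    and "AE x in lebesgue_on \<Omega>. norm (v x) \<le> C * norm (u x)"
  shows "v \<in> L2 \<Omega>"
proof -
  have "integrable (lebesgue_on \<Omega>) (\<lambda>x. (norm (v x))\<^sup>2)"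
  proof (rule Bochner_Integration.integrable_bound)
    show "integrable (lebesgue_on \<Omega>) (\<lambda>x. C\<^sup>2 * (norm (u x))\<^sup>2)" using L2D(2)[OF assms(2)] by simp
    show "AE x in lebesgue_on \<Omega>. norm ((norm (v x))\<^sup>2) \<le> norm (C\<^sup>2 * (norm (u x))\<^sup>2)"
      using assms(3)
    proof eventually_elim
      case (elim x)
      then have "(norm (v x))\<^sup>2 \<le> (C * norm (u x))\<^sup>2" by (intro power_mono) auto
      then show ?case by (simp add: power_mult_distrib)
    qed
  qed (use assms(1) in measurable)
  then show ?thesis using assms(1) by (simp add: L2_def)
qed

lemma norm_add_sq_le: "(norm (a + b))\<^sup>2 \<le> 2 * (norm a)\<^sup>2 + 2 * (norm b)\<^sup>2"
  for a b :: "'b::real_normed_vector"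
proof -
  have "(norm (a + b))\<^sup>2 \<le> (norm a + norm b)\<^sup>2" by (intro power_mono norm_triangle_ineq) simp
  also have "\<dots> \<le> 2 * (norm a)\<^sup>2 + 2 * (norm b)\<^sup>2" 
    using sum_squares_bound[of "norm a" "norm b"] by (simp add: power2_sum)
  finally show ?thesis .
qed

lemma norm_diff_sq_le: "(norm (a - b))\<^sup>2 \<le> 2 * (norm a)\<^sup>2 + 2 * (norm b)\<^sup>2"
  for a b :: "'b::real_normed_vector"
  using norm_add_sq_le[of a "- b"] by simp

lemma L2_add:
  assumes "u \<in> L2 \<Omega>" "v \<in> L2 \<Omega>"
  shows "(\<lambda>x. u x + v x) \<in> L2 \<Omega>"
proof -
  have [measurable]: "u \<in> borel_measurable (lebesgue_on \<Omega>)" "v \<in> borel_measurable (lebesgue_on \<Omega>)"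
    using assms by (auto simp: L2_def)
  have "integrable (lebesgue_on \<Omega>) (\<lambda>x. (norm (u x + v x))\<^sup>2)"
    by (rule Bochner_Integration.integrable_bound[of _ "\<lambda>x. 2 * (norm (u x))\<^sup>2 + 2 * (norm (v x))\<^sup>2"])
       (use L2D(2)[OF assms(1)] L2D(2)[OF assms(2)] norm_add_sq_le in auto)
  then show ?thesis by (simp add: L2_def)
qed

lemma L2_uminus: "u \<in> L2 \<Omega> \<Longrightarrow> (\<lambda>x. - u x) \<in> L2 \<Omega>"
  by (auto simp: L2_def)

lemma L2_diff: "u \<in> L2 \<Omega> \<Longrightarrow> v \<in> L2 \<Omega> \<Longrightarrow> (\<lambda>x. u x - v x) \<in> L2 \<Omega>"
  using L2_add[OF _ L2_uminus, of u \<Omega> v] by simp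

lemma L2_integrable_norm_mult:
  assumes "u \<in> L2 \<Omega>" "v \<in> L2 \<Omega>"
  shows "integrable (lebesgue_on \<Omega>) (\<lambda>x. norm (u x) * norm (v x))"
proof (rule Bochner_Integration.integrable_bound)
  show "integrable (lebesgue_on \<Omega>) (\<lambda>x. (norm (u x))\<^sup>2 + (norm (v x))\<^sup>2)"
    using L2D(2)[OF assms(1)] L2D(2)[OF assms(2)] by simp
  have "norm (u x) * norm (v x) \<le> (norm (u x))\<^sup>2 + (norm (v x))\<^sup>2" for x
    using sum_squares_bound[of "norm (u x)" "norm (v x)"] mult_nonneg_nonneg[OF norm_ge_zero[of "u x"] norm_ge_zero[of "v x"]]
    by linarith
  then show "AE x in lebesgue_on \<Omega>. norm (norm (u x) * norm (v x)) \<le> norm ((norm (u x))\<^sup>2 + (norm (v x))\<^sup>2)"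
    by (simp add: abs_mult)
  show "(\<lambda>x. norm (u x) * norm (v x)) \<in> borel_measurable (lebesgue_on \<Omega>)"
    using L2D(1)[OF assms(1)] L2D(1)[OF assms(2)] by measurable
qed

lemma L2_integrable_mult:
  fixes u v :: "'a::euclidean_space \<Rightarrow> complex"
  assumes "u \<in> L2 \<Omega>" "v \<in> L2 \<Omega>"
  shows "integrable (lebesgue_on \<Omega>) (\<lambda>x. u x * v x)"
  by (rule Bochner_Integration.integrable_bound[OF L2_integrable_norm_mult[OF assms]])
     (use L2D(1)[OF assms(1)] L2D(1)[OF assms(2)] in \<open>auto simp: norm_mult intro!: borel_measurable_times\<close>)

lemma L2_Cauchy_Schwarz:
  assumes u: "u \<in> L2 \<Omega>" and v: "v \<in> L2 \<Omega>"
  shows "(\<integral>x. norm (u x) * norm (v x) \<partial>lebesgue_on \<Omega>)\<^sup>2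
    \<le> (\<integral>x. (norm (u x))\<^sup>2 \<partial>lebesgue_on \<Omega>) * (\<integral>x. (norm (v x))\<^sup>2 \<partial>lebesgue_on \<Omega>)"
proof -
  let ?M = "lebesgue_on \<Omega>"
  define P A Q where "P = (\<integral>x. norm (u x) * norm (v x) \<partial>?M)" and "A = (\<integral>x. (norm (u x))\<^sup>2 \<partial>?M)"
    and "Q = (\<integral>x. (norm (v x))\<^sup>2 \<partial>?M)"
  have quad: "0 \<le> A - 2 * t * P + t\<^sup>2 * Q" for t
  proof -
    have "0 \<le> (\<integral>x. (norm (u x) - t * norm (v x))\<^sup>2 \<partial>?M)" by simp
    also have "\<dots> = (\<integral>x. (norm (u x))\<^sup>2 - 2 * t * (norm (u x) * norm (v x)) + t\<^sup>2 * (norm (v x))\<^sup>2 \<partial>?M)"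
      by (simp add: power2_diff power_mult_distrib algebra_simps)
    also have "\<dots> = A - 2 * t * P + t\<^sup>2 * Q"
      unfolding A_def P_def Q_def
      using L2D(2)[OF u] L2D(2)[OF v] L2_integrable_norm_mult[OF u v] by simp
    finally show ?thesis .
  qed
  have Q0: "Q \<ge> 0" by (simp add: Q_def)
  show ?thesis
  proof (cases "Q = 0")
    case False
    with quad[of "P / Q"] Q0 have "P\<^sup>2 \<le> A * Q"
      by (simp add: field_simps power2_eq_square)
    then show ?thesis by (simp add: P_def A_def Q_def)
  next
    case True
    then have "AE x in ?M. (norm (v x))\<^sup>2 = 0"
      unfolding Q_def using L2D(2)[OF v] by (subst (asm) integral_nonneg_eq_0_iff_AE) auto
    then have "P = 0" unfolding P_def by (intro integral_eq_zero_AE) (auto elim!: eventually_mono)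
    then show ?thesis using True by (simp add: P_def[symmetric] Q_def[symmetric])
  qed
qed

text \<open>Convergence in $L^2$ passes to the pairing with a fixed square integrable function.\<close>

lemma L2_tendsto_pairing:
  fixes f :: "nat \<Rightarrow> 'a::euclidean_space \<Rightarrow> complex"
  assumes f: "\<And>n. f n \<in> L2 \<Omega>" "F \<in> L2 \<Omega>" and g: "g \<in> L2 \<Omega>"
    and lim: "L2_tendsto \<Omega> f F"
  shows "(\<lambda>n. \<integral>x. f n x * g x \<partial>lebesgue_on \<Omega>) \<longlonglongrightarrow> (\<integral>x. F x * g x \<partial>lebesgue_on \<Omega>)"
proof -
  let ?M = "lebesgue_on \<Omega>"
  define G where "G = (\<integral>x. (norm (g x))\<^sup>2 \<partial>?M)"
  have d: "(\<lambda>x. f n x - F x) \<in> L2 \<Omega>" for n by (intro L2_diff f)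
  have le: "norm ((\<integral>x. f n x * g x \<partial>?M) - (\<integral>x. F x * g x \<partial>?M))
     \<le> sqrt ((\<integral>x. (norm (f n x - F x))\<^sup>2 \<partial>?M) * G)" for n
  proof -
    have "(\<integral>x. f n x * g x \<partial>?M) - (\<integral>x. F x * g x \<partial>?M) = (\<integral>x. (f n x - F x) * g x \<partial>?M)"
      using L2_integrable_mult[OF f(1)[of n] g] L2_integrable_mult[OF f(2) g] by (simp add: algebra_simps)
    also have "norm \<dots> \<le> (\<integral>x. norm ((f n x - F x) * g x) \<partial>?M)" by (rule integral_norm_bound)
    also have "\<dots> = (\<integral>x. norm (f n x - F x) * norm (g x) \<partial>?M)" by (simp add: norm_mult)
    also have "\<dots> \<le> sqrt ((\<integral>x. (norm (f n x - F x))\<^sup>2 \<partial>?M) * G)"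
      using L2_Cauchy_Schwarz[OF d[of n] g] by (intro real_le_rsqrt) (simp add: G_def)
    finally show ?thesis .
  qed
  have "(\<lambda>n. sqrt ((\<integral>x. (norm (f n x - F x))\<^sup>2 \<partial>?M) * G)) \<longlonglongrightarrow> sqrt (0 * G)"
    by (intro tendsto_intros lim)
  then have "(\<lambda>n. (\<integral>x. f n x * g x \<partial>?M) - (\<integral>x. F x * g x \<partial>?M)) \<longlonglongrightarrow> 0"
    by (intro Lim_null_comparison[OF always_eventually[rule_format, OF le]]) simp
  then show ?thesis by (simp add: LIM_zero_iff)
qed

lemma L2_limit_triangle:
  assumes f: "\<And>n. f n \<in> L2 \<Omega>" and h: "\<And>n. h n \<in> L2 \<Omega>" and F: "F \<in> L2 \<Omega>"
    and lim: "(\<lambda>n. \<integral>x. (norm (f n x - h n x))\<^sup>2 \<partial>lebesgue_on \<Omega>) \<longlonglongrightarrow> 0"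
      "L2_tendsto \<Omega> h F"
  shows "L2_tendsto \<Omega> f F"
proof (rule tendsto_sandwich[OF _ _ tendsto_const])
  let ?M = "lebesgue_on \<Omega>"
  have "(\<integral>x. (norm (f n x - F x))\<^sup>2 \<partial>?M) \<le> (\<integral>x. 2 * (norm (f n x - h n x))\<^sup>2 + 2 * (norm (h n x - F x))\<^sup>2 \<partial>?M)" for n
  proof (rule integral_mono)
    show "(norm (f n x - F x))\<^sup>2 \<le> 2 * (norm (f n x - h n x))\<^sup>2 + 2 * (norm (h n x - F x))\<^sup>2" for x
      using norm_add_sq_le[of "f n x - h n x" "h n x - F x"] by simp
  qed (use L2D(2)[OF L2_diff[OF f[of n] F]] L2D(2)[OF L2_diff[OF f[of n] h[of n]]] L2D(2)[OF L2_diff[OF h[of n] F]] in auto)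
  also have "(\<integral>x. 2 * (norm (f n x - h n x))\<^sup>2 + 2 * (norm (h n x - F x))\<^sup>2 \<partial>?M)
      = 2 * (\<integral>x. (norm (f n x - h n x))\<^sup>2 \<partial>?M) + 2 * (\<integral>x. (norm (h n x - F x))\<^sup>2 \<partial>?M)" for n
    using L2D(2)[OF L2_diff[OF f[of n] h[of n]]] L2D(2)[OF L2_diff[OF h[of n] F]]
    by (subst Bochner_Integration.integral_add) (intro integrable_mult_right impI | simp)+
  finally have "(\<integral>x. (norm (f n x - F x))\<^sup>2 \<partial>?M) \<le> 2 * (\<integral>x. (norm (f n x - h n x))\<^sup>2 \<partial>?M) + 2 * (\<integral>x. (norm (h n x - F x))\<^sup>2 \<partial>?M)" for n .
  then show "\<forall>\<^sub>F n in sequentially. (\<integral>x. (norm (f n x - F x))\<^sup>2 \<partial>?M) \<le> 2 * (\<integral>x. (norm (f n x - h n x))\<^sup>2 \<partial>?M) + 2 * (\<integral>x. (norm (h n x - F x))\<^sup>2 \<partial>?M)"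
    by simp
  show "(\<lambda>n. 2 * (\<integral>x. (norm (f n x - h n x))\<^sup>2 \<partial>?M) + 2 * (\<integral>x. (norm (h n x - F x))\<^sup>2 \<partial>?M)) \<longlonglongrightarrow> 0"
    using tendsto_add[OF tendsto_mult[OF tendsto_const[of 2] lim(1)] tendsto_mult[OF tendsto_const[of 2] lim(2)]] by simp
qed simp

lemma continuous_on_cball_L2:
  fixes f :: "complex \<Rightarrow> 'b::euclidean_space"
  assumes "continuous_on (cball 0 1) f"
  shows "f \<in> L2 (ball 0 1)"
proof -
  have "continuous_on (cball 0 1) (\<lambda>z. (norm (f z))\<^sup>2)" using assms by (intro continuous_intros)
  then show ?thesis
    using continuous_on_cball_integrable(2) borel_measurable_integrable[OF continuous_on_cball_integrable(2)[OF assms]]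
    by (auto simp: L2_def)
qed

lemma continuous_on_circle_L2:
  fixes f :: "real \<Rightarrow> complex"
  assumes "continuous_on {0..2 * pi} f"
  shows "f \<in> L2 {0..2 * pi}"
proof -
  have *: "integrable (lebesgue_on {0..2*pi}) h" if "continuous_on {0..2*pi} h" for h :: "real \<Rightarrow> 'c::euclidean_space"
  proof -
    have "integrable lborel (\<lambda>x. indicator {0..2*pi} x *\<^sub>R h x)"
      using borel_integrable_compact[OF _ that] by simp
    then have "integrable lebesgue (\<lambda>x. indicator {0..2*pi} x *\<^sub>R h x)"
      by (subst integrable_completion) auto
    then show ?thesis by (simp add: integrable_restrict_space)
  qed
  have "continuous_on {0..2*pi} (\<lambda>z. (norm (f z))\<^sup>2)" using assms by (intro continuous_intros)
  then show ?thesis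
    using *[of "\<lambda>z. (norm (f z))\<^sup>2"] borel_measurable_integrable[OF *[OF assms]]
    by (simp add: L2_def)
qed

lemma L2_disc_integrable:
  fixes u :: "complex \<Rightarrow> 'b::euclidean_space"
  assumes "u \<in> L2 (ball 0 1)"
  shows "integrable (lebesgue_on (ball 0 1)) u"
proof -
  have "(\<lambda>z::complex. 1 :: real) \<in> L2 (ball 0 1)" by (intro continuous_on_cball_L2 continuous_on_const)
  from L2_integrable_norm_mult[OF assms this] show ?thesis
    using integrable_norm_iff[OF L2D(1)[OF assms]] by simp
qed

lemma L2_disc_locally_integrable:
  fixes u :: "complex \<Rightarrow> 'b::euclidean_space"
  assumes "u \<in> L2 (ball 0 1)"
  shows "locally_integrable (ball 0 1) u"
proof -
  have "u absolutely_integrable_on ball 0 1"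
    using L2_disc_integrable[OF assms] by (simp add: integrable_restrict_space set_integrable_def)
  then show ?thesis unfolding locally_integrable_def
    by (auto intro!: set_integrable_subset[of lebesgue "ball 0 1"] simp: lmeasurable_compact fmeasurableD)
qed

text \<open>The derivative chosen by \<^const>\<open>weak_deriv\<close> is only known to be locally integrable. Its measurability
  on the whole disc is what allows it to be exchanged for another representative under the integral sign.\<close>

lemma locally_integrable_disc_measurable:
  fixes v :: "complex \<Rightarrow> 'b::euclidean_space"
  assumes "locally_integrable (ball 0 1) v"
  shows "v \<in> borel_measurable (lebesgue_on (ball 0 1))"
proof -
  have "(\<lambda>z. indicator (ball 0 1) z *\<^sub>R v z) \<in> borel_measurable lebesgue"
  proof (rule borel_measurable_LIMSEQ_metric)
    fix n
    have "v absolutely_integrable_on cball 0 (1 - inverse (real (Suc n)))"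
    proof -
      have "cball (0::complex) (1 - inverse (real (Suc n))) \<subseteq> ball 0 1"
        by (intro cball_subset_ball_iff[THEN iffD2]) simp
      then show ?thesis using assms compact_cball unfolding locally_integrable_def by blast
    qed
    then show "(\<lambda>z. indicator (cball 0 (1 - inverse (real (Suc n)))) z *\<^sub>R v z) \<in> borel_measurable lebesgue"
      by (auto simp: set_integrable_def)
  next
    fix z :: complex
    show "(\<lambda>n. indicator (cball 0 (1 - inverse (real (Suc n)))) z *\<^sub>R v z) \<longlonglongrightarrow> indicator (ball 0 1) z *\<^sub>R v z"
    proof (cases "z \<in> ball 0 1")
      case True
      then have "\<forall>\<^sub>F n in sequentially. inverse (real (Suc n)) < 1 - cmod z"
        using order_tendstoD(2)[OF LIMSEQ_inverse_real_of_nat, of "1 - cmod z"] by simp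
      then have "\<forall>\<^sub>F n in sequentially. indicator (cball 0 (1 - inverse (real (Suc n)))) z *\<^sub>R v z = indicator (ball 0 1) z *\<^sub>R v z"
        by eventually_elim (use True in \<open>simp add: indicator_def\<close>)
      then show ?thesis by (rule tendsto_eventually)
    next
      case False
      have "indicator (cball 0 (1 - inverse (real (Suc n)))) z = (0::real)" for n
      proof -
        have "0 < inverse (real (Suc n))" by simp
        then have "z \<notin> cball 0 (1 - inverse (real (Suc n)))" using False unfolding mem_cball_0 mem_ball_0 by linarith
        then show ?thesis by (rule indicator_simps(2))
      qed
      then show ?thesis using False by simp
    qed
  qed
  then show ?thesis by (simp add: borel_measurable_restrict_space_iff)
qed

section \<open>Closure of the smooth functions\<close>

definition smooth_to_boundary :: "(complex \<Rightarrow> complex) \<Rightarrow> bool" where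
  "smooth_to_boundary \<psi> \<longleftrightarrow> (\<exists>S. open S \<and> cball 0 1 \<subseteq> S \<and> smooth_on S \<psi>)"

text \<open>A map $u$ in $H^1$ with partial derivatives $p$, $q$ and trace $g$. The derivatives are arguments, since
  the chosen ones are determined only up to null sets; one sequence witnesses all four limits.\<close>

definition sobolev_limit ::
  "(complex \<Rightarrow> complex) \<Rightarrow> (complex \<Rightarrow> complex) \<Rightarrow> (complex \<Rightarrow> complex) \<Rightarrow> (complex \<Rightarrow> complex) \<Rightarrow> bool" where
  "sobolev_limit u p q g \<longleftrightarrow> u \<in> L2 (ball 0 1) \<and> p \<in> L2 (ball 0 1) \<and> q \<in> L2 (ball 0 1) \<and>
     (\<lambda>\<theta>. g (cis \<theta>)) \<in> L2 {0..2 * pi} \<and>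
     (\<exists>\<psi> :: nat \<Rightarrow> complex \<Rightarrow> complex. (\<forall>n. smooth_to_boundary (\<psi> n)) \<and>
        L2_tendsto (ball 0 1) \<psi> u \<and>
        L2_tendsto (ball 0 1) (\<lambda>n. dx (\<psi> n)) p \<and>
        L2_tendsto (ball 0 1) (\<lambda>n. dy (\<psi> n)) q \<and>
        L2_tendsto {0..2 * pi} (\<lambda>n \<theta>. \<psi> n (cis \<theta>)) (\<lambda>\<theta>. g (cis \<theta>)))"

lemma smooth_to_boundary_L2:
  assumes "smooth_to_boundary \<psi>"
  shows "\<psi> \<in> L2 (ball 0 1)" "dx \<psi> \<in> L2 (ball 0 1)" "dy \<psi> \<in> L2 (ball 0 1)" "(\<lambda>\<theta>. \<psi> (cis \<theta>)) \<in> L2 {0..2 * pi}"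
    "continuous_on (cball 0 1) \<psi>" "continuous_on (cball 0 1) (dx \<psi>)" "continuous_on (cball 0 1) (dy \<psi>)"
proof -
  obtain S where S: "open S" "cball 0 1 \<subseteq> S" "\<And>k. Ck_on k S \<psi>"
    using assms by (auto simp: smooth_to_boundary_def smooth_on_def)
  show c: "continuous_on (cball 0 1) \<psi>" "continuous_on (cball 0 1) (dx \<psi>)" "continuous_on (cball 0 1) (dy \<psi>)"
    using S(3)[of 0] Ck_on_dx[OF S(3)[of "Suc 0"]] Ck_on_dy[OF S(3)[of "Suc 0"]] S(2) by (auto intro: continuous_on_subset)
  show "\<psi> \<in> L2 (ball 0 1)" "dx \<psi> \<in> L2 (ball 0 1)" "dy \<psi> \<in> L2 (ball 0 1)"
    by (intro continuous_on_cball_L2 c)+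
  show "(\<lambda>\<theta>. \<psi> (cis \<theta>)) \<in> L2 {0..2 * pi}"
    by (intro continuous_on_circle_L2 continuous_on_compose2[OF c(1), of _ cis] continuous_on_cis continuous_on_id) auto
qed

lemma smooth_to_boundary_weak_deriv:
  assumes "smooth_to_boundary \<psi>"
  shows "has_weak_deriv (ball 0 1) 1 \<psi> (dx \<psi>)" "has_weak_deriv (ball 0 1) \<i> \<psi> (dy \<psi>)"
proof -
  obtain S where S: "open S" "cball 0 1 \<subseteq> S" "\<And>k. Ck_on k S \<psi>"
    using assms by (auto simp: smooth_to_boundary_def smooth_on_def)
  show "has_weak_deriv (ball 0 1) 1 \<psi> (dx \<psi>)" "has_weak_deriv (ball 0 1) \<i> \<psi> (dy \<psi>)"
    using has_weak_deriv_classical[OF S(1,2) S(3)] by (simp_all add: Basis_complex_def)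
qed

lemma has_weak_deriv_L2_limit:
  fixes u :: "complex \<Rightarrow> complex"
  assumes e: "e \<in> Basis" and w: "\<And>n. has_weak_deriv (ball 0 1) e (\<psi> n) (\<psi>' n)"
    and L: "\<And>n. \<psi> n \<in> L2 (ball 0 1)" "\<And>n. \<psi>' n \<in> L2 (ball 0 1)" "u \<in> L2 (ball 0 1)" "p \<in> L2 (ball 0 1)"
    and lim: "L2_tendsto (ball 0 1) \<psi> u"
      "L2_tendsto (ball 0 1) \<psi>' p"
  shows "has_weak_deriv (ball 0 1) e u p"
  unfolding has_weak_deriv_def
proof (intro conjI allI impI L2_disc_locally_integrable L)
  fix \<phi> :: "complex \<Rightarrow> real" assume t: "test_function (ball 0 1) \<phi>"
  have Lt: "(\<lambda>z. of_real (\<eta> z) :: complex) \<in> L2 (ball 0 1)" if "Ck_on 0 UNIV \<eta>" for \<eta> :: "complex \<Rightarrow> real"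
    using that continuous_on_subset[of UNIV \<eta> "cball 0 1"]
    by (intro continuous_on_cball_L2 continuous_on_of_real) simp
  have A: "(\<lambda>z. of_real (\<phi> z) :: complex) \<in> L2 (ball 0 1)" by (rule Lt[OF test_function_Ck[OF t]])
  have B: "(\<lambda>z. of_real (frechet_derivative \<phi> (at z) e) :: complex) \<in> L2 (ball 0 1)"
    by (rule Lt[OF Ck_on_SucD(2)[OF test_function_Ck[OF t] e]])
  have 1: "(\<lambda>n. \<integral>z. \<psi> n z * of_real (frechet_derivative \<phi> (at z) e) \<partial>lebesgue_on (ball 0 1))
     \<longlonglongrightarrow> (\<integral>z. u z * of_real (frechet_derivative \<phi> (at z) e) \<partial>lebesgue_on (ball 0 1))"
    by (rule L2_tendsto_pairing[OF L(1) L(3) B lim(1)])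
  have "(\<lambda>n. \<integral>z. \<psi>' n z * of_real (\<phi> z) \<partial>lebesgue_on (ball 0 1))
     \<longlonglongrightarrow> (\<integral>z. p z * of_real (\<phi> z) \<partial>lebesgue_on (ball 0 1))"
    by (rule L2_tendsto_pairing[OF L(2) L(4) A lim(2)])
  then have 2: "(\<lambda>n. - (\<integral>z. \<psi>' n z * of_real (\<phi> z) \<partial>lebesgue_on (ball 0 1)))
     \<longlonglongrightarrow> - (\<integral>z. p z * of_real (\<phi> z) \<partial>lebesgue_on (ball 0 1))"
    by (rule tendsto_minus)
  have "(\<integral>z. \<psi> n z * of_real (frechet_derivative \<phi> (at z) e) \<partial>lebesgue_on (ball 0 1))
      = - (\<integral>z. \<psi>' n z * of_real (\<phi> z) \<partial>lebesgue_on (ball 0 1))" for n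
    using w[of n] t by (simp add: has_weak_deriv_def scaleR_conv_of_real mult.commute)
  with 1 2 have "(\<integral>z. u z * of_real (frechet_derivative \<phi> (at z) e) \<partial>lebesgue_on (ball 0 1))
      = - (\<integral>z. p z * of_real (\<phi> z) \<partial>lebesgue_on (ball 0 1))"
    using LIMSEQ_unique by simp
  then show "(\<integral>x. frechet_derivative \<phi> (at x) e *\<^sub>R u x \<partial>lebesgue_on (ball 0 1)) = - (\<integral>x. \<phi> x *\<^sub>R p x \<partial>lebesgue_on (ball 0 1))"
    by (simp add: scaleR_conv_of_real mult.commute)
qed

lemma sobolev_limit_weak_deriv:
  assumes "sobolev_limit u p q g"
  shows "has_weak_deriv (ball 0 1) 1 u p" "has_weak_deriv (ball 0 1) \<i> u q"
proof -
  obtain \<psi> where \<psi>: "\<And>n. smooth_to_boundary (\<psi> n)"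
        "L2_tendsto (ball 0 1) \<psi> u"
        "L2_tendsto (ball 0 1) (\<lambda>n. dx (\<psi> n)) p"
        "L2_tendsto (ball 0 1) (\<lambda>n. dy (\<psi> n)) q"
    and L: "u \<in> L2 (ball 0 1)" "p \<in> L2 (ball 0 1)" "q \<in> L2 (ball 0 1)"
    using assms by (auto simp: sobolev_limit_def)
  show "has_weak_deriv (ball 0 1) 1 u p"
    by (rule has_weak_deriv_L2_limit[OF _ smooth_to_boundary_weak_deriv(1)[OF \<psi>(1)] _ _ L(1,2) \<psi>(2,3)])
       (use smooth_to_boundary_L2[OF \<psi>(1)] in \<open>auto simp: Basis_complex_def\<close>)
  show "has_weak_deriv (ball 0 1) \<i> u q"
    by (rule has_weak_deriv_L2_limit[OF _ smooth_to_boundary_weak_deriv(2)[OF \<psi>(1)] _ _ L(1,3) \<psi>(2,4)])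
       (use smooth_to_boundary_L2[OF \<psi>(1)] in \<open>auto simp: Basis_complex_def\<close>)
qed

lemma grad_norm_sq_AE:
  fixes u :: "complex \<Rightarrow> 'b::euclidean_space"
  assumes "has_weak_deriv (ball 0 1) 1 u p" "has_weak_deriv (ball 0 1) \<i> u q"
  shows "AE z in lebesgue_on (ball 0 1). grad_norm_sq (ball 0 1) u z = (norm (p z))\<^sup>2 + (norm (q z))\<^sup>2"
    and "grad_norm_sq (ball 0 1) u \<in> borel_measurable (lebesgue_on (ball 0 1))"
proof -
  show "AE z in lebesgue_on (ball 0 1). grad_norm_sq (ball 0 1) u z = (norm (p z))\<^sup>2 + (norm (q z))\<^sup>2"
    using weak_deriv_AE_eq[OF open_ball assms(1)] weak_deriv_AE_eq[OF open_ball assms(2)]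
    by eventually_elim (simp add: grad_norm_sq_def Basis_complex_def)
  have "has_weak_deriv (ball 0 1) 1 u (weak_deriv (ball 0 1) 1 u)" "has_weak_deriv (ball 0 1) \<i> u (weak_deriv (ball 0 1) \<i> u)"
    using someI[of "has_weak_deriv (ball 0 1) 1 u", OF assms(1)] someI[of "has_weak_deriv (ball 0 1) \<i> u", OF assms(2)]
    by (simp_all add: weak_deriv_def)
  then have [measurable]: "weak_deriv (ball 0 1) 1 u \<in> borel_measurable (lebesgue_on (ball 0 1))"
    "weak_deriv (ball 0 1) \<i> u \<in> borel_measurable (lebesgue_on (ball 0 1))"
    by (auto intro!: locally_integrable_disc_measurable simp: has_weak_deriv_def)
  show "grad_norm_sq (ball 0 1) u \<in> borel_measurable (lebesgue_on (ball 0 1))"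
    unfolding grad_norm_sq_def[abs_def] by (simp add: Basis_complex_def)
qed

text \<open>By uniqueness, the derivatives chosen inside \<^const>\<open>H1_norm\<close> agree almost everywhere with those at hand.\<close>

lemma H1_norm_diff:
  fixes u \<psi> :: "complex \<Rightarrow> complex"
  assumes L: "u \<in> L2 (ball 0 1)" "p \<in> L2 (ball 0 1)" "q \<in> L2 (ball 0 1)"
    and w: "has_weak_deriv (ball 0 1) 1 u p" "has_weak_deriv (ball 0 1) \<i> u q" and \<psi>: "smooth_to_boundary \<psi>"
  shows "(H1_norm (ball 0 1) (\<lambda>z. \<psi> z - u z))\<^sup>2
     = (\<integral>z. (cmod (\<psi> z - u z))\<^sup>2 \<partial>lebesgue_on (ball 0 1)) + (\<integral>z. (cmod (dx \<psi> z - p z))\<^sup>2 \<partial>lebesgue_on (ball 0 1))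
       + (\<integral>z. (cmod (dy \<psi> z - q z))\<^sup>2 \<partial>lebesgue_on (ball 0 1))"
proof -
  let ?M = "lebesgue_on (ball (0::complex) 1)"
  note W = smooth_to_boundary_weak_deriv[OF \<psi>] note LP = smooth_to_boundary_L2[OF \<psi>]
  have d: "has_weak_deriv (ball 0 1) 1 (\<lambda>z. \<psi> z - u z) (\<lambda>z. dx \<psi> z - p z)"
    "has_weak_deriv (ball 0 1) \<i> (\<lambda>z. \<psi> z - u z) (\<lambda>z. dy \<psi> z - q z)"
    by (rule has_weak_deriv_diff[OF open_ball _ W(1) w(1)] has_weak_deriv_diff[OF open_ball _ W(2) w(2)]; simp add: Basis_complex_def)+
  have D: "(\<lambda>z. \<psi> z - u z) \<in> L2 (ball 0 1)" "(\<lambda>z. dx \<psi> z - p z) \<in> L2 (ball 0 1)" "(\<lambda>z. dy \<psi> z - q z) \<in> L2 (ball 0 1)"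
    by (intro L2_diff L LP)+
  note [measurable] = L2D(1)[OF D(1)] L2D(1)[OF D(2)] L2D(1)[OF D(3)] grad_norm_sq_AE(2)[OF d]
  have "(\<integral>z. (cmod (\<psi> z - u z))\<^sup>2 + grad_norm_sq (ball 0 1) (\<lambda>z. \<psi> z - u z) z \<partial>?M)
     = (\<integral>z. (cmod (\<psi> z - u z))\<^sup>2 + ((cmod (dx \<psi> z - p z))\<^sup>2 + (cmod (dy \<psi> z - q z))\<^sup>2) \<partial>?M)"
    by (intro integral_cong_AE) (measurable, use grad_norm_sq_AE(1)[OF d] in \<open>auto elim!: eventually_mono\<close>)
  also have "\<dots> = (\<integral>z. (cmod (\<psi> z - u z))\<^sup>2 \<partial>?M) + ((\<integral>z. (cmod (dx \<psi> z - p z))\<^sup>2 \<partial>?M) + (\<integral>z. (cmod (dy \<psi> z - q z))\<^sup>2 \<partial>?M))"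
    using L2D(2)[OF D(1)] L2D(2)[OF D(2)] L2D(2)[OF D(3)] by simp
  finally have E: "(\<integral>z. (cmod (\<psi> z - u z))\<^sup>2 + grad_norm_sq (ball 0 1) (\<lambda>z. \<psi> z - u z) z \<partial>?M) = \<dots>" .
  have "0 \<le> \<dots>" by (intro add_nonneg_nonneg) auto
  then show ?thesis unfolding H1_norm_def E by simp
qed

lemma has_trace_imp_sobolev_limit:
  assumes "has_trace u g"
  obtains p q where "sobolev_limit u p q g"
proof -
  have uH: "u \<in> H1 (ball 0 1)" and g: "(\<lambda>\<theta>. g (cis \<theta>)) \<in> L2 {0..2 * pi}" using assms by (auto simp: has_trace_def)
  obtain p q where pq: "p \<in> L2 (ball 0 1)" "q \<in> L2 (ball 0 1)" and w: "has_weak_deriv (ball 0 1) 1 u p" "has_weak_deriv (ball 0 1) \<i> u q"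
    using uH by (auto simp: H1_def Basis_complex_def)
  have u: "u \<in> L2 (ball 0 1)" using uH by (simp add: H1_def)
  obtain \<psi> where \<psi>: "\<And>n. smooth_to_boundary (\<psi> n)" and lim: "(\<lambda>n. H1_norm (ball 0 1) (\<lambda>z. \<psi> n z - u z)) \<longlonglongrightarrow> 0"
      "L2_tendsto {0..2 * pi} (\<lambda>n \<theta>. \<psi> n (cis \<theta>)) (\<lambda>\<theta>. g (cis \<theta>))"
    using assms unfolding has_trace_def smooth_to_boundary_def by blast
  have N: "(\<lambda>n. (H1_norm (ball 0 1) (\<lambda>z. \<psi> n z - u z))\<^sup>2) \<longlonglongrightarrow> 0"
    using tendsto_power[OF lim(1), of 2] by simp
  note E = H1_norm_diff[OF u pq w \<psi>]
  have "L2_tendsto (ball 0 1) \<psi> u"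
    "L2_tendsto (ball 0 1) (\<lambda>n. dx (\<psi> n)) p"
    "L2_tendsto (ball 0 1) (\<lambda>n. dy (\<psi> n)) q"
    by (rule tendsto_sandwich[OF _ _ tendsto_const N]; auto simp: E intro!: always_eventually add_nonneg_nonneg)+
  then have "sobolev_limit u p q g"
    unfolding sobolev_limit_def using u pq g \<psi> lim(2) by blast
  then show thesis by (rule that)
qed

lemma sobolev_limit_imp_has_trace:
  assumes "sobolev_limit u p q g"
  shows "has_trace u g"
proof -
  obtain \<psi> where \<psi>: "\<And>n. smooth_to_boundary (\<psi> n)" and lim:
        "L2_tendsto (ball 0 1) \<psi> u"
        "L2_tendsto (ball 0 1) (\<lambda>n. dx (\<psi> n)) p"
        "L2_tendsto (ball 0 1) (\<lambda>n. dy (\<psi> n)) q"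
        "L2_tendsto {0..2 * pi} (\<lambda>n \<theta>. \<psi> n (cis \<theta>)) (\<lambda>\<theta>. g (cis \<theta>))"
    and L: "u \<in> L2 (ball 0 1)" "p \<in> L2 (ball 0 1)" "q \<in> L2 (ball 0 1)" and g: "(\<lambda>\<theta>. g (cis \<theta>)) \<in> L2 {0..2 * pi}"
    using assms by (auto simp: sobolev_limit_def)
  note w = sobolev_limit_weak_deriv[OF assms]
  have H: "u \<in> H1 (ball 0 1)" using L w by (auto simp: H1_def Basis_complex_def)
  have "(\<lambda>n. (H1_norm (ball 0 1) (\<lambda>z. \<psi> n z - u z))\<^sup>2) \<longlonglongrightarrow> 0 + 0 + 0"
    unfolding H1_norm_diff[OF L w \<psi>] by (intro tendsto_add lim)
  then have "(\<lambda>n. sqrt ((H1_norm (ball 0 1) (\<lambda>z. \<psi> n z - u z))\<^sup>2)) \<longlonglongrightarrow> sqrt (0 + 0 + 0)" by (rule tendsto_real_sqrt)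
  then have "(\<lambda>n. \<bar>H1_norm (ball 0 1) (\<lambda>z. \<psi> n z - u z)\<bar>) \<longlonglongrightarrow> 0" by simp
  then have "(\<lambda>n. H1_norm (ball 0 1) (\<lambda>z. \<psi> n z - u z)) \<longlonglongrightarrow> 0" by (simp add: tendsto_rabs_zero_iff)
  then show ?thesis unfolding has_trace_def
    using H g \<psi> lim(4) by (auto simp: smooth_to_boundary_def)
qed

lemma sobolev_limit_smooth:
  assumes "smooth_to_boundary \<psi>" "\<And>\<theta>. g (cis \<theta>) = \<psi> (cis \<theta>)"
  shows "sobolev_limit \<psi> (dx \<psi>) (dy \<psi>) g"
  unfolding sobolev_limit_def using smooth_to_boundary_L2[OF assms(1)] assms
  by (auto intro!: exI[of _ "\<lambda>n. \<psi>"])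

text \<open>A diagonal argument. The trace is fixed along the sequence, so it is inherited by the limit.\<close>

lemma sobolev_limit_closed:
  assumes X: "\<And>n. sobolev_limit (u n) (p n) (q n) g"
    and L: "v \<in> L2 (ball 0 1)" "r \<in> L2 (ball 0 1)" "s \<in> L2 (ball 0 1)"
    and lim: "L2_tendsto (ball 0 1) u v"
      "L2_tendsto (ball 0 1) p r"
      "L2_tendsto (ball 0 1) q s"
  shows "sobolev_limit v r s g"
proof -
  let ?M = "lebesgue_on (ball (0::complex) 1)"
  define P where "P n \<psi> \<longleftrightarrow> smooth_to_boundary \<psi> \<and> (\<integral>z. (cmod (\<psi> z - u n z))\<^sup>2 \<partial>?M) < 1 / Suc n
     \<and> (\<integral>z. (cmod (dx \<psi> z - p n z))\<^sup>2 \<partial>?M) < 1 / Suc n \<and> (\<integral>z. (cmod (dy \<psi> z - q n z))\<^sup>2 \<partial>?M) < 1 / Suc n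
     \<and> (\<integral>\<theta>. (cmod (\<psi> (cis \<theta>) - g (cis \<theta>)))\<^sup>2 \<partial>lebesgue_on {0..2 * pi}) < 1 / Suc n" for n \<psi>
  have "\<exists>\<psi>. P n \<psi>" for n
  proof -
    have e: "1 / real (Suc n) > 0" by simp
    obtain \<psi> where \<psi>: "\<And>m. smooth_to_boundary (\<psi> m)" and l:
        "L2_tendsto (ball 0 1) \<psi> (u n)"
        "L2_tendsto (ball 0 1) (\<lambda>m. dx (\<psi> m)) (p n)"
        "L2_tendsto (ball 0 1) (\<lambda>m. dy (\<psi> m)) (q n)"
        "L2_tendsto {0..2 * pi} (\<lambda>m \<theta>. \<psi> m (cis \<theta>)) (\<lambda>\<theta>. g (cis \<theta>))"
      using X[of n] by (auto simp: sobolev_limit_def)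
    have "\<forall>\<^sub>F m in sequentially. (\<integral>z. (cmod (\<psi> m z - u n z))\<^sup>2 \<partial>?M) < 1 / Suc n
     \<and> (\<integral>z. (cmod (dx (\<psi> m) z - p n z))\<^sup>2 \<partial>?M) < 1 / Suc n \<and> (\<integral>z. (cmod (dy (\<psi> m) z - q n z))\<^sup>2 \<partial>?M) < 1 / Suc n
     \<and> (\<integral>\<theta>. (cmod (\<psi> m (cis \<theta>) - g (cis \<theta>)))\<^sup>2 \<partial>lebesgue_on {0..2 * pi}) < 1 / Suc n"
      by (intro eventually_conj order_tendstoD(2)[OF l(1) e] order_tendstoD(2)[OF l(2) e] order_tendstoD(2)[OF l(3) e] order_tendstoD(2)[OF l(4) e])
    from eventually_happens'[OF sequentially_bot this] obtain m where
      "(\<integral>z. (cmod (\<psi> m z - u n z))\<^sup>2 \<partial>?M) < 1 / Suc n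
     \<and> (\<integral>z. (cmod (dx (\<psi> m) z - p n z))\<^sup>2 \<partial>?M) < 1 / Suc n \<and> (\<integral>z. (cmod (dy (\<psi> m) z - q n z))\<^sup>2 \<partial>?M) < 1 / Suc n
     \<and> (\<integral>\<theta>. (cmod (\<psi> m (cis \<theta>) - g (cis \<theta>)))\<^sup>2 \<partial>lebesgue_on {0..2 * pi}) < 1 / Suc n" ..
    with \<psi>[of m] have "P n (\<psi> m)" unfolding P_def by (intro conjI) (elim conjE, assumption)+
    then show ?thesis by (rule exI[of "P n" "\<psi> m"])
  qed
  then obtain \<psi> where P: "\<And>n. P n (\<psi> n)" by metis
  have \<psi>: "smooth_to_boundary (\<psi> n)" for n using P[of n] by (simp add: P_def)
  have lt:
     "(\<integral>z. (cmod (\<psi> n z - u n z))\<^sup>2 \<partial>?M) < 1 / Suc n" "(\<integral>z. (cmod (dx (\<psi> n) z - p n z))\<^sup>2 \<partial>?M) < 1 / Suc n"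
     "(\<integral>z. (cmod (dy (\<psi> n) z - q n z))\<^sup>2 \<partial>?M) < 1 / Suc n"
     "(\<integral>\<theta>. (cmod (\<psi> n (cis \<theta>) - g (cis \<theta>)))\<^sup>2 \<partial>lebesgue_on {0..2 * pi}) < 1 / Suc n"
    for n
    using P[of n] unfolding P_def by simp_all
  have z: "f \<longlonglongrightarrow> 0" if "\<And>n. f n < 1 / Suc n" "\<And>n. 0 \<le> f n" for f :: "nat \<Rightarrow> real"
    by (rule tendsto_sandwich[OF _ _ tendsto_const LIMSEQ_inverse_real_of_nat])
       (use that in \<open>auto intro!: always_eventually less_imp_le simp: inverse_eq_divide\<close>)
  have Lu: "u n \<in> L2 (ball 0 1)" "p n \<in> L2 (ball 0 1)" "q n \<in> L2 (ball 0 1)" for n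
    using X by (auto simp: sobolev_limit_def)
  note LP = smooth_to_boundary_L2[OF \<psi>]
  have "L2_tendsto (ball 0 1) \<psi> v"
    by (rule L2_limit_triangle[OF LP(1) Lu(1) L(1) z[OF lt(1)] lim(1)]) simp
  moreover have "L2_tendsto (ball 0 1) (\<lambda>n. dx (\<psi> n)) r"
    by (rule L2_limit_triangle[OF LP(2) Lu(2) L(2) z[OF lt(2)] lim(2)]) simp
  moreover have "L2_tendsto (ball 0 1) (\<lambda>n. dy (\<psi> n)) s"
    by (rule L2_limit_triangle[OF LP(3) Lu(3) L(3) z[OF lt(3)] lim(3)]) simp
  moreover have "L2_tendsto {0..2 * pi} (\<lambda>n \<theta>. \<psi> n (cis \<theta>)) (\<lambda>\<theta>. g (cis \<theta>))"
    by (rule z[OF lt(4)]) simp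
  ultimately show ?thesis
    unfolding sobolev_limit_def using L \<psi> X[of 0] by (auto simp: sobolev_limit_def)
qed

section \<open>Composition with smooth maps\<close>

lemma L2_dominated_convergence:
  fixes f :: "nat \<Rightarrow> 'a::euclidean_space \<Rightarrow> 'b::euclidean_space" and w :: "'a \<Rightarrow> 'c::euclidean_space"
  assumes meas: "\<And>n. f n \<in> borel_measurable (lebesgue_on \<Omega>)" "F \<in> borel_measurable (lebesgue_on \<Omega>)"
    and w: "w \<in> L2 \<Omega>" and bound: "\<And>n. AE x in lebesgue_on \<Omega>. norm (f n x) \<le> C * norm (w x)"
    and conv: "AE x in lebesgue_on \<Omega>. (\<lambda>n. f n x) \<longlonglongrightarrow> F x"
  shows "F \<in> L2 \<Omega>" "\<And>n. f n \<in> L2 \<Omega>" "L2_tendsto \<Omega> f F"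
proof -
  have all: "AE x in lebesgue_on \<Omega>. \<forall>n. norm (f n x) \<le> C * norm (w x)"
    using bound by (simp add: AE_all_countable)
  have Fb: "AE x in lebesgue_on \<Omega>. norm (F x) \<le> C * norm (w x)"
    using all conv
  proof eventually_elim
    case (elim x)
    then show ?case by (intro LIMSEQ_le_const2[OF tendsto_norm[OF elim(2)]]) auto
  qed
  show "F \<in> L2 \<Omega>" by (rule L2_bound[OF meas(2) w Fb])
  show "f n \<in> L2 \<Omega>" for n by (rule L2_bound[OF meas(1) w bound])
  have "(\<lambda>n. \<integral>x. (norm (f n x - F x))\<^sup>2 \<partial>lebesgue_on \<Omega>) \<longlonglongrightarrow> (\<integral>x. 0 \<partial>lebesgue_on \<Omega>)"
  proof (rule integral_dominated_convergence[where w = "\<lambda>x. 4 * (C\<^sup>2 * (norm (w x))\<^sup>2)"])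
    show "(\<lambda>x. (norm (f n x - F x))\<^sup>2) \<in> borel_measurable (lebesgue_on \<Omega>)" for n using meas by measurable
    show "integrable (lebesgue_on \<Omega>) (\<lambda>x. 4 * (C\<^sup>2 * (norm (w x))\<^sup>2))"
      by (intro integrable_mult_right impI L2D(2)[OF w])
    show "AE x in lebesgue_on \<Omega>. (\<lambda>n. (norm (f n x - F x))\<^sup>2) \<longlonglongrightarrow> 0"
      using conv
    proof eventually_elim
      case (elim x)
      then have "(\<lambda>n. norm (f n x - F x)) \<longlonglongrightarrow> 0" using LIM_zero tendsto_norm_zero by blast
      from tendsto_power[OF this, of 2] show ?case by simp
    qed
    show "AE x in lebesgue_on \<Omega>. norm ((norm (f n x - F x))\<^sup>2) \<le> 4 * (C\<^sup>2 * (norm (w x))\<^sup>2)" for n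
      using all Fb
    proof eventually_elim
      case (elim x)
      have "(norm (f n x))\<^sup>2 \<le> (C * norm (w x))\<^sup>2" "(norm (F x))\<^sup>2 \<le> (C * norm (w x))\<^sup>2"
        using elim by (auto intro!: power_mono)
      then show ?case using norm_diff_sq_le[of "f n x" "F x"] by (simp add: power_mult_distrib)
    qed
  qed simp
  then show "L2_tendsto \<Omega> f F" by simp
qed

lemma L2_limit_mono:
  fixes a :: "nat \<Rightarrow> 'a::euclidean_space \<Rightarrow> 'b::euclidean_space" and b :: "nat \<Rightarrow> 'a \<Rightarrow> 'c::euclidean_space"
  assumes a: "\<And>n. a n \<in> L2 \<Omega>" and b: "\<And>n. b n \<in> borel_measurable (lebesgue_on \<Omega>)"
    and le: "\<And>n x. x \<in> \<Omega> \<Longrightarrow> norm (b n x) \<le> C * norm (a n x)"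
    and lim: "(\<lambda>n. \<integral>x. (norm (a n x))\<^sup>2 \<partial>lebesgue_on \<Omega>) \<longlonglongrightarrow> 0"
  shows "(\<lambda>n. \<integral>x. (norm (b n x))\<^sup>2 \<partial>lebesgue_on \<Omega>) \<longlonglongrightarrow> 0"
proof (rule tendsto_sandwich[OF _ _ tendsto_const])
  have sp: "AE x in lebesgue_on \<Omega>. norm (b n x) \<le> C * norm (a n x)" for n
    using le by (intro AE_I2) (simp add: space_restrict_space)
  have bL: "b n \<in> L2 \<Omega>" for n by (rule L2_bound[OF b a sp])
  have "(\<integral>x. (norm (b n x))\<^sup>2 \<partial>lebesgue_on \<Omega>) \<le> (\<integral>x. C\<^sup>2 * (norm (a n x))\<^sup>2 \<partial>lebesgue_on \<Omega>)" for n
  proof (rule integral_mono_AE)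
    show "AE x in lebesgue_on \<Omega>. (norm (b n x))\<^sup>2 \<le> C\<^sup>2 * (norm (a n x))\<^sup>2"
      using sp[of n]
    proof eventually_elim
      case (elim x)
      then have "(norm (b n x))\<^sup>2 \<le> (C * norm (a n x))\<^sup>2" by (intro power_mono) auto
      then show ?case by (simp add: power_mult_distrib)
    qed
  qed (use L2D(2)[OF bL[of n]] L2D(2)[OF a[of n]] in auto)
  then show "\<forall>\<^sub>F n in sequentially. (\<integral>x. (norm (b n x))\<^sup>2 \<partial>lebesgue_on \<Omega>) \<le> C\<^sup>2 * (\<integral>x. (norm (a n x))\<^sup>2 \<partial>lebesgue_on \<Omega>)"
    by simp
  show "(\<lambda>n. C\<^sup>2 * (\<integral>x. (norm (a n x))\<^sup>2 \<partial>lebesgue_on \<Omega>)) \<longlonglongrightarrow> 0"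
    using tendsto_mult[OF tendsto_const[of "C\<^sup>2"] lim] by simp
qed simp

text \<open>Needed because nonlinear expressions of the limit are reached by dominated convergence only.\<close>

lemma L2_limit_AE_subseq:
  fixes f :: "nat \<Rightarrow> 'a::euclidean_space \<Rightarrow> 'b::euclidean_space"
  assumes "\<And>n. f n \<in> L2 \<Omega>" "F \<in> L2 \<Omega>" "L2_tendsto \<Omega> f F"
  obtains r :: "nat \<Rightarrow> nat" where "strict_mono r" "AE x in lebesgue_on \<Omega>. (\<lambda>n. f (r n) x) \<longlonglongrightarrow> F x"
proof -
  have "\<exists>r::nat\<Rightarrow>nat. strict_mono r \<and> (AE x in lebesgue_on \<Omega>. (\<lambda>n. (norm (f (r n) x - F x))\<^sup>2) \<longlonglongrightarrow> 0)"
    using L2D(2)[OF L2_diff[OF assms(1) assms(2)]] assms(3) by (intro tendsto_L1_AE_subseq) auto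
  then obtain r :: "nat \<Rightarrow> nat" where r: "strict_mono r" "AE x in lebesgue_on \<Omega>. (\<lambda>n. (norm (f (r n) x - F x))\<^sup>2) \<longlonglongrightarrow> 0"
    by auto
  from r(2) have "AE x in lebesgue_on \<Omega>. (\<lambda>n. f (r n) x) \<longlonglongrightarrow> F x"
  proof eventually_elim
    case (elim x)
    from tendsto_real_sqrt[OF elim] have "(\<lambda>n. norm (f (r n) x - F x)) \<longlonglongrightarrow> 0" by simp
    then show ?case using LIM_zero_cancel tendsto_norm_zero_iff by blast
  qed
  with r(1) show thesis by (rule that)
qed

text \<open>The maps of the plane which act on \<^const>\<open>sobolev_limit\<close>. The last clause keeps composed approximations
  smooth up to the boundary.\<close>

definition smooth_lipschitz :: "(complex \<Rightarrow> complex) \<Rightarrow> (complex \<Rightarrow> complex \<Rightarrow> complex) \<Rightarrow> real \<Rightarrow> bool" where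
  "smooth_lipschitz \<Phi> \<Phi>' L \<longleftrightarrow> (\<forall>w. (\<Phi> has_derivative \<Phi>' w) (at w)) \<and> (\<forall>v. continuous_on UNIV (\<lambda>w. \<Phi>' w v)) \<and>
     (\<forall>w v. cmod (\<Phi>' w v) \<le> L * cmod v) \<and> (\<forall>\<psi>. smooth_to_boundary \<psi> \<longrightarrow> smooth_to_boundary (\<lambda>z. \<Phi> (\<psi> z)))"

lemma smooth_lipschitzD:
  assumes "smooth_lipschitz \<Phi> \<Phi>' L"
  shows "(\<Phi> has_derivative \<Phi>' w) (at w)" "continuous_on UNIV (\<lambda>w. \<Phi>' w v)" "cmod (\<Phi>' w v) \<le> L * cmod v"
    "smooth_to_boundary \<psi> \<Longrightarrow> smooth_to_boundary (\<lambda>z. \<Phi> (\<psi> z))" "continuous_on UNIV \<Phi>" "cmod (\<Phi> a - \<Phi> b) \<le> L * cmod (a - b)"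
proof -
  show D: "(\<Phi> has_derivative \<Phi>' w) (at w)" for w using assms by (auto simp: smooth_lipschitz_def)
  show "continuous_on UNIV (\<lambda>w. \<Phi>' w v)" "smooth_to_boundary \<psi> \<Longrightarrow> smooth_to_boundary (\<lambda>z. \<Phi> (\<psi> z))"
    using assms by (auto simp: smooth_lipschitz_def)
  show B: "cmod (\<Phi>' w v) \<le> L * cmod v" for w v using assms by (auto simp: smooth_lipschitz_def)
  show "continuous_on UNIV \<Phi>"
    by (rule has_derivative_continuous_on) (use D in auto)
  have "L \<ge> 0" using order_trans[OF norm_ge_zero B[of 0 1]] by simp
  then have "onorm (\<Phi>' w) \<le> L" for w using B by (intro onorm_le) 
  then show "cmod (\<Phi> a - \<Phi> b) \<le> L * cmod (a - b)"
    by (intro differentiable_bound[of UNIV \<Phi> \<Phi>']) (use D in auto)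
qed

lemma smooth_lipschitz_measurable:
  assumes \<Phi>: "smooth_lipschitz \<Phi> \<Phi>' L" and u: "u \<in> borel_measurable M" and p: "p \<in> borel_measurable M"
  shows "(\<lambda>z. \<Phi>' (u z) (p z)) \<in> borel_measurable M" "(\<lambda>z. \<Phi> (u z)) \<in> borel_measurable M"
proof -
  have lin: "\<Phi>' w v = Re v *\<^sub>R \<Phi>' w 1 + Im v *\<^sub>R \<Phi>' w \<i>" for w v
  proof -
    have l: "linear (\<Phi>' w)" using smooth_lipschitzD(1)[OF \<Phi>] has_derivative_linear by blast
    have "v = Re v *\<^sub>R 1 + Im v *\<^sub>R \<i>" by (simp add: complex_eq_iff)
    then have "\<Phi>' w v = \<Phi>' w (Re v *\<^sub>R 1 + Im v *\<^sub>R \<i>)" by simp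
    also have "\<dots> = Re v *\<^sub>R \<Phi>' w 1 + Im v *\<^sub>R \<Phi>' w \<i>" by (simp add: linear_add[OF l] linear_scale[OF l])
    finally show ?thesis .
  qed
  have c: "(\<lambda>z. \<Phi>' (u z) v) \<in> borel_measurable M" for v
    using measurable_compose[OF u borel_measurable_continuous_onI[OF smooth_lipschitzD(2)[OF \<Phi>]]] by simp
  show "(\<lambda>z. \<Phi>' (u z) (p z)) \<in> borel_measurable M"
    unfolding lin[of "u _" "p _"] using c p by measurable
  show "(\<lambda>z. \<Phi> (u z)) \<in> borel_measurable M"
    using measurable_compose[OF u borel_measurable_continuous_onI[OF smooth_lipschitzD(5)[OF \<Phi>]]] by simp
qed

text \<open>Both factors of the chain rule vary. The change of $h_n$ is controlled by the Lipschitz bound, uniformly in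
  $n$; the change of $\Phi'(f_n)$ on the fixed function $p$ by dominated convergence.\<close>

lemma L2_chain_limit:
  fixes f h :: "nat \<Rightarrow> complex \<Rightarrow> complex"
  assumes \<Phi>: "smooth_lipschitz \<Phi> \<Phi>' L"
    and f: "\<And>n. f n \<in> L2 (ball 0 1)" "u \<in> L2 (ball 0 1)" "AE z in lebesgue_on (ball 0 1). (\<lambda>n. f n z) \<longlonglongrightarrow> u z"
    and h: "\<And>n. h n \<in> L2 (ball 0 1)" "p \<in> L2 (ball 0 1)"
      "L2_tendsto (ball 0 1) h p"
  shows "L2_tendsto (ball 0 1) (\<lambda>n z. \<Phi>' (f n z) (h n z)) (\<lambda>z. \<Phi>' (u z) (p z))"
proof -
  note m = smooth_lipschitz_measurable(1)[OF \<Phi>]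
  note B = smooth_lipschitzD(3)[OF \<Phi>]
  have L: "(\<lambda>z. \<Phi>' (v z) (r z)) \<in> L2 (ball 0 1)" if "v \<in> L2 (ball 0 1)" "r \<in> L2 (ball 0 1)" for v r
    by (rule L2_bound[OF m[OF L2D(1)[OF that(1)] L2D(1)[OF that(2)]] that(2)]) (use B in auto)
  show ?thesis
  proof (rule L2_limit_triangle[OF L[OF f(1) h(1)] L[OF f(1) h(2)] L[OF f(2) h(2)]])
    have "\<Phi>' (f n z) (h n z) - \<Phi>' (f n z) (p z) = \<Phi>' (f n z) (h n z - p z)" for n z
      using linear_diff[OF has_derivative_linear[OF smooth_lipschitzD(1)[OF \<Phi>]]] by simp
    then show "(\<lambda>n. \<integral>z. (cmod (\<Phi>' (f n z) (h n z) - \<Phi>' (f n z) (p z)))\<^sup>2 \<partial>lebesgue_on (ball 0 1)) \<longlonglongrightarrow> 0"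
      using L2_limit_mono[OF L2_diff[OF h(1) h(2)] m[OF L2D(1)[OF f(1)] L2D(1)[OF L2_diff[OF h(1) h(2)]]] B h(3)]
      by simp
    have "AE z in lebesgue_on (ball 0 1). (\<lambda>n. \<Phi>' (f n z) (p z)) \<longlonglongrightarrow> \<Phi>' (u z) (p z)"
      using f(3)
    proof eventually_elim
      case (elim z)
      have "isCont (\<lambda>w. \<Phi>' w (p z)) (u z)"
        using smooth_lipschitzD(2)[OF \<Phi>, of "p z"] by (simp add: continuous_on_eq_continuous_at)
      then show ?case using isCont_tendsto_compose[OF _ elim] by blast
    qed
    then show "L2_tendsto (ball 0 1) (\<lambda>n z. \<Phi>' (f n z) (p z)) (\<lambda>z. \<Phi>' (u z) (p z))"
      by (intro L2_dominated_convergence(3)[OF m[OF L2D(1)[OF f(1)] L2D(1)[OF h(2)]] m[OF L2D(1)[OF f(2)] L2D(1)[OF h(2)]] h(2), where C = L])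
         (use B in auto)
  qed
qed

text \<open>Compose the approximating sequence, after passing to a subsequence that converges almost everywhere.\<close>

lemma sobolev_limit_compose:
  assumes X: "sobolev_limit u p q g" and \<Phi>: "smooth_lipschitz \<Phi> \<Phi>' L"
  shows "sobolev_limit (\<lambda>z. \<Phi> (u z)) (\<lambda>z. \<Phi>' (u z) (p z)) (\<lambda>z. \<Phi>' (u z) (q z)) (\<lambda>z. \<Phi> (g z))"
proof -
  let ?M = "lebesgue_on (ball (0::complex) 1)"
  obtain \<psi> where \<psi>: "\<And>n. smooth_to_boundary (\<psi> n)" and lim:
        "L2_tendsto (ball 0 1) \<psi> u"
        "L2_tendsto (ball 0 1) (\<lambda>n. dx (\<psi> n)) p"
        "L2_tendsto (ball 0 1) (\<lambda>n. dy (\<psi> n)) q"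
        "L2_tendsto {0..2 * pi} (\<lambda>n \<theta>. \<psi> n (cis \<theta>)) (\<lambda>\<theta>. g (cis \<theta>))"
    and L: "u \<in> L2 (ball 0 1)" "p \<in> L2 (ball 0 1)" "q \<in> L2 (ball 0 1)" and g: "(\<lambda>\<theta>. g (cis \<theta>)) \<in> L2 {0..2 * pi}"
    using X by (auto simp: sobolev_limit_def)
  note LP = smooth_to_boundary_L2[OF \<psi>]
  obtain r :: "nat \<Rightarrow> nat" where r: "strict_mono r" and AE: "AE z in ?M. (\<lambda>n. \<psi> (r n) z) \<longlonglongrightarrow> u z"
    using L2_limit_AE_subseq[OF LP(1) L(1) lim(1)] by blast
  note sub = LIMSEQ_subseq_LIMSEQ[OF _ r, unfolded comp_def]
  note m = smooth_lipschitz_measurable[OF \<Phi>]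
  note B = smooth_lipschitzD(3)[OF \<Phi>] note lip = smooth_lipschitzD(6)[OF \<Phi>]
  have S: "smooth_to_boundary (\<lambda>z. \<Phi> (\<psi> (r n) z))" for n by (rule smooth_lipschitzD(4)[OF \<Phi> \<psi>])
  have D: "dx (\<lambda>z. \<Phi> (\<psi> (r n) z)) z = \<Phi>' (\<psi> (r n) z) (dx (\<psi> (r n)) z)"
    "dy (\<lambda>z. \<Phi> (\<psi> (r n) z)) z = \<Phi>' (\<psi> (r n) z) (dy (\<psi> (r n)) z)" if "z \<in> ball 0 1" for n z
  proof -
    obtain S where S: "cball 0 1 \<subseteq> S" "Ck_on (Suc 0) S (\<psi> (r n))"
      using \<psi>[of "r n"] by (auto simp: smooth_to_boundary_def smooth_on_def)
    then have "z \<in> S" using that by auto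
    from has_derivative_compose[OF Ck_on_SucD(1)[OF S(2) this] smooth_lipschitzD(1)[OF \<Phi>]]
    have "((\<lambda>z. \<Phi> (\<psi> (r n) z)) has_derivative (\<lambda>v. \<Phi>' (\<psi> (r n) z) (frechet_derivative (\<psi> (r n)) (at z) v))) (at z)" .
    from frechet_derivative_at[OF this]
    show "dx (\<lambda>z. \<Phi> (\<psi> (r n) z)) z = \<Phi>' (\<psi> (r n) z) (dx (\<psi> (r n)) z)"
      "dy (\<lambda>z. \<Phi> (\<psi> (r n) z)) z = \<Phi>' (\<psi> (r n) z) (dy (\<psi> (r n)) z)" by metis+
  qed
  have "(\<lambda>z. \<Phi>' (u z) (s z)) \<in> L2 (ball 0 1)" if "s \<in> L2 (ball 0 1)" for s
    by (rule L2_bound[OF m(1)[OF L2D(1)[OF L(1)] L2D(1)[OF that]] that]) (use B in auto)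
  note L' = this[OF L(2)] this[OF L(3)]
  have lipL: "(\<lambda>z. \<Phi> (v z)) \<in> L2 \<Omega>" if v: "v \<in> L2 \<Omega>" and c: "(\<lambda>z. 1 :: real) \<in> L2 \<Omega>" for v and \<Omega> :: "'a::euclidean_space set"
  proof -
    have "(\<lambda>z. cmod (v z) + 1) \<in> L2 \<Omega>"
      by (intro L2_add c L2_bound[OF _ v, of "\<lambda>z. cmod (v z)" 1]) (use L2D(1)[OF v] in auto)
    then show ?thesis
    proof (rule L2_bound[OF m(2)[OF L2D(1)[OF v] L2D(1)[OF v]], where C = "\<bar>L\<bar> + cmod (\<Phi> 0)"], intro AE_I2)
      fix z
      have "cmod (\<Phi> (v z)) \<le> cmod (\<Phi> (v z) - \<Phi> 0) + cmod (\<Phi> 0)" using norm_triangle_sub[of "\<Phi> (v z)" "\<Phi> 0"] by simp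
      also have "\<dots> \<le> \<bar>L\<bar> * cmod (v z) + cmod (\<Phi> 0)"
        using lip[of "v z" 0] mult_right_mono[OF abs_ge_self[of L] norm_ge_zero[of "v z"]] by simp
      also have "\<dots> \<le> (\<bar>L\<bar> + cmod (\<Phi> 0)) * norm (cmod (v z) + 1)" by (simp add: algebra_simps)
      finally show "cmod (\<Phi> (v z)) \<le> (\<bar>L\<bar> + cmod (\<Phi> 0)) * norm (cmod (v z) + 1)" .
    qed
  qed
  have one: "(\<lambda>z::complex. 1 :: real) \<in> L2 (ball 0 1)" by (intro continuous_on_cball_L2 continuous_on_const)
  have "(\<lambda>z::real. 1 :: complex) \<in> L2 {0..2*pi}" by (intro continuous_on_circle_L2 continuous_on_const)
  then have one': "(\<lambda>z::real. 1 :: real) \<in> L2 {0..2*pi}" by (simp add: L2_def)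
  have 1: "L2_tendsto (ball 0 1) (\<lambda>n z. \<Phi> (\<psi> (r n) z)) (\<lambda>z. \<Phi> (u z))"
    by (rule L2_limit_mono[OF L2_diff[OF LP(1) L(1)] L2D(1)[OF L2_diff[OF lipL[OF LP(1) one] lipL[OF L(1) one]]] lip sub[OF lim(1)]])
  have 2: "L2_tendsto {0..2 * pi} (\<lambda>n \<theta>. \<Phi> (\<psi> (r n) (cis \<theta>))) (\<lambda>\<theta>. \<Phi> (g (cis \<theta>)))"
    by (rule L2_limit_mono[OF L2_diff[OF LP(4) g] L2D(1)[OF L2_diff[OF lipL[OF LP(4) one'] lipL[OF g one']]] lip sub[OF lim(4)]])
  have 3: "L2_tendsto (ball 0 1) (\<lambda>n z. dx (\<lambda>z. \<Phi> (\<psi> (r n) z)) z) (\<lambda>z. \<Phi>' (u z) (p z))"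
  proof -
    have "L2_tendsto (ball 0 1) (\<lambda>n z. \<Phi>' (\<psi> (r n) z) (dx (\<psi> (r n)) z)) (\<lambda>z. \<Phi>' (u z) (p z))"
      by (rule L2_chain_limit[OF \<Phi> LP(1) L(1) AE LP(2) L(2) sub[OF lim(2)]])
    also have "(\<lambda>n. \<integral>z. (cmod (\<Phi>' (\<psi> (r n) z) (dx (\<psi> (r n)) z) - \<Phi>' (u z) (p z)))\<^sup>2 \<partial>?M)
        = (\<lambda>n. \<integral>z. (cmod (dx (\<lambda>z. \<Phi> (\<psi> (r n) z)) z - \<Phi>' (u z) (p z)))\<^sup>2 \<partial>?M)"
      by (intro ext Bochner_Integration.integral_cong) (simp_all add: D)
    finally show ?thesis .
  qed
  have 4: "L2_tendsto (ball 0 1) (\<lambda>n z. dy (\<lambda>z. \<Phi> (\<psi> (r n) z)) z) (\<lambda>z. \<Phi>' (u z) (q z))"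
  proof -
    have "L2_tendsto (ball 0 1) (\<lambda>n z. \<Phi>' (\<psi> (r n) z) (dy (\<psi> (r n)) z)) (\<lambda>z. \<Phi>' (u z) (q z))"
      by (rule L2_chain_limit[OF \<Phi> LP(1) L(1) AE LP(3) L(3) sub[OF lim(3)]])
    also have "(\<lambda>n. \<integral>z. (cmod (\<Phi>' (\<psi> (r n) z) (dy (\<psi> (r n)) z) - \<Phi>' (u z) (q z)))\<^sup>2 \<partial>?M)
        = (\<lambda>n. \<integral>z. (cmod (dy (\<lambda>z. \<Phi> (\<psi> (r n) z)) z - \<Phi>' (u z) (q z)))\<^sup>2 \<partial>?M)"
      by (intro ext Bochner_Integration.integral_cong) (simp_all add: D)
    finally show ?thesis .
  qed
  show ?thesis
    unfolding sobolev_limit_def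
    by (intro conjI lipL[OF L(1) one] L' lipL[OF g one'] exI[of _ "\<lambda>n z. \<Phi> (\<psi> (r n) z)"] allI S 1 2 3 4)
qed

section \<open>Radial maps and the modulus\<close>

lemma has_derivative_cmod_square: "((\<lambda>w. (cmod w)\<^sup>2) has_derivative (\<lambda>v. 2 * Re (cnj w * v))) (at w)"
proof -
  have "((\<lambda>w. w \<bullet> w) has_derivative (\<lambda>v. w \<bullet> v + v \<bullet> w)) (at w)"
    by (intro has_derivative_inner has_derivative_ident)
  then show ?thesis by (simp add: power2_norm_eq_inner inner_complex_def algebra_simps)
qed

lemma Ck_on_cmod_square: "open S \<Longrightarrow> Ck_on k S \<psi> \<Longrightarrow> Ck_on k S (\<lambda>z. (cmod (\<psi> z))\<^sup>2)"
  by (simp add: power2_norm_eq_inner Ck_on_inner)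

lemma abs_Re_cnj_mult_le: "\<bar>Re (cnj w * v)\<bar> \<le> cmod w * cmod v"
  using abs_Re_le_cmod[of "cnj w * v"] by (simp add: norm_mult)

lemma continuous_on_radial:
  assumes "continuous_on {0..} h"
  shows "continuous_on UNIV (\<lambda>w. h ((cmod w)\<^sup>2))"
  by (rule continuous_on_compose2[OF assms]) (auto intro!: continuous_intros)

lemma smooth_to_boundary_compose:
  assumes "\<And>S k f. open S \<Longrightarrow> Ck_on k S f \<Longrightarrow> Ck_on k S (\<lambda>z::complex. \<Phi> (f z))" and "smooth_to_boundary \<psi>"
  shows "smooth_to_boundary (\<lambda>z. \<Phi> (\<psi> z))"
proof -
  obtain S where S: "open S" "cball 0 1 \<subseteq> S" "\<And>k. Ck_on k S \<psi>"
    using assms(2) by (auto simp: smooth_to_boundary_def smooth_on_def)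
  have "smooth_on S (\<lambda>z. \<Phi> (\<psi> z))"
    unfolding smooth_on_def by (intro allI assms(1)[OF S(1,3)])
  then show ?thesis using S(1,2) unfolding smooth_to_boundary_def by (intro exI[of _ S] conjI)
qed

lemma norm_radial_derivative_le:
  "cmod (a *\<^sub>R v + (2 * b * Re (cnj w * v)) *\<^sub>R w) \<le> (\<bar>a\<bar> + 2 * (cmod w)\<^sup>2 * \<bar>b\<bar>) * cmod v"
proof -
  have "cmod (a *\<^sub>R v + (2 * b * Re (cnj w * v)) *\<^sub>R w) \<le> \<bar>a\<bar> * cmod v + 2 * \<bar>b\<bar> * \<bar>Re (cnj w * v)\<bar> * cmod w"
    by (rule order_trans[OF norm_triangle_ineq]) (simp add: abs_mult)
  also have "\<dots> \<le> \<bar>a\<bar> * cmod v + 2 * \<bar>b\<bar> * (cmod w * cmod v) * cmod w"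
    by (intro add_left_mono mult_right_mono mult_left_mono abs_Re_cnj_mult_le) auto
  also have "\<dots> = (\<bar>a\<bar> + 2 * (cmod w)\<^sup>2 * \<bar>b\<bar>) * cmod v"
    by (simp add: algebra_simps power2_eq_square)
  finally show ?thesis .
qed

text \<open>A radial map is written with $|w|^2$ in place of $|w|$, which makes it smooth at the origin.\<close>

lemma smooth_lipschitz_radial:
  fixes h h' :: "real \<Rightarrow> real"
  assumes dh: "\<And>s. s \<ge> 0 \<Longrightarrow> (h has_real_derivative h' s) (at s)"
    and ch: "continuous_on {0..} h'"
    and bound: "\<And>s. s \<ge> 0 \<Longrightarrow> \<bar>h s\<bar> + 2 * s * \<bar>h' s\<bar> \<le> L"
    and smooth: "\<And>S k f. open S \<Longrightarrow> Ck_on k S f \<Longrightarrow> (\<And>x. f x \<ge> 0) \<Longrightarrow> Ck_on k S (\<lambda>x::complex. h (f x))"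
  shows "smooth_lipschitz (\<lambda>w. h ((cmod w)\<^sup>2) *\<^sub>R w)
    (\<lambda>w v. h ((cmod w)\<^sup>2) *\<^sub>R v + (2 * h' ((cmod w)\<^sup>2) * Re (cnj w * v)) *\<^sub>R w) L"
  unfolding smooth_lipschitz_def
proof (intro conjI allI impI)
  fix w :: complex
  have "((\<lambda>w. h ((cmod w)\<^sup>2)) has_derivative (\<lambda>v. h' ((cmod w)\<^sup>2) * (2 * Re (cnj w * v)))) (at w)"
    using has_derivative_compose[OF has_derivative_cmod_square dh[of "(cmod w)\<^sup>2", unfolded has_field_derivative_def]] by simp
  moreover have "h' ((cmod w)\<^sup>2) * (2 * Re (cnj w * v)) = 2 * h' ((cmod w)\<^sup>2) * Re (cnj w * v)" for v
    by (simp only: ac_simps)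
  ultimately have "((\<lambda>w. h ((cmod w)\<^sup>2)) has_derivative (\<lambda>v. 2 * h' ((cmod w)\<^sup>2) * Re (cnj w * v))) (at w)"
    by (simp only:)
  from has_derivative_scaleR[OF this has_derivative_ident]
  show "((\<lambda>w. h ((cmod w)\<^sup>2) *\<^sub>R w) has_derivative (\<lambda>v. h ((cmod w)\<^sup>2) *\<^sub>R v + (2 * h' ((cmod w)\<^sup>2) * Re (cnj w * v)) *\<^sub>R w)) (at w)"
    by (simp only:)
next
  fix v :: complex
  have "continuous_on {0..} h"
    by (rule DERIV_continuous_on[of _ h h']) (use dh in \<open>auto intro: has_field_derivative_at_within\<close>)
  then show "continuous_on UNIV (\<lambda>w. h ((cmod w)\<^sup>2) *\<^sub>R v + (2 * h' ((cmod w)\<^sup>2) * Re (cnj w * v)) *\<^sub>R w)"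
    by (intro continuous_intros continuous_on_radial ch)
next
  fix w v :: complex
  have "(\<bar>h ((cmod w)\<^sup>2)\<bar> + 2 * (cmod w)\<^sup>2 * \<bar>h' ((cmod w)\<^sup>2)\<bar>) * cmod v \<le> L * cmod v"
    using bound[of "(cmod w)\<^sup>2"] by (intro mult_right_mono) auto
  from order_trans[OF norm_radial_derivative_le this] show "cmod (h ((cmod w)\<^sup>2) *\<^sub>R v + (2 * h' ((cmod w)\<^sup>2) * Re (cnj w * v)) *\<^sub>R w) \<le> L * cmod v" .
next
  fix \<psi> :: "complex \<Rightarrow> complex" assume "smooth_to_boundary \<psi>"
  then show "smooth_to_boundary (\<lambda>z. h ((cmod (\<psi> z))\<^sup>2) *\<^sub>R \<psi> z)"
    by (rule smooth_to_boundary_compose[rotated]) (intro Ck_on_scaleR smooth Ck_on_cmod_square; simp)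
qed

lemma smooth_lipschitz_sqrt:
  fixes d :: real
  assumes "d > 0"
  shows "smooth_lipschitz (\<lambda>w. of_real ((d + (cmod w)\<^sup>2) powr (1/2)))
    (\<lambda>w v. of_real ((d + (cmod w)\<^sup>2) powr (- (1/2)) * Re (cnj w * v))) 1"
  unfolding smooth_lipschitz_def
proof (intro conjI allI impI)
  fix w :: complex
  have pos: "d + (cmod w)\<^sup>2 > 0" using assms by (simp add: add_pos_nonneg)
  have "((\<lambda>w. d + (cmod w)\<^sup>2) has_derivative (\<lambda>v. 2 * Re (cnj w * v))) (at w)"
    using has_derivative_add[OF has_derivative_const has_derivative_cmod_square] by simp
  from has_derivative_compose[OF this has_real_derivative_powr[OF pos, of "1/2", unfolded has_field_derivative_def]]
  have "((\<lambda>w. (d + (cmod w)\<^sup>2) powr (1/2)) has_derivative (\<lambda>v. (d + (cmod w)\<^sup>2) powr (- (1/2)) * Re (cnj w * v))) (at w)"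
    by (rule has_derivative_eq_rhs) (simp add: fun_eq_iff field_simps)
  from has_derivative_of_real[OF this]
  show "((\<lambda>w. of_real ((d + (cmod w)\<^sup>2) powr (1/2)) :: complex) has_derivative (\<lambda>v. of_real ((d + (cmod w)\<^sup>2) powr (- (1/2)) * Re (cnj w * v)))) (at w)" .
next
  fix v :: complex
  have "d + (cmod w)\<^sup>2 \<noteq> 0" for w using assms by (smt (verit) zero_le_power2)
  then show "continuous_on UNIV (\<lambda>w. of_real ((d + (cmod w)\<^sup>2) powr (- (1/2)) * Re (cnj w * v)) :: complex)"
    by (intro continuous_intros) auto
next
  fix w v :: complex
  have pos: "d + (cmod w)\<^sup>2 > 0" using assms by (simp add: add_pos_nonneg)
  have "cmod w \<le> sqrt (d + (cmod w)\<^sup>2)" using assms by (intro real_le_rsqrt) simp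
  then have "(d + (cmod w)\<^sup>2) powr (- (1/2)) * cmod w \<le> 1"
    using pos by (simp add: powr_minus powr_half_sqrt field_simps)
  then have "(d + (cmod w)\<^sup>2) powr (- (1/2)) * cmod w * cmod v \<le> 1 * cmod v" by (rule mult_right_mono) simp
  moreover have "cmod (of_real ((d + (cmod w)\<^sup>2) powr (- (1/2)) * Re (cnj w * v))) = (d + (cmod w)\<^sup>2) powr (- (1/2)) * \<bar>Re (cnj w * v)\<bar>"
    by (simp only: norm_of_real abs_mult abs_of_nonneg powr_ge_zero)
  ultimately show "cmod (of_real ((d + (cmod w)\<^sup>2) powr (- (1/2)) * Re (cnj w * v))) \<le> 1 * cmod v"
    using mult_left_mono[OF abs_Re_cnj_mult_le[of w v] powr_ge_zero[of "d + (cmod w)\<^sup>2" "-(1/2)"]]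
    by (simp only: mult.assoc)
next
  fix \<psi> :: "complex \<Rightarrow> complex" assume "smooth_to_boundary \<psi>"
  then show "smooth_to_boundary (\<lambda>z. of_real ((d + (cmod (\<psi> z))\<^sup>2) powr (1/2)))"
    by (rule smooth_to_boundary_compose[rotated])
       (intro Ck_on_of_real Ck_on_powr Ck_on_add Ck_on_const Ck_on_cmod_square; simp add: assms add_pos_nonneg)
qed

lemma has_weak_deriv_zero:
  "has_weak_deriv \<Omega> e (\<lambda>x. 0 :: 'b::euclidean_space) (\<lambda>x. 0)"
  by (simp add: has_weak_deriv_def locally_integrable_def)

lemma has_real_derivative_shift_powr:
  assumes "d + s > 0"
  shows "((\<lambda>s. (d + s) powr a) has_real_derivative a * (d + s) powr (a - 1)) (at s)"
  using DERIV_chain2[OF has_real_derivative_powr[OF assms, of a] DERIV_add[OF DERIV_const DERIV_ident]] by simp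

text \<open>On the zero set the gradient vanishes: $\sqrt{\delta}\,u/\sqrt{\delta+|u|^2}$ tends to $0$ uniformly
  as $\delta\to0$, while its derivatives tend to those of $u$ on the zero set and to $0$ elsewhere.\<close>

lemma gradient_zero_on_zero_set:
  assumes X: "sobolev_limit u p q g"
  shows "AE z in lebesgue_on (ball 0 1). u z = 0 \<longrightarrow> p z = 0 \<and> q z = 0"
proof -
  let ?M = "lebesgue_on (ball (0::complex) 1)"
  have L: "u \<in> L2 (ball 0 1)" "p \<in> L2 (ball 0 1)" "q \<in> L2 (ball 0 1)" using X by (auto simp: sobolev_limit_def)
  note [measurable] = L2D(1)[OF L(1)] L2D(1)[OF L(2)] L2D(1)[OF L(3)]
  define d where "d n = inverse (real (Suc n))" for n
  have d: "d n > 0" for n by (simp add: d_def)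
  define h where "h n s = d n powr (1/2) * (d n + s) powr (- (1/2))" for n s
  define h' where "h' n s = d n powr (1/2) * (- (1/2) * (d n + s) powr (- (1/2) - 1))" for n s
  have hpos: "0 \<le> h n s" for n s by (simp add: h_def)
  have h'h: "2 * s * \<bar>h' n s\<bar> \<le> h n s" if "s \<ge> 0" for n s
  proof -
    have pos: "d n + s > 0" using d[of n] that by simp
    have "2 * s * \<bar>h' n s\<bar> = h n s * (s / (d n + s))"
    proof -
      have "(d n + s) powr (- (1/2) - 1) = (d n + s) powr (- (1/2)) / (d n + s)"
        unfolding powr_diff using pos by simp
      then show ?thesis using pos unfolding h'_def h_def by (simp add: abs_mult) (simp add: field_simps)
    qed
    also have "\<dots> \<le> h n s * 1" using that d[of n] hpos by (intro mult_left_mono) auto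
    finally show ?thesis by simp
  qed
  have h_le: "h n s \<le> sqrt (d n) / sqrt s" if "s > 0" for n s
  proof -
    have "h n s = sqrt (d n) / sqrt (d n + s)"
      using d[of n] that by (simp add: h_def powr_minus powr_half_sqrt field_simps)
    also have "\<dots> \<le> sqrt (d n) / sqrt s" using d[of n] that by (intro divide_left_mono) auto
    finally show ?thesis .
  qed
  have h1: "h n s \<le> 1" if "s \<ge> 0" for n s
  proof -
    have "h n s = sqrt (d n) / sqrt (d n + s)"
      using d[of n] that by (simp add: h_def powr_minus powr_half_sqrt field_simps)
    also have "\<dots> \<le> 1" using d[of n] that by simp
    finally show ?thesis .
  qed
  have h0: "h n 0 = 1" for n using d[of n] by (simp add: h_def powr_minus)
  have hlim: "(\<lambda>n. h n s) \<longlonglongrightarrow> 0" if "s > 0" for s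
  proof (rule tendsto_sandwich[OF _ _ tendsto_const])
    have "d \<longlonglongrightarrow> 0" using LIMSEQ_inverse_real_of_nat by (simp add: d_def[abs_def])
    from tendsto_divide[OF tendsto_real_sqrt[OF this] tendsto_const[of "sqrt s"]] that
    show "(\<lambda>n. sqrt (d n) / sqrt s) \<longlonglongrightarrow> 0" by simp
  qed (use hpos h_le that in auto)
  have \<Phi>: "smooth_lipschitz (\<lambda>w. h n ((cmod w)\<^sup>2) *\<^sub>R w)
    (\<lambda>w v. h n ((cmod w)\<^sup>2) *\<^sub>R v + (2 * h' n ((cmod w)\<^sup>2) * Re (cnj w * v)) *\<^sub>R w) 2" for n
  proof (rule smooth_lipschitz_radial)
    fix s :: real assume s: "s \<ge> 0"
    then show "(h n has_real_derivative h' n s) (at s)"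
      unfolding h_def[abs_def] h'_def using d[of n] by (intro DERIV_cmult has_real_derivative_shift_powr) simp
    show "\<bar>h n s\<bar> + 2 * s * \<bar>h' n s\<bar> \<le> 2" using h1[OF s, of n] h'h[OF s, of n] hpos[of n s] by simp
  next
    have "d n + s \<noteq> 0" if "s \<in> {0..}" for s using d[of n] that by auto
    then show "continuous_on {0..} (h' n)" unfolding h'_def[abs_def] by (intro continuous_intros) auto
  next
    fix S :: "complex set" and k f assume "open S" "Ck_on k S f" "\<And>x. (0::real) \<le> f x"
    then show "Ck_on k S (\<lambda>x. h n (f x))"
      unfolding h_def using d[of n] by (intro Ck_on_mult Ck_on_powr Ck_on_add Ck_on_const) (auto simp: add_pos_nonneg)
  qed
  have bd: "cmod (h n ((cmod w)\<^sup>2) *\<^sub>R v + (2 * h' n ((cmod w)\<^sup>2) * Re (cnj w * v)) *\<^sub>R w) \<le> 2 * h n ((cmod w)\<^sup>2) * cmod v" for n w v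
  proof -
    have "(\<bar>h n ((cmod w)\<^sup>2)\<bar> + 2 * (cmod w)\<^sup>2 * \<bar>h' n ((cmod w)\<^sup>2)\<bar>) * cmod v \<le> 2 * h n ((cmod w)\<^sup>2) * cmod v"
      using h'h[of "(cmod w)\<^sup>2" n] hpos[of n "(cmod w)\<^sup>2"] by (intro mult_right_mono) auto
    from order_trans[OF norm_radial_derivative_le this] show ?thesis .
  qed
  have u0: "L2_tendsto (ball 0 1) (\<lambda>n z. h n ((cmod (u z))\<^sup>2) *\<^sub>R u z) (\<lambda>z. 0)"
  proof (rule L2_dominated_convergence(3)[where C = 1 and w = u])
    show "(\<lambda>z. h n ((cmod (u z))\<^sup>2) *\<^sub>R u z) \<in> borel_measurable ?M" for n
      by (rule smooth_lipschitz_measurable(2)[OF \<Phi>]) measurable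
    show "AE z in ?M. cmod (h n ((cmod (u z))\<^sup>2) *\<^sub>R u z) \<le> 1 * cmod (u z)" for n
      using h1[of "(cmod (u _))\<^sup>2" n] hpos[of n] by (intro AE_I2) (simp add: mult_left_le_one_le)
    show "AE z in ?M. (\<lambda>n. h n ((cmod (u z))\<^sup>2) *\<^sub>R u z) \<longlonglongrightarrow> 0"
    proof (rule AE_I2)
      fix z show "(\<lambda>n. h n ((cmod (u z))\<^sup>2) *\<^sub>R u z) \<longlonglongrightarrow> 0"
        using tendsto_scaleR[OF hlim[of "(cmod (u z))\<^sup>2"] tendsto_const[of "u z"]] by (cases "u z = 0") auto
    qed
  qed (use L in auto)
  have *: "AE z in ?M. u z = 0 \<longrightarrow> r z = 0" if e: "e \<in> Basis" and r: "r \<in> L2 (ball 0 1)"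
    and w: "\<And>n. has_weak_deriv (ball 0 1) e (\<lambda>z. h n ((cmod (u z))\<^sup>2) *\<^sub>R u z)
       (\<lambda>z. h n ((cmod (u z))\<^sup>2) *\<^sub>R r z + (2 * h' n ((cmod (u z))\<^sup>2) * Re (cnj (u z) * r z)) *\<^sub>R u z)"
     and L1: "\<And>n. (\<lambda>z. h n ((cmod (u z))\<^sup>2) *\<^sub>R u z) \<in> L2 (ball 0 1)" for e r
  proof -
    note [measurable] = L2D(1)[OF r]
    let ?d = "\<lambda>n z. h n ((cmod (u z))\<^sup>2) *\<^sub>R r z + (2 * h' n ((cmod (u z))\<^sup>2) * Re (cnj (u z) * r z)) *\<^sub>R u z"
    define R where "R z = (if u z = 0 then r z else 0)" for z
    have m1: "?d n \<in> borel_measurable ?M" for n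
      by (rule smooth_lipschitz_measurable(1)[OF \<Phi>]) measurable
    have m2: "R \<in> borel_measurable ?M" unfolding R_def[abs_def] by measurable
    have b: "AE z in ?M. cmod (?d n z) \<le> 2 * cmod (r z)" for n
    proof (rule AE_I2)
      fix z
      have "2 * h n ((cmod (u z))\<^sup>2) * cmod (r z) \<le> 2 * 1 * cmod (r z)"
        by (intro mult_right_mono mult_left_mono h1) auto
      with bd[of n "u z" "r z"] show "cmod (?d n z) \<le> 2 * cmod (r z)" by linarith
    qed
    have c: "AE z in ?M. (\<lambda>n. ?d n z) \<longlonglongrightarrow> R z"
    proof (rule AE_I2)
      fix z
      show "(\<lambda>n. ?d n z) \<longlonglongrightarrow> R z"
      proof (cases "u z = 0")
        case True then show ?thesis by (simp add: R_def h0)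
      next
        case False
        then have "(\<lambda>n. 2 * h n ((cmod (u z))\<^sup>2) * cmod (r z)) \<longlonglongrightarrow> 2 * 0 * cmod (r z)"
          by (intro tendsto_intros hlim) auto
        then have "(\<lambda>n. ?d n z) \<longlonglongrightarrow> 0"
          by (intro Lim_null_comparison[OF always_eventually[rule_format, OF bd]]) simp
        then show ?thesis using False by (simp add: R_def)
      qed
    qed
    note dc = L2_dominated_convergence[OF m1 m2 r b c]
    have "has_weak_deriv (ball 0 1) e (\<lambda>z. 0) R"
      by (rule has_weak_deriv_L2_limit[OF e w L1 dc(2) _ dc(1) _ dc(3)])
         (use u0 in \<open>auto intro!: continuous_on_cball_L2\<close>)
    from has_weak_deriv_unique[OF open_ball this has_weak_deriv_zero]
    show ?thesis by eventually_elim (auto simp: R_def)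
  qed
  note XC = sobolev_limit_compose[OF X \<Phi>]
  have L1: "(\<lambda>z. h n ((cmod (u z))\<^sup>2) *\<^sub>R u z) \<in> L2 (ball 0 1)" for n
    using XC[of n] by (auto simp: sobolev_limit_def)
  have "AE z in ?M. u z = 0 \<longrightarrow> p z = 0"
    by (rule *[OF _ L(2) sobolev_limit_weak_deriv(1)[OF XC] L1]) (simp add: Basis_complex_def)
  moreover have "AE z in ?M. u z = 0 \<longrightarrow> q z = 0"
    by (rule *[OF _ L(3) sobolev_limit_weak_deriv(2)[OF XC] L1]) (simp add: Basis_complex_def)
  ultimately show ?thesis by eventually_elim auto
qed

lemma has_weak_deriv_Re:
  assumes "open \<Omega>" "e \<in> Basis" "has_weak_deriv \<Omega> e u v"
  shows "has_weak_deriv \<Omega> e (\<lambda>x. Re (u x)) (\<lambda>x. Re (v x))"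
proof -
  have l: "locally_integrable \<Omega> u" "locally_integrable \<Omega> v" using assms(3) by (auto simp: has_weak_deriv_def)
  have lR: "locally_integrable \<Omega> (\<lambda>x. Re (f x))" if "locally_integrable \<Omega> f" for f
    unfolding locally_integrable_def set_integrable_def
  proof (intro allI impI)
    fix K assume "compact K \<and> K \<subseteq> \<Omega>"
    then have "integrable lebesgue (\<lambda>x. indicator K x *\<^sub>R f x)"
      using that by (auto simp: locally_integrable_def set_integrable_def)
    from integrable_Re[OF this] show "integrable lebesgue (\<lambda>x. indicator K x *\<^sub>R Re (f x))" by simp
  qed
  show ?thesis
    unfolding has_weak_deriv_def
  proof (intro conjI allI impI lR l)
    fix \<phi> :: "'a \<Rightarrow> real" assume t: "test_function \<Omega> \<phi>"
    have "(\<integral>x. frechet_derivative \<phi> (at x) e *\<^sub>R Re (u x) \<partial>lebesgue_on \<Omega>) = Re (\<integral>x. frechet_derivative \<phi> (at x) e *\<^sub>R u x \<partial>lebesgue_on \<Omega>)"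
      by (subst integral_Re[symmetric, OF integrable_test_function(2)[OF t l(1) assms(1,2)]]) simp
    also have "\<dots> = - Re (\<integral>x. \<phi> x *\<^sub>R v x \<partial>lebesgue_on \<Omega>)"
      using assms(3) t by (simp add: has_weak_deriv_def)
    also have "Re (\<integral>x. \<phi> x *\<^sub>R v x \<partial>lebesgue_on \<Omega>) = (\<integral>x. \<phi> x *\<^sub>R Re (v x) \<partial>lebesgue_on \<Omega>)"
      by (subst integral_Re[symmetric, OF integrable_test_function(1)[OF t l(2) assms(1)]]) simp
    finally show "(\<integral>x. frechet_derivative \<phi> (at x) e *\<^sub>R Re (u x) \<partial>lebesgue_on \<Omega>) = - (\<integral>x. \<phi> x *\<^sub>R Re (v x) \<partial>lebesgue_on \<Omega>)" .
  qed
qed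

lemma borel_measurable_cnj [measurable (raw)]:
  "f \<in> borel_measurable M \<Longrightarrow> (\<lambda>x. cnj (f x)) \<in> borel_measurable M"
  by (erule measurable_compose, rule borel_measurable_continuous_onI, intro continuous_intros)

text \<open>The modulus is the limit of $\sqrt{\delta+|u|^2}$. On the zero set the limit of the derivatives is $0$,
  in agreement with the value of the quotient by $0$.\<close>

lemma has_weak_deriv_cmod:
  assumes X: "sobolev_limit u p q g"
  shows "has_weak_deriv (ball 0 1) 1 (\<lambda>z. cmod (u z)) (\<lambda>z. Re (cnj (u z) * p z) / cmod (u z))"
    and "has_weak_deriv (ball 0 1) \<i> (\<lambda>z. cmod (u z)) (\<lambda>z. Re (cnj (u z) * q z) / cmod (u z))"
proof -
  let ?M = "lebesgue_on (ball (0::complex) 1)"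
  have L: "u \<in> L2 (ball 0 1)" "p \<in> L2 (ball 0 1)" "q \<in> L2 (ball 0 1)" using X by (auto simp: sobolev_limit_def)
  note [measurable] = L2D(1)[OF L(1)] L2D(1)[OF L(2)] L2D(1)[OF L(3)]
  define d where "d n = inverse (real (Suc n))" for n
  have d: "d n > 0" "d n \<le> 1" for n by (auto simp: d_def divide_simps)
  have dlim: "d \<longlonglongrightarrow> 0" using LIMSEQ_inverse_real_of_nat by (simp add: d_def[abs_def])
  have pos: "d n + s > 0" if "s \<ge> 0" for n s using d(1)[of n] that by simp
  note \<Phi> = smooth_lipschitz_sqrt[OF d(1)]
  let ?S = "\<lambda>n z. of_real ((d n + (cmod (u z))\<^sup>2) powr (1/2)) :: complex"
  note XC = sobolev_limit_compose[OF X \<Phi>]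
  have one: "(\<lambda>z. cmod (u z) + 1) \<in> L2 (ball 0 1)"
    by (intro L2_add L2_bound[OF _ L(1), of "\<lambda>z. cmod (u z)" 1] continuous_on_cball_L2 continuous_on_const) auto
  have sq: "(d n + (cmod w)\<^sup>2) powr (1/2) = sqrt (d n + (cmod w)\<^sup>2)" for n w
    using pos[of "(cmod w)\<^sup>2" n] by (simp add: powr_half_sqrt)
  have LS: "(?S n) \<in> L2 (ball 0 1)" for n using XC[of n] by (auto simp: sobolev_limit_def)
  have S1: "AE z in ?M. cmod (?S n z) \<le> 1 * norm (cmod (u z) + 1)" for n
  proof (rule AE_I2)
    fix z
    have "sqrt (d n + (cmod (u z))\<^sup>2) \<le> cmod (u z) + 1"
    proof (rule real_le_lsqrt)
      have "d n \<le> 1 + 2 * cmod (u z)" using d(2)[of n] norm_ge_zero[of "u z"] by linarith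
      then show "d n + (cmod (u z))\<^sup>2 \<le> (cmod (u z) + 1)\<^sup>2" by (simp add: power2_sum)
    qed simp
    then show "cmod (?S n z) \<le> 1 * norm (cmod (u z) + 1)" using pos[of "(cmod (u z))\<^sup>2" n] unfolding sq by (simp add: less_imp_le)
  qed
  have S2: "AE z in ?M. (\<lambda>n. ?S n z) \<longlonglongrightarrow> of_real (cmod (u z))"
  proof (rule AE_I2)
    fix z
    have "(\<lambda>n. sqrt (d n + (cmod (u z))\<^sup>2)) \<longlonglongrightarrow> sqrt (0 + (cmod (u z))\<^sup>2)" by (intro tendsto_intros dlim)
    then show "(\<lambda>n. ?S n z) \<longlonglongrightarrow> of_real (cmod (u z))" unfolding sq by (intro tendsto_of_real) simp
  qed
  have Su: "(\<lambda>z. of_real (cmod (u z)) :: complex) \<in> L2 (ball 0 1)"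
    and Slim: "L2_tendsto (ball 0 1) ?S (\<lambda>z. of_real (cmod (u z)))"
    using L2_dominated_convergence[OF L2D(1)[OF LS] _ one S1 S2] by auto
  have *: "has_weak_deriv (ball 0 1) e (\<lambda>z. cmod (u z)) (\<lambda>z. Re (cnj (u z) * r z) / cmod (u z))"
    if e: "e \<in> Basis" and r: "r \<in> L2 (ball 0 1)"
    and w: "\<And>n. has_weak_deriv (ball 0 1) e (?S n) (\<lambda>z. of_real ((d n + (cmod (u z))\<^sup>2) powr (- (1/2)) * Re (cnj (u z) * r z)))" for e r
  proof -
    note [measurable] = L2D(1)[OF r]
    let ?d = "\<lambda>n z. of_real ((d n + (cmod (u z))\<^sup>2) powr (- (1/2)) * Re (cnj (u z) * r z)) :: complex"
    let ?R = "\<lambda>z. of_real (Re (cnj (u z) * r z) / cmod (u z)) :: complex"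
    have m1: "?d n \<in> borel_measurable ?M" for n
      by (rule smooth_lipschitz_measurable(1)[OF \<Phi>]) measurable
    have m2: "?R \<in> borel_measurable ?M" by measurable
    have b: "AE z in ?M. cmod (?d n z) \<le> 1 * cmod (r z)" for n
      by (intro AE_I2 smooth_lipschitzD(3)[OF \<Phi>])
    have c: "AE z in ?M. (\<lambda>n. ?d n z) \<longlonglongrightarrow> ?R z"
    proof (rule AE_I2)
      fix z
      show "(\<lambda>n. ?d n z) \<longlonglongrightarrow> ?R z"
      proof (cases "u z = 0")
        case False
        have "(\<lambda>n. inverse (sqrt (d n + (cmod (u z))\<^sup>2)) * Re (cnj (u z) * r z)) \<longlonglongrightarrow> inverse (sqrt (0 + (cmod (u z))\<^sup>2)) * Re (cnj (u z) * r z)"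
          by (intro tendsto_intros dlim) (use False in auto)
        then have "(\<lambda>n. (d n + (cmod (u z))\<^sup>2) powr (- (1/2)) * Re (cnj (u z) * r z)) \<longlonglongrightarrow> Re (cnj (u z) * r z) / cmod (u z)"
          unfolding powr_minus sq by (simp add: divide_inverse mult.commute)
        then show ?thesis by (rule tendsto_of_real)
      qed simp
    qed
    note dc = L2_dominated_convergence[OF m1 m2 r b c]
    have "has_weak_deriv (ball 0 1) e (\<lambda>z. of_real (cmod (u z))) ?R"
      by (rule has_weak_deriv_L2_limit[OF e w LS dc(2) Su dc(1) Slim dc(3)])
    from has_weak_deriv_Re[OF open_ball e this] show ?thesis by (simp only: Re_complex_of_real)
  qed
  show "has_weak_deriv (ball 0 1) 1 (\<lambda>z. cmod (u z)) (\<lambda>z. Re (cnj (u z) * p z) / cmod (u z))"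
    by (rule *[OF _ L(2) sobolev_limit_weak_deriv(1)[OF XC]]) (simp add: Basis_complex_def)
  show "has_weak_deriv (ball 0 1) \<i> (\<lambda>z. cmod (u z)) (\<lambda>z. Re (cnj (u z) * q z) / cmod (u z))"
    by (rule *[OF _ L(3) sobolev_limit_weak_deriv(2)[OF XC]]) (simp add: Basis_complex_def)
qed

section \<open>The Jacobian as a null Lagrangian\<close>

text \<open>With $\eta$ smooth up to the boundary, both sides of Green's formula are continuous in the
  first argument, so a vanishing trace suffices.\<close>

lemma Green_zero_trace_smooth:
  assumes X: "sobolev_limit w p q (\<lambda>z. 0)" and \<eta>: "smooth_to_boundary \<eta>"
  shows "(\<integral>z. p z * dy \<eta> z - q z * dx \<eta> z \<partial>lebesgue_on (ball 0 1)) = 0"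
proof -
  let ?M = "lebesgue_on (ball (0::complex) 1)"
  obtain \<psi> where \<psi>: "\<And>n. smooth_to_boundary (\<psi> n)" and lim:
        "L2_tendsto (ball 0 1) (\<lambda>n. dx (\<psi> n)) p"
        "L2_tendsto (ball 0 1) (\<lambda>n. dy (\<psi> n)) q"
        "L2_tendsto {0..2 * pi} (\<lambda>n \<theta>. \<psi> n (cis \<theta>)) (\<lambda>\<theta>. 0)"
    and L: "p \<in> L2 (ball 0 1)" "q \<in> L2 (ball 0 1)" 
    using X unfolding sobolev_limit_def by blast
  note LP = smooth_to_boundary_L2[OF \<psi>] note LE = smooth_to_boundary_L2[OF \<eta>]
  define k where "k \<theta> = of_real (cos \<theta>) * dy \<eta> (cis \<theta>) - of_real (sin \<theta>) * dx \<eta> (cis \<theta>)" for \<theta> :: real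
  have kc: "continuous_on {0..2*pi} k" unfolding k_def[abs_def]
    by (intro continuous_intros continuous_on_compose2[OF LE(6), of _ cis] continuous_on_compose2[OF LE(7), of _ cis]) auto
  have kL: "k \<in> L2 {0..2*pi}" by (rule continuous_on_circle_L2[OF kc])
  have 0: "(\<lambda>\<theta>. 0::complex) \<in> L2 {0..2*pi}" by (intro continuous_on_circle_L2 continuous_on_const)
  have G: "(\<integral>z. dx (\<psi> n) z * dy \<eta> z - dy (\<psi> n) z * dx \<eta> z \<partial>?M) = (\<integral>\<theta>. \<psi> n (cis \<theta>) * k \<theta> \<partial>lebesgue_on {0..2*pi})" for n
  proof -
    obtain S where S: "open S" "cball 0 1 \<subseteq> S" "\<And>k. Ck_on k S (\<psi> n)"
      using \<psi>[of n] by (auto simp: smooth_to_boundary_def smooth_on_def)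
    obtain T where T: "open T" "cball 0 1 \<subseteq> T" "\<And>k. Ck_on k T \<eta>"
      using \<eta> by (auto simp: smooth_to_boundary_def smooth_on_def)
    have "(\<integral>z. dx (\<psi> n) z * dy \<eta> z - dy (\<psi> n) z * dx \<eta> z \<partial>?M) = integral {0..2*pi} (\<lambda>\<theta>. \<psi> n (cis \<theta>) * k \<theta>)"
      using Green_disc[of "S \<inter> T" "\<psi> n" \<eta>] S(1,2) T(1,2) Ck_on_subset[OF S(3), of "S \<inter> T"] Ck_on_subset[OF T(3), of "S \<inter> T"]
      by (simp add: k_def scaleR_conv_of_real open_Int)
    also have "\<dots> = (\<integral>\<theta>. \<psi> n (cis \<theta>) * k \<theta> \<partial>lebesgue_on {0..2*pi})"
      by (rule lebesgue_integral_eq_integral[symmetric, OF L2_integrable_mult[OF LP(4) kL]]) simp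
    finally show ?thesis .
  qed
  have "(\<lambda>n. (\<integral>z. dx (\<psi> n) z * dy \<eta> z \<partial>?M) - (\<integral>z. dy (\<psi> n) z * dx \<eta> z \<partial>?M)) \<longlonglongrightarrow> (\<integral>z. p z * dy \<eta> z \<partial>?M) - (\<integral>z. q z * dx \<eta> z \<partial>?M)"
    by (intro tendsto_diff L2_tendsto_pairing[OF LP(2) L(1) LE(3) lim(1)] L2_tendsto_pairing[OF LP(3) L(2) LE(2) lim(2)])
  then have "(\<lambda>n. \<integral>\<theta>. \<psi> n (cis \<theta>) * k \<theta> \<partial>lebesgue_on {0..2*pi}) \<longlonglongrightarrow> (\<integral>z. p z * dy \<eta> z - q z * dx \<eta> z \<partial>?M)"
    using L2_integrable_mult[OF LP(2) LE(3)] L2_integrable_mult[OF LP(3) LE(2)] L2_integrable_mult[OF L(1) LE(3)] L2_integrable_mult[OF L(2) LE(2)]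
    by (simp add: G[symmetric])
  moreover have "(\<lambda>n. \<integral>\<theta>. \<psi> n (cis \<theta>) * k \<theta> \<partial>lebesgue_on {0..2*pi}) \<longlonglongrightarrow> (\<integral>\<theta>. 0 * k \<theta> \<partial>lebesgue_on {0..2*pi})"
    by (rule L2_tendsto_pairing[OF LP(4) 0 kL lim(3)])
  ultimately show ?thesis using LIMSEQ_unique by fastforce
qed

text \<open>The second argument is made rough only after the limit in the first one. A simultaneous limit is out of
  reach, since the boundary term contains the tangential derivative of the second argument, which is not controlled
  by convergence of the traces in $L^2$.\<close>

lemma Green_zero_trace:
  assumes X: "sobolev_limit w p q (\<lambda>z. 0)" and Y: "sobolev_limit v r s g"
  shows "(\<integral>z. p z * s z - q z * r z \<partial>lebesgue_on (ball 0 1)) = 0"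
proof -
  let ?M = "lebesgue_on (ball (0::complex) 1)"
  obtain \<psi> where \<psi>: "\<And>n. smooth_to_boundary (\<psi> n)" and lim:
        "L2_tendsto (ball 0 1) (\<lambda>n. dx (\<psi> n)) r"
        "L2_tendsto (ball 0 1) (\<lambda>n. dy (\<psi> n)) s"
    and LR: "r \<in> L2 (ball 0 1)" "s \<in> L2 (ball 0 1)" 
    using Y unfolding sobolev_limit_def by blast
  have L: "p \<in> L2 (ball 0 1)" "q \<in> L2 (ball 0 1)" using X by (auto simp: sobolev_limit_def)
  note LP = smooth_to_boundary_L2[OF \<psi>]
  have "(\<lambda>n. (\<integral>z. dy (\<psi> n) z * p z \<partial>?M) - (\<integral>z. dx (\<psi> n) z * q z \<partial>?M)) \<longlonglongrightarrow> (\<integral>z. s z * p z \<partial>?M) - (\<integral>z. r z * q z \<partial>?M)"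
    by (intro tendsto_diff L2_tendsto_pairing[OF LP(3) LR(2) L(1) lim(2)] L2_tendsto_pairing[OF LP(2) LR(1) L(2) lim(1)])
  moreover have "(\<integral>z. dy (\<psi> n) z * p z \<partial>?M) - (\<integral>z. dx (\<psi> n) z * q z \<partial>?M) = 0" for n
    using Green_zero_trace_smooth[OF X \<psi>, of n] L2_integrable_mult[OF L(1) LP(3)] L2_integrable_mult[OF L(2) LP(2)]
    by (simp add: mult.commute)
  ultimately have "(\<integral>z. s z * p z \<partial>?M) - (\<integral>z. r z * q z \<partial>?M) = 0" by (simp add: LIMSEQ_const_iff)
  then show ?thesis
    using L2_integrable_mult[OF L(1) LR(2)] L2_integrable_mult[OF L(2) LR(1)] by (simp add: mult.commute)
qed

lemma sobolev_limit_cnj: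
  assumes "sobolev_limit u p q g"
  shows "sobolev_limit (\<lambda>z. cnj (u z)) (\<lambda>z. cnj (p z)) (\<lambda>z. cnj (q z)) (\<lambda>z. cnj (g z))"
proof (rule sobolev_limit_compose[OF assms])
  show "smooth_lipschitz cnj (\<lambda>w. cnj) 1"
    unfolding smooth_lipschitz_def
    by (auto intro!: smooth_to_boundary_compose[of cnj] Ck_on_bounded_linear[OF _ bounded_linear_cnj]
        bounded_linear_imp_has_derivative bounded_linear_cnj)
qed

lemma L2_limit_diff:
  fixes a b :: "nat \<Rightarrow> 'a::euclidean_space \<Rightarrow> 'b::euclidean_space"
  assumes "\<And>n. a n \<in> L2 \<Omega>" "\<And>n. b n \<in> L2 \<Omega>" "A \<in> L2 \<Omega>" "B \<in> L2 \<Omega>"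
    and "L2_tendsto \<Omega> a A"
    and "L2_tendsto \<Omega> b B"
  shows "L2_tendsto \<Omega> (\<lambda>n x. a n x - b n x) (\<lambda>x. A x - B x)"
proof (rule L2_limit_triangle[OF L2_diff[OF assms(1,2)] L2_diff[OF assms(3) assms(2)] L2_diff[OF assms(3,4)]])
  show "(\<lambda>n. \<integral>x. (norm ((a n x - b n x) - (A x - b n x)))\<^sup>2 \<partial>lebesgue_on \<Omega>) \<longlonglongrightarrow> 0"
    using assms(5) by simp
  show "L2_tendsto \<Omega> (\<lambda>n x. A x - b n x) (\<lambda>x. A x - B x)"
    using assms(6) by (simp add: norm_minus_commute)
qed

lemma sobolev_limit_diff:
  assumes X: "sobolev_limit u p q g" and Y: "sobolev_limit v r s k"
  shows "sobolev_limit (\<lambda>z. u z - v z) (\<lambda>z. p z - r z) (\<lambda>z. q z - s z) (\<lambda>z. g z - k z)"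
proof -
  let ?M = "lebesgue_on (ball (0::complex) 1)"
  obtain \<psi> where \<psi>: "\<And>n. smooth_to_boundary (\<psi> n)" and lim:
        "L2_tendsto (ball 0 1) \<psi> u"
        "L2_tendsto (ball 0 1) (\<lambda>n. dx (\<psi> n)) p"
        "L2_tendsto (ball 0 1) (\<lambda>n. dy (\<psi> n)) q"
        "L2_tendsto {0..2 * pi} (\<lambda>n \<theta>. \<psi> n (cis \<theta>)) (\<lambda>\<theta>. g (cis \<theta>))"
    and L: "u \<in> L2 (ball 0 1)" "p \<in> L2 (ball 0 1)" "q \<in> L2 (ball 0 1)" and g: "(\<lambda>\<theta>. g (cis \<theta>)) \<in> L2 {0..2 * pi}"
    using X unfolding sobolev_limit_def by blast
  obtain \<eta> where \<eta>: "\<And>n. smooth_to_boundary (\<eta> n)" and lim':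
        "L2_tendsto (ball 0 1) \<eta> v"
        "L2_tendsto (ball 0 1) (\<lambda>n. dx (\<eta> n)) r"
        "L2_tendsto (ball 0 1) (\<lambda>n. dy (\<eta> n)) s"
        "L2_tendsto {0..2 * pi} (\<lambda>n \<theta>. \<eta> n (cis \<theta>)) (\<lambda>\<theta>. k (cis \<theta>))"
    and L': "v \<in> L2 (ball 0 1)" "r \<in> L2 (ball 0 1)" "s \<in> L2 (ball 0 1)" and k: "(\<lambda>\<theta>. k (cis \<theta>)) \<in> L2 {0..2 * pi}"
    using Y unfolding sobolev_limit_def by blast
  note LP = smooth_to_boundary_L2[OF \<psi>] and LE = smooth_to_boundary_L2[OF \<eta>]
  \<comment> \<open>the approximations live on two neighbourhoods of the closed disc\<close>
  have SD: "smooth_to_boundary (\<lambda>z. \<psi> n z - \<eta> n z) \<and> (\<forall>z\<in>ball 0 1. dx (\<lambda>z. \<psi> n z - \<eta> n z) z = dx (\<psi> n) z - dx (\<eta> n) z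
       \<and> dy (\<lambda>z. \<psi> n z - \<eta> n z) z = dy (\<psi> n) z - dy (\<eta> n) z)" for n
  proof -
    obtain S where S: "open S" "cball 0 1 \<subseteq> S" "\<And>k. Ck_on k S (\<psi> n)"
      using \<psi>[of n] by (auto simp: smooth_to_boundary_def smooth_on_def)
    obtain T where T: "open T" "cball 0 1 \<subseteq> T" "\<And>k. Ck_on k T (\<eta> n)"
      using \<eta>[of n] by (auto simp: smooth_to_boundary_def smooth_on_def)
    have o: "open (S \<inter> T)" "cball 0 1 \<subseteq> S \<inter> T" using S T by auto
    have "smooth_on (S \<inter> T) (\<lambda>z. \<psi> n z - \<eta> n z)"
      unfolding smooth_on_def
      by (intro allI Ck_on_diff o Ck_on_subset[OF S(3)] Ck_on_subset[OF T(3)]) auto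
    then have 1: "smooth_to_boundary (\<lambda>z. \<psi> n z - \<eta> n z)" using o unfolding smooth_to_boundary_def by blast
    have "frechet_derivative (\<lambda>z. \<psi> n z - \<eta> n z) (at z) = (\<lambda>e. frechet_derivative (\<psi> n) (at z) e - frechet_derivative (\<eta> n) (at z) e)"
      if "z \<in> ball 0 1" for z
    proof -
      have "z \<in> S" "z \<in> T" using that S(2) T(2) by auto
      then show ?thesis
        by (intro frechet_derivative_at[symmetric] has_derivative_diff Ck_on_SucD(1)[OF S(3)] Ck_on_SucD(1)[OF T(3)])
    qed
    with 1 show ?thesis by simp
  qed
  have L2s: "(\<lambda>z. u z - v z) \<in> L2 (ball 0 1)" "(\<lambda>z. p z - r z) \<in> L2 (ball 0 1)" "(\<lambda>z. q z - s z) \<in> L2 (ball 0 1)"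
     "(\<lambda>\<theta>. g (cis \<theta>) - k (cis \<theta>)) \<in> L2 {0..2 * pi}"
    by (intro L2_diff L L' g k)+
  have 1: "L2_tendsto (ball 0 1) (\<lambda>n z. \<psi> n z - \<eta> n z) (\<lambda>z. u z - v z)"
    by (rule L2_limit_diff[OF LP(1) LE(1) L(1) L'(1) lim(1) lim'(1)])
  have 2: "L2_tendsto {0..2 * pi} (\<lambda>n \<theta>. \<psi> n (cis \<theta>) - \<eta> n (cis \<theta>)) (\<lambda>\<theta>. g (cis \<theta>) - k (cis \<theta>))"
    by (rule L2_limit_diff[OF LP(4) LE(4) g k lim(4) lim'(4)])
  have "L2_tendsto (ball 0 1) (\<lambda>n z. dx (\<psi> n) z - dx (\<eta> n) z) (\<lambda>z. p z - r z)"
    by (rule L2_limit_diff[OF LP(2) LE(2) L(2) L'(2) lim(2) lim'(2)])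
  also have "(\<lambda>n. \<integral>z. (cmod ((dx (\<psi> n) z - dx (\<eta> n) z) - (p z - r z)))\<^sup>2 \<partial>?M) = (\<lambda>n. \<integral>z. (cmod (dx (\<lambda>z. \<psi> n z - \<eta> n z) z - (p z - r z)))\<^sup>2 \<partial>?M)"
    using SD by (intro ext Bochner_Integration.integral_cong) auto
  finally have 3: "L2_tendsto (ball 0 1) (\<lambda>n z. dx (\<lambda>z. \<psi> n z - \<eta> n z) z) (\<lambda>z. p z - r z)" .
  have "L2_tendsto (ball 0 1) (\<lambda>n z. dy (\<psi> n) z - dy (\<eta> n) z) (\<lambda>z. q z - s z)"
    by (rule L2_limit_diff[OF LP(3) LE(3) L(3) L'(3) lim(3) lim'(3)])
  also have "(\<lambda>n. \<integral>z. (cmod ((dy (\<psi> n) z - dy (\<eta> n) z) - (q z - s z)))\<^sup>2 \<partial>?M) = (\<lambda>n. \<integral>z. (cmod (dy (\<lambda>z. \<psi> n z - \<eta> n z) z - (q z - s z)))\<^sup>2 \<partial>?M)"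
    using SD by (intro ext Bochner_Integration.integral_cong) auto
  finally have 4: "L2_tendsto (ball 0 1) (\<lambda>n z. dy (\<lambda>z. \<psi> n z - \<eta> n z) z) (\<lambda>z. q z - s z)" .
  have SD1: "smooth_to_boundary (\<lambda>z. \<psi> n z - \<eta> n z)" for n using SD by blast
  show ?thesis unfolding sobolev_limit_def
    by (intro conjI L2s exI[of _ "\<lambda>n z. \<psi> n z - \<eta> n z"] allI SD1 1 2 3 4)
qed

text \<open>The Jacobian determinant of $u$ is $\mathrm{Im}(\overline{u_x}\,u_y)$.\<close>

lemma L2_integrable_Jacobian:
  assumes "p \<in> L2 (ball 0 1)" "q \<in> L2 (ball 0 1)"
  shows "integrable (lebesgue_on (ball 0 1)) (\<lambda>z::complex. Im (cnj (p z) * q z))"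
proof (rule integrable_Im)
  have "(\<lambda>z. cnj (p z)) \<in> L2 (ball 0 1)"
    using L2D(1)[OF assms(1)] by (intro L2_bound[OF _ assms(1), of _ 1]) auto
  then show "integrable (lebesgue_on (ball 0 1)) (\<lambda>z::complex. cnj (p z) * q z)"
    using assms(2) by (rule L2_integrable_mult)
qed

text \<open>The Jacobian is a quadratic form. By polarisation, the difference of its values at $u$ and $v$ is half the sum of its
  pairings of $u-v$ with $u$ and with $v$, and $u-v$ has zero trace.\<close>

theorem Jacobian_integral_depends_on_trace:
  assumes X: "sobolev_limit u p q g" and Y: "sobolev_limit v r s g"
  shows "(\<integral>z. Im (cnj (p z) * q z) \<partial>lebesgue_on (ball 0 1)) = (\<integral>z. Im (cnj (r z) * s z) \<partial>lebesgue_on (ball 0 1))"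
proof -
  let ?M = "lebesgue_on (ball (0::complex) 1)"
  have L: "p \<in> L2 (ball 0 1)" "q \<in> L2 (ball 0 1)" "r \<in> L2 (ball 0 1)" "s \<in> L2 (ball 0 1)"
    using X Y by (auto simp: sobolev_limit_def)
  have W: "sobolev_limit (\<lambda>z. cnj (u z - v z)) (\<lambda>z. cnj (p z - r z)) (\<lambda>z. cnj (q z - s z)) (\<lambda>z. 0)"
    using sobolev_limit_cnj[OF sobolev_limit_diff[OF X Y]] by simp
  have LW: "(\<lambda>z. cnj (p z - r z)) \<in> L2 (ball 0 1)" "(\<lambda>z. cnj (q z - s z)) \<in> L2 (ball 0 1)"
    using W by (auto simp: sobolev_limit_def)
  define A where "A z = cnj (p z - r z) * q z - cnj (q z - s z) * p z" for z
  define B where "B z = cnj (p z - r z) * s z - cnj (q z - s z) * r z" for z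
  have "integrable ?M A" "integrable ?M B" unfolding A_def[abs_def] B_def[abs_def]
    by (intro Bochner_Integration.integrable_diff L2_integrable_mult LW L)+
  moreover have "integral\<^sup>L ?M A = 0" "integral\<^sup>L ?M B = 0"
    unfolding A_def[abs_def] B_def[abs_def] by (rule Green_zero_trace[OF W X] Green_zero_trace[OF W Y])+
  ultimately have I: "(\<integral>z. Im (A z) + Im (B z) \<partial>?M) = 0"
    by (simp add: integral_Im integrable_Im)
  have "Im (A z) + Im (B z) = 2 * (Im (cnj (p z) * q z) - Im (cnj (r z) * s z))" for z
    by (simp add: A_def B_def algebra_simps)
  with I have "(\<integral>z. 2 * (Im (cnj (p z) * q z) - Im (cnj (r z) * s z)) \<partial>?M) = 0" by (simp only:)
  then have "(\<integral>z. Im (cnj (p z) * q z) - Im (cnj (r z) * s z) \<partial>?M) = 0"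
    unfolding Bochner_Integration.integral_mult_right_zero by (simp only: mult_eq_0_iff) simp
  then show ?thesis using L2_integrable_Jacobian[OF L(1,2)] L2_integrable_Jacobian[OF L(3,4)] by simp
qed

section \<open>A Poincare inequality\<close>

text \<open>The divergence theorem for the field $|\psi(z)|^2z$, whose divergence is
  $2|\psi|^2+2\,\mathrm{Re}(\overline\psi\,z\cdot\nabla\psi)$; the last term is absorbed because $|z|\le1$.\<close>

lemma Poincare_smooth:
  assumes "smooth_to_boundary \<psi>"
  shows "(\<integral>z. (cmod (\<psi> z))\<^sup>2 \<partial>lebesgue_on (ball 0 1)) \<le> (\<integral>\<theta>. (cmod (\<psi> (cis \<theta>)))\<^sup>2 \<partial>lebesgue_on {0..2 * pi})
    + (\<integral>z. (cmod (dx \<psi> z))\<^sup>2 \<partial>lebesgue_on (ball 0 1)) + (\<integral>z. (cmod (dy \<psi> z))\<^sup>2 \<partial>lebesgue_on (ball 0 1))"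
proof -
  let ?M = "lebesgue_on (ball (0::complex) 1)"
  obtain S where S: "open S" "cball 0 1 \<subseteq> S" "\<And>k. Ck_on k S \<psi>"
    using assms by (auto simp: smooth_to_boundary_def smooth_on_def)
  note LP = smooth_to_boundary_L2[OF assms]
  define f where "f z = (of_real (Re z * (cmod (\<psi> z))\<^sup>2) :: complex)" for z
  define h where "h z = (of_real (Im z * (cmod (\<psi> z))\<^sup>2) :: complex)" for z
  have f: "Ck_on (Suc 0) S f" unfolding f_def[abs_def]
    by (intro Ck_on_of_real Ck_on_mult Ck_on_linear Ck_on_cmod_square S bounded_linear_Re)
  have h: "Ck_on (Suc 0) S h" unfolding h_def[abs_def]
    by (intro Ck_on_of_real Ck_on_mult Ck_on_linear Ck_on_cmod_square S bounded_linear_Im)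
  have sq: "((\<lambda>z. (cmod (\<psi> z))\<^sup>2) has_derivative (\<lambda>v. 2 * Re (cnj (\<psi> z) * frechet_derivative \<psi> (at z) v))) (at z)" if "z \<in> S" for z
    using has_derivative_compose[OF Ck_on_SucD(1)[OF S(3) that] has_derivative_cmod_square] .
  have dxf: "dx f z = of_real ((cmod (\<psi> z))\<^sup>2 + 2 * Re z * Re (cnj (\<psi> z) * dx \<psi> z))" if "z \<in> S" for z
  proof -
    have "(f has_derivative (\<lambda>v. of_real (Re z * (2 * Re (cnj (\<psi> z) * frechet_derivative \<psi> (at z) v)) + Re v * (cmod (\<psi> z))\<^sup>2))) (at z)"
      unfolding f_def[abs_def]
      by (intro has_derivative_of_real has_derivative_mult sq that bounded_linear_imp_has_derivative bounded_linear_Re)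
    from frechet_derivative_at[OF this, symmetric] show ?thesis by (simp add: algebra_simps)
  qed
  have dyh: "dy h z = of_real ((cmod (\<psi> z))\<^sup>2 + 2 * Im z * Re (cnj (\<psi> z) * dy \<psi> z))" if "z \<in> S" for z
  proof -
    have "(h has_derivative (\<lambda>v. of_real (Im z * (2 * Re (cnj (\<psi> z) * frechet_derivative \<psi> (at z) v)) + Im v * (cmod (\<psi> z))\<^sup>2))) (at z)"
      unfolding h_def[abs_def]
      by (intro has_derivative_of_real has_derivative_mult sq that bounded_linear_imp_has_derivative bounded_linear_Im)
    from frechet_derivative_at[OF this, symmetric] show ?thesis by (simp add: algebra_simps)
  qed
  have c: "continuous_on (cball 0 1) (dx f)" "continuous_on (cball 0 1) (dy h)"
    using Ck_on_dx[OF f] Ck_on_dy[OF h] S(2) by (auto intro: continuous_on_subset)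
  have cc: "continuous_on {0..2*pi} (\<lambda>\<theta>. f (cis \<theta>))" "continuous_on {0..2*pi} (\<lambda>\<theta>. h (cis \<theta>))"
    using S(2) by (auto intro!: continuous_on_compose2[OF Ck_on_imp_continuous_on[OF f], of _ cis] continuous_on_compose2[OF Ck_on_imp_continuous_on[OF h], of _ cis] continuous_intros)
  have "(\<integral>z. dx f z + dy h z \<partial>?M) = integral {0..2*pi} (\<lambda>\<theta>. cos \<theta> *\<^sub>R f (cis \<theta>)) + integral {0..2*pi} (\<lambda>\<theta>. sin \<theta> *\<^sub>R h (cis \<theta>))"
    using continuous_on_cball_integrable(2)[OF c(1)] continuous_on_cball_integrable(2)[OF c(2)]
      divergence_disc_x[OF S(1,2) f] divergence_disc_y[OF S(1,2) h] by simp
  also have "\<dots> = integral {0..2*pi} (\<lambda>\<theta>. cos \<theta> *\<^sub>R f (cis \<theta>) + sin \<theta> *\<^sub>R h (cis \<theta>))"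
    using cc by (intro integral_add[symmetric] integrable_continuous_real continuous_intros)
  also have "(\<lambda>\<theta>. cos \<theta> *\<^sub>R f (cis \<theta>) + sin \<theta> *\<^sub>R h (cis \<theta>)) = (\<lambda>\<theta>. of_real ((cmod (\<psi> (cis \<theta>)))\<^sup>2))"
  proof
    fix \<theta>
    have "cos \<theta> *\<^sub>R f (cis \<theta>) + sin \<theta> *\<^sub>R h (cis \<theta>) = of_real (((cos \<theta>)\<^sup>2 + (sin \<theta>)\<^sup>2) * (cmod (\<psi> (cis \<theta>)))\<^sup>2)"
      by (simp only: f_def h_def cis.simps scaleR_conv_of_real of_real_mult[symmetric] of_real_add[symmetric] power2_eq_square distrib_right mult.assoc)
    then show "cos \<theta> *\<^sub>R f (cis \<theta>) + sin \<theta> *\<^sub>R h (cis \<theta>) = of_real ((cmod (\<psi> (cis \<theta>)))\<^sup>2)"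
      by (simp only: sin_cos_squared_add2 mult_1)
  qed
  also have "integral {0..2*pi} (\<lambda>\<theta>. complex_of_real ((cmod (\<psi> (cis \<theta>)))\<^sup>2)) = (\<integral>\<theta>. complex_of_real ((cmod (\<psi> (cis \<theta>)))\<^sup>2) \<partial>lebesgue_on {0..2*pi})"
    using L2D(2)[OF LP(4)] by (intro lebesgue_integral_eq_integral[symmetric] integrable_of_real) auto
  finally have E: "(\<integral>z. dx f z + dy h z \<partial>?M) = of_real (\<integral>\<theta>. (cmod (\<psi> (cis \<theta>)))\<^sup>2 \<partial>lebesgue_on {0..2*pi})"
    by (simp only: integral_complex_of_real)
  define R where "R z = ((cmod (\<psi> z))\<^sup>2 + 2 * Re z * Re (cnj (\<psi> z) * dx \<psi> z)) + ((cmod (\<psi> z))\<^sup>2 + 2 * Im z * Re (cnj (\<psi> z) * dy \<psi> z))" for z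
  have Re: "Re (dx f z + dy h z) = R z" if "z \<in> ball 0 1" for z
  proof -
    have "z \<in> S" using that S(2) by auto
    then show ?thesis by (simp only: dxf dyh R_def of_real_add[symmetric] Re_complex_of_real)
  qed
  have iR: "integrable ?M (\<lambda>z. Re (dx f z + dy h z))"
    by (intro integrable_Re Bochner_Integration.integrable_add continuous_on_cball_integrable(2) c)
  have "(\<integral>z. Re (dx f z + dy h z) \<partial>?M) = Re (\<integral>z. dx f z + dy h z \<partial>?M)"
    by (intro integral_Re Bochner_Integration.integrable_add continuous_on_cball_integrable(2) c)
  then have T: "(\<integral>z. Re (dx f z + dy h z) \<partial>?M) = (\<integral>\<theta>. (cmod (\<psi> (cis \<theta>)))\<^sup>2 \<partial>lebesgue_on {0..2*pi})" by (simp add: E)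
  have pw: "(cmod (\<psi> z))\<^sup>2 \<le> Re (dx f z + dy h z) + (cmod (dx \<psi> z))\<^sup>2 + (cmod (dy \<psi> z))\<^sup>2" if z: "z \<in> ball 0 1" for z
  proof -
    \<comment> \<open>applied with $t=x$ and $t=y$; then $x^2+y^2\le1$ absorbs the terms in $|\psi|^2$\<close>
    have *: "2 * t * Re (cnj a * b) \<ge> - (t\<^sup>2 * (cmod a)\<^sup>2) - (cmod b)\<^sup>2" for t a b
    proof -
      have "0 \<le> (cmod (of_real t * a + b))\<^sup>2" by simp
      also have "\<dots> = t\<^sup>2 * (cmod a)\<^sup>2 + (cmod b)\<^sup>2 + 2 * t * Re (cnj a * b)"
        unfolding cmod_power2 by (simp add: power2_eq_square algebra_simps)
      finally show ?thesis by linarith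
    qed
    have "(Re z)\<^sup>2 + (Im z)\<^sup>2 \<le> 1" using z power_mono[of "cmod z" 1 2] by (simp add: cmod_power2[symmetric])
    then have "((Re z)\<^sup>2 + (Im z)\<^sup>2) * (cmod (\<psi> z))\<^sup>2 \<le> 1 * (cmod (\<psi> z))\<^sup>2" by (intro mult_right_mono) auto
    then show ?thesis
      using *[of "Re z" "\<psi> z" "dx \<psi> z"] *[of "Im z" "\<psi> z" "dy \<psi> z"] unfolding Re[OF z] R_def by (simp only: distrib_right)
  qed
  have "(\<integral>z. (cmod (\<psi> z))\<^sup>2 \<partial>?M) \<le> (\<integral>z. Re (dx f z + dy h z) + (cmod (dx \<psi> z))\<^sup>2 + (cmod (dy \<psi> z))\<^sup>2 \<partial>?M)"
    using L2D(2)[OF LP(1)] L2D(2)[OF LP(2)] L2D(2)[OF LP(3)] iR pw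
    by (intro integral_mono) (auto intro!: Bochner_Integration.integrable_add)
  also have "\<dots> = (\<integral>z. Re (dx f z + dy h z) \<partial>?M) + (\<integral>z. (cmod (dx \<psi> z))\<^sup>2 \<partial>?M) + (\<integral>z. (cmod (dy \<psi> z))\<^sup>2 \<partial>?M)"
    using L2D(2)[OF LP(2)] L2D(2)[OF LP(3)] iR
    by (simp add: Bochner_Integration.integral_add[OF Bochner_Integration.integrable_add] Bochner_Integration.integral_add del: plus_complex.sel)
  finally show ?thesis unfolding T .
qed

lemma zero_gradient_zero_trace:
  assumes X: "sobolev_limit w p q (\<lambda>z. 0)"
    and 0: "AE z in lebesgue_on (ball 0 1). p z = 0 \<and> q z = 0"
  shows "AE z in lebesgue_on (ball 0 1). w z = 0"
proof -
  let ?M = "lebesgue_on (ball (0::complex) 1)"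
  obtain \<psi> where \<psi>: "\<And>n. smooth_to_boundary (\<psi> n)" and lim:
        "L2_tendsto (ball 0 1) \<psi> w"
        "L2_tendsto (ball 0 1) (\<lambda>n. dx (\<psi> n)) p"
        "L2_tendsto (ball 0 1) (\<lambda>n. dy (\<psi> n)) q"
        "L2_tendsto {0..2 * pi} (\<lambda>n \<theta>. \<psi> n (cis \<theta>)) (\<lambda>\<theta>. 0)"
    and L: "w \<in> L2 (ball 0 1)" "p \<in> L2 (ball 0 1)" "q \<in> L2 (ball 0 1)"
    using X unfolding sobolev_limit_def by blast
  note LP = smooth_to_boundary_L2[OF \<psi>]
  note [measurable] = L2D(1)[OF L(2)] L2D(1)[OF L(3)] L2D(1)[OF LP(2)] L2D(1)[OF LP(3)]
  have "(\<integral>z. (cmod (dx (\<psi> n) z - p z))\<^sup>2 \<partial>?M) = (\<integral>z. (cmod (dx (\<psi> n) z))\<^sup>2 \<partial>?M)" for n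
    by (intro integral_cong_AE) (measurable, rule eventually_mono[OF 0], simp)
  with lim(2) have 2: "(\<lambda>n. \<integral>z. (cmod (dx (\<psi> n) z))\<^sup>2 \<partial>?M) \<longlonglongrightarrow> 0" by simp
  have "(\<integral>z. (cmod (dy (\<psi> n) z - q z))\<^sup>2 \<partial>?M) = (\<integral>z. (cmod (dy (\<psi> n) z))\<^sup>2 \<partial>?M)" for n
    by (intro integral_cong_AE) (measurable, rule eventually_mono[OF 0], simp)
  with lim(3) have 3: "(\<lambda>n. \<integral>z. (cmod (dy (\<psi> n) z))\<^sup>2 \<partial>?M) \<longlonglongrightarrow> 0" by simp
  have "(\<lambda>n. \<integral>\<theta>. (cmod (\<psi> n (cis \<theta>)))\<^sup>2 \<partial>lebesgue_on {0..2 * pi}) \<longlonglongrightarrow> 0" using lim(4) by simp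
  from tendsto_add[OF tendsto_add[OF this 2] 3]
  have lim0: "(\<lambda>n. (\<integral>\<theta>. (cmod (\<psi> n (cis \<theta>)))\<^sup>2 \<partial>lebesgue_on {0..2 * pi}) + (\<integral>z. (cmod (dx (\<psi> n) z))\<^sup>2 \<partial>?M) + (\<integral>z. (cmod (dy (\<psi> n) z))\<^sup>2 \<partial>?M)) \<longlonglongrightarrow> 0"
    by simp
  have "(\<lambda>n. \<integral>z. (cmod (\<psi> n z))\<^sup>2 \<partial>?M) \<longlonglongrightarrow> 0"
    by (rule tendsto_sandwich[OF _ _ tendsto_const lim0]) (simp_all add: Poincare_smooth[OF \<psi>])
  then have "(\<lambda>n. \<integral>z. (cmod (w z - \<psi> n z))\<^sup>2 \<partial>?M) \<longlonglongrightarrow> 0" "L2_tendsto (ball 0 1) \<psi> (\<lambda>z. 0)"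
    using lim(1) by (simp_all add: norm_minus_commute)
  from L2_limit_triangle[OF L(1) LP(1) _ this]
  have "(\<integral>z. (cmod (w z))\<^sup>2 \<partial>?M) = 0"
    by (simp add: LIMSEQ_const_iff continuous_on_cball_L2)
  then have "AE z in ?M. (cmod (w z))\<^sup>2 = 0"
    using L2D(2)[OF L(1)] by (subst (asm) integral_nonneg_eq_0_iff_AE) auto
  then show ?thesis by simp
qed

section \<open>The energy as Jacobian plus a conformality defect\<close>

text \<open>For $w=\rho e^{i\varphi}$ with derivatives $p$, $q$, the quotients $\overline wp/|w|$ and
  $\overline wq/|w|$ are $\rho_x+i\rho\varphi_x$ and $\rho_y+i\rho\varphi_y$. The two squares are the
  Cauchy-Riemann equations for $\varepsilon^{-1}\log\rho+i\varphi$, multiplied by $\rho$.\<close>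

definition conformal_defect :: "real \<Rightarrow> complex \<Rightarrow> complex \<Rightarrow> complex \<Rightarrow> real" where
  "conformal_defect \<epsilon> w p q =
     (Re (cnj w * p) / cmod w / \<epsilon> - Im (cnj w * q) / cmod w)\<^sup>2 + (Re (cnj w * q) / cmod w / \<epsilon> + Im (cnj w * p) / cmod w)\<^sup>2"

lemma conformal_defect_nonneg: "0 \<le> conformal_defect \<epsilon> w p q"
  by (simp add: conformal_defect_def)

text \<open>Completing the square; the hypothesis at $w=0$ is what holds almost everywhere on the zero set of a map in $H^1$.\<close>

lemma energy_density_eq:
  assumes "w = 0 \<longrightarrow> p = 0 \<and> q = 0" "\<epsilon> > 0"
  shows "(cmod p)\<^sup>2 + (cmod q)\<^sup>2 + (1 / \<epsilon>\<^sup>2 - 1) * ((Re (cnj w * p) / cmod w)\<^sup>2 + (Re (cnj w * q) / cmod w)\<^sup>2)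
    = 2 / \<epsilon> * Im (cnj p * q) + conformal_defect \<epsilon> w p q"
proof (cases "w = 0")
  case True
  then show ?thesis using assms by (simp add: conformal_defect_def)
next
  case False
  define A B where "A = cnj w * p / cmod w" and "B = cnj w * q / cmod w"
  have w: "cmod w > 0" using False by simp
  have "cmod A = cmod p" "cmod B = cmod q" using False by (simp_all add: A_def B_def norm_mult norm_divide)
  then have 1: "(cmod p)\<^sup>2 = (Re A)\<^sup>2 + (Im A)\<^sup>2" "(cmod q)\<^sup>2 = (Re B)\<^sup>2 + (Im B)\<^sup>2"
    using cmod_power2[of A] cmod_power2[of B] by simp_all
  have "cnj A * B = cnj p * q * (w * cnj w) / (of_real (cmod w))\<^sup>2" by (simp add: A_def B_def power2_eq_square)
  also have "\<dots> = cnj p * q" using False by (simp add: complex_norm_square[symmetric])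
  finally have e: "cnj A * B = cnj p * q" .
  have 2: "Im (cnj p * q) = Re A * Im B - Im A * Re B" unfolding e[symmetric] by simp
  have 3: "Re (cnj w * p) / cmod w = Re A" "Im (cnj w * p) / cmod w = Im A" "Re (cnj w * q) / cmod w = Re B" "Im (cnj w * q) / cmod w = Im B"
    by (simp_all add: A_def B_def)
  show ?thesis
    unfolding conformal_defect_def 1 2 3 using assms(2) by (simp add: field_simps power2_eq_square)
qed

lemma energy_eq:
  assumes X: "sobolev_limit u p q g" and \<epsilon>: "\<epsilon> > 0"
  shows "integrable (lebesgue_on (ball 0 1)) (\<lambda>z. conformal_defect \<epsilon> (u z) (p z) (q z))"
    and "energy \<epsilon> u = 2 / \<epsilon> * (\<integral>z. Im (cnj (p z) * q z) \<partial>lebesgue_on (ball 0 1))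
      + (\<integral>z. conformal_defect \<epsilon> (u z) (p z) (q z) \<partial>lebesgue_on (ball 0 1))"
proof -
  let ?M = "lebesgue_on (ball (0::complex) 1)"
  have L: "u \<in> L2 (ball 0 1)" "p \<in> L2 (ball 0 1)" "q \<in> L2 (ball 0 1)" using X by (auto simp: sobolev_limit_def)
  note [measurable] = L2D(1)[OF L(1)] L2D(1)[OF L(2)] L2D(1)[OF L(3)]
  define P Q where "P z = Re (cnj (u z) * p z) / cmod (u z)" and "Q z = Re (cnj (u z) * q z) / cmod (u z)" for z
  have Pm[measurable]: "P \<in> borel_measurable ?M" "Q \<in> borel_measurable ?M" unfolding P_def[abs_def] Q_def[abs_def] by measurable
  have le: "\<bar>Re (cnj w * v) / cmod w\<bar> \<le> cmod v" for w v
    using abs_Re_cnj_mult_le[of w v] by (cases "w = 0") (auto simp: abs_divide divide_le_eq mult.commute)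
  have LPQ: "P \<in> L2 (ball 0 1)" "Q \<in> L2 (ball 0 1)"
    by (rule L2_bound[OF Pm(1) L(2), of 1] L2_bound[OF Pm(2) L(3), of 1]; use le in \<open>auto simp: P_def Q_def\<close>)+
  have J: "integrable ?M (\<lambda>z. Im (cnj (p z) * q z))" by (rule L2_integrable_Jacobian[OF L(2,3)])
  define E where "E z = (cmod (p z))\<^sup>2 + (cmod (q z))\<^sup>2 + (1 / \<epsilon>\<^sup>2 - 1) * ((P z)\<^sup>2 + (Q z)\<^sup>2)" for z
  have Ei: "integrable ?M E" unfolding E_def[abs_def]
    using L2D(2)[OF L(2)] L2D(2)[OF L(3)] L2D(2)[OF LPQ(1)] L2D(2)[OF LPQ(2)] by auto
  have ae: "AE z in ?M. E z = 2 / \<epsilon> * Im (cnj (p z) * q z) + conformal_defect \<epsilon> (u z) (p z) (q z)"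
    using gradient_zero_on_zero_set[OF X]
    by eventually_elim (simp only: E_def P_def Q_def energy_density_eq[OF _ \<epsilon>])
  have Cm[measurable]: "(\<lambda>z. conformal_defect \<epsilon> (u z) (p z) (q z)) \<in> borel_measurable ?M"
    unfolding conformal_defect_def by measurable
  have "integrable ?M (\<lambda>z. E z - 2 / \<epsilon> * Im (cnj (p z) * q z))"
    by (intro Bochner_Integration.integrable_diff integrable_mult_right Ei J)
  then show Ci: "integrable ?M (\<lambda>z. conformal_defect \<epsilon> (u z) (p z) (q z))"
    using Cm
  proof (rule integrable_cong_AE_imp)
    show "AE z in ?M. E z - 2 / \<epsilon> * Im (cnj (p z) * q z) = conformal_defect \<epsilon> (u z) (p z) (q z)"
      using ae by eventually_elim linarith
  qed
  note W = sobolev_limit_weak_deriv[OF X] note WC = has_weak_deriv_cmod[OF X]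
  note [measurable] = grad_norm_sq_AE(2)[OF W] grad_norm_sq_AE(2)[OF WC]
  have "energy \<epsilon> u = integral\<^sup>L ?M (\<lambda>z. 2 / \<epsilon> * Im (cnj (p z) * q z) + conformal_defect \<epsilon> (u z) (p z) (q z))"
    unfolding energy_def
  proof (rule integral_cong_AE)
    show "AE z in ?M. grad_norm_sq (ball 0 1) u z + (1 / \<epsilon>\<^sup>2 - 1) * grad_norm_sq (ball 0 1) (\<lambda>w. cmod (u w)) z
        = 2 / \<epsilon> * Im (cnj (p z) * q z) + conformal_defect \<epsilon> (u z) (p z) (q z)"
      using ae grad_norm_sq_AE(1)[OF W] grad_norm_sq_AE(1)[OF WC]
      by eventually_elim (simp only: E_def P_def Q_def real_norm_def power2_abs)
  qed measurable
  also have "\<dots> = 2 / \<epsilon> * (\<integral>z. Im (cnj (p z) * q z) \<partial>?M) + (\<integral>z. conformal_defect \<epsilon> (u z) (p z) (q z) \<partial>?M)"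
    by (simp only: Bochner_Integration.integral_add[OF integrable_mult_right[OF J] Ci] Bochner_Integration.integral_mult_right_zero)
  finally show "energy \<epsilon> u = 2 / \<epsilon> * (\<integral>z. Im (cnj (p z) * q z) \<partial>?M)
      + (\<integral>z. conformal_defect \<epsilon> (u z) (p z) (q z) \<partial>?M)" .
qed

section \<open>Smooth approximations of the power maps\<close>

text \<open>A smooth $h$ such that $w\mapsto h(|w|^2)w$ approximates $w\mapsto|w|^{\kappa-1}w$ in the unit disc as
  $k\to\infty$. The shift by $1/k$ removes the singularity at $0$, and the second factor, which tends to $1$ inside
  the disc, makes the map bounded. The constants give $h(1)=1$: points of the unit circle are fixed.\<close>

definition reg_power :: "real \<Rightarrow> nat \<Rightarrow> real \<Rightarrow> real" where
  "reg_power \<kappa> k s = ((s + 1 / real k) / (1 + 1 / real k)) powr ((\<kappa> - 1) / 2) * (2 / (1 + s ^ k)) powr (\<kappa> / (2 * real k))"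

definition reg_power_deriv :: "real \<Rightarrow> nat \<Rightarrow> real \<Rightarrow> real" where
  "reg_power_deriv \<kappa> k s = reg_power \<kappa> k s * ((\<kappa> - 1) / 2 / (s + 1 / real k) - \<kappa> / 2 * s ^ (k - 1) / (1 + s ^ k))"

text \<open>This is $2sh'/h$ for $h=$ \<^term>\<open>reg_power \<kappa> k\<close>, the logarithmic derivative with respect to the
  modulus. Its limit is $\kappa-1$ for $0<s<1$.\<close>

definition reg_power_logderiv :: "real \<Rightarrow> nat \<Rightarrow> real \<Rightarrow> real" where
  "reg_power_logderiv \<kappa> k s = (\<kappa> - 1) * (s / (s + 1 / real k)) - \<kappa> * (s ^ k / (1 + s ^ k))"

lemma reg_power_pos: "k > 0 \<Longrightarrow> s \<ge> 0 \<Longrightarrow> 0 < reg_power \<kappa> k s"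
proof -
  assume k: "k > 0" and s: "s \<ge> 0"
  have "s + 1 / real k > 0" "1 + 1 / real k > 0" "1 + s ^ k > 0"
    using k s by (simp_all add: add_nonneg_pos add_pos_nonneg)
  then show "0 < reg_power \<kappa> k s" unfolding reg_power_def by (intro mult_pos_pos) simp_all
qed

lemma reg_power_1: "k > 0 \<Longrightarrow> reg_power \<kappa> k 1 = 1"
  using add_pos_nonneg[of 1 "1 / real k"] by (simp add: reg_power_def)

lemma reg_power_deriv_eq:
  assumes "k > 0"
  shows "2 * s * reg_power_deriv \<kappa> k s = reg_power \<kappa> k s * reg_power_logderiv \<kappa> k s"
proof -
  have sk: "s * s ^ (k - 1) = s ^ k" using assms by (cases k) auto
  have 1: "2 * s * (A / 2 / X) = A * (s / X)" for A X :: real by simp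
  have 2: "2 * s * (B / 2 * t / Y) = B * (s * t / Y)" for B t Y :: real by simp
  have "2 * s * ((\<kappa> - 1) / 2 / (s + 1 / real k) - \<kappa> / 2 * s ^ (k - 1) / (1 + s ^ k)) = reg_power_logderiv \<kappa> k s"
    unfolding reg_power_logderiv_def right_diff_distrib[of "2 * s"] 1 2 sk ..
  then have "reg_power \<kappa> k s * (2 * s * ((\<kappa> - 1) / 2 / (s + 1 / real k) - \<kappa> / 2 * s ^ (k - 1) / (1 + s ^ k))) = reg_power \<kappa> k s * reg_power_logderiv \<kappa> k s"
    by (simp only:)
  then show ?thesis unfolding reg_power_deriv_def by (simp only: ac_simps)
qed

lemma reg_power_has_derivative:
  assumes k: "k > 0" and s: "s \<ge> 0"
  shows "(reg_power \<kappa> k has_real_derivative reg_power_deriv \<kappa> k s) (at s)"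
proof -
  define d where "d = 1 / real k"
  have d: "d > 0" using k by (simp add: d_def)
  define X Y where "X s = (s + d) / (1 + d)" and "Y s = 2 / (1 + s ^ k)" for s
  define a c where "a = (\<kappa> - 1) / 2" and "c = \<kappa> / (2 * real k)"
  have X: "X s > 0" and Y: "Y s > 0" using d s by (auto simp: X_def Y_def add_pos_nonneg add_nonneg_pos)
  have sk: "1 + s ^ k > 0" using s by (simp add: add_pos_nonneg)
  have "(X has_real_derivative (1 + 0) / (1 + d)) (at s)" unfolding X_def[abs_def]
    by (intro DERIV_cdivide DERIV_add DERIV_ident DERIV_const)
  from DERIV_chain2[OF has_real_derivative_powr[OF X, of a] this]
  have "((\<lambda>s. X s powr a) has_real_derivative a * X s powr (a - 1) * ((1 + 0) / (1 + d))) (at s)" .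
  also have "a * X s powr (a - 1) * ((1 + 0) / (1 + d)) = X s powr a * (a / (s + d))"
  proof -
    have e: "s + d = X s * (1 + d)" using d by (simp add: X_def)
    have "X s powr (a - 1) = X s powr a / X s" using X by (simp add: powr_diff)
    then show ?thesis unfolding e by simp
  qed
  finally have DX: "((\<lambda>s. X s powr a) has_real_derivative X s powr a * (a / (s + d))) (at s)" .
  have "(Y has_real_derivative - 2 * (real k * s ^ (k - 1)) / (1 + s ^ k)\<^sup>2) (at s)" unfolding Y_def[abs_def]
    using sk by (auto intro!: derivative_eq_intros simp: power2_eq_square)
  from DERIV_chain2[OF has_real_derivative_powr[OF Y, of c] this]
  have "((\<lambda>s. Y s powr c) has_real_derivative c * Y s powr (c - 1) * (- 2 * (real k * s ^ (k - 1)) / (1 + s ^ k)\<^sup>2)) (at s)" .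
  also have "c * Y s powr (c - 1) * (- 2 * (real k * s ^ (k - 1)) / (1 + s ^ k)\<^sup>2) = Y s powr c * (- (\<kappa> / 2 * s ^ (k - 1) / (1 + s ^ k)))"
  proof -
    have "c * Y s powr (c - 1) * (- 2 * (real k * s ^ (k - 1)) / (1 + s ^ k)\<^sup>2)
       = Y s powr c * (- (c * real k * s ^ (k - 1) / (1 + s ^ k)))"
    proof -
      have e: "(2::real) = Y s * (1 + s ^ k)" 
      proof -
        have "2 = 2 / t * t" if "t > 0" for t :: real using that by simp
        from this[OF sk] show ?thesis unfolding Y_def .
      qed
      have Yc: "Y s powr (c - 1) = Y s powr c / Y s" using Y by (simp add: powr_diff)
      have "c * (E / y) * (- (y * t) * K / t\<^sup>2) = E * (- (c * K / t))" if "y > 0" "t > 0" for E K y t :: real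
        using that by (simp add: power2_eq_square)
      from this[OF Y sk, of "Y s powr c" "real k * s ^ (k - 1)"] show ?thesis
        unfolding Yc e[symmetric] by (simp only: mult.assoc)
    qed
    also have "c * real k = \<kappa> / 2" using k by (simp add: c_def)
    finally show ?thesis .
  qed
  finally have DY: "((\<lambda>s. Y s powr c) has_real_derivative Y s powr c * (- (\<kappa> / 2 * s ^ (k - 1) / (1 + s ^ k)))) (at s)" .
  have eq: "reg_power \<kappa> k = (\<lambda>s. X s powr a * Y s powr c)"
    by (simp add: fun_eq_iff reg_power_def X_def Y_def a_def c_def d_def)
  have eq': "reg_power_deriv \<kappa> k s = X s powr a * (Y s powr c * (- (\<kappa> / 2 * s ^ (k - 1) / (1 + s ^ k)))) + X s powr a * (a / (s + d)) * Y s powr c"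
    unfolding reg_power_deriv_def eq by (simp add: a_def d_def[symmetric] algebra_simps)
  show ?thesis unfolding eq' unfolding eq by (rule DERIV_mult'[OF DX DY])
qed

lemma reg_power_logderiv_bound:
  assumes k: "k > 0" and s: "s \<ge> 0" and \<kappa>: "\<kappa> > 0"
  shows "\<bar>reg_power_logderiv \<kappa> k s\<bar> \<le> \<bar>\<kappa> - 1\<bar> + \<kappa>"
proof -
  have 1: "0 \<le> s / (s + 1 / real k)" "s / (s + 1 / real k) \<le> 1" using k s by (auto simp: divide_le_eq add_nonneg_pos)
  have 2: "0 \<le> s ^ k / (1 + s ^ k)" "s ^ k / (1 + s ^ k) \<le> 1" using s by (auto simp: divide_le_eq add_pos_nonneg)
  have "\<bar>reg_power_logderiv \<kappa> k s\<bar> \<le> \<bar>\<kappa> - 1\<bar> * (s / (s + 1 / real k)) + \<kappa> * (s ^ k / (1 + s ^ k))"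
  proof -
    have "\<bar>A * x - B * y\<bar> \<le> \<bar>A\<bar> * x + B * y" if "0 \<le> x" "0 \<le> y" "0 < B" for A B x y :: real
      using that by (intro order_trans[OF abs_triangle_ineq4]) (simp add: abs_mult)
    from this[OF 1(1) 2(1) \<kappa>] show ?thesis unfolding reg_power_logderiv_def .
  qed
  also have "\<dots> \<le> \<bar>\<kappa> - 1\<bar> * 1 + \<kappa> * 1" using 1 2 \<kappa> by (intro add_mono mult_left_mono) auto
  finally show ?thesis by simp
qed

text \<open>The factor $1+2sh'/h$ is the ratio of radial and angular stretching. For $\kappa\le1$ its positivity makes all
  regularised Jacobians nonnegative multiples of the original one.\<close>

lemma reg_power_logderiv_ge:
  assumes k: "k > 0" and s: "s \<ge> 0" and \<kappa>: "0 < \<kappa>" "\<kappa> \<le> 1"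
  shows "\<kappa> / (1 + s ^ k) \<le> 1 + reg_power_logderiv \<kappa> k s"
proof -
  have "s / (s + 1 / real k) \<le> 1" using k s by (auto simp: divide_le_eq add_nonneg_pos)
  then have "(\<kappa> - 1) * 1 \<le> (\<kappa> - 1) * (s / (s + 1 / real k))" using \<kappa> by (intro mult_left_mono_neg) auto
  moreover have "\<kappa> * (t / (1 + t)) = \<kappa> - \<kappa> / (1 + t)" if "t \<ge> 0" for t
    using that by (simp add: field_simps)
  from this[of "s ^ k"] have "\<kappa> * (s ^ k / (1 + s ^ k)) = \<kappa> - \<kappa> / (1 + s ^ k)" using s by simp
  moreover have "R \<le> 1 + (P - Q)" if "(\<kappa> - 1) * 1 \<le> P" "Q = \<kappa> - R" for P Q R
    using that by simp
  ultimately show ?thesis unfolding reg_power_logderiv_def by blast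
qed

text \<open>Bounds uniform in $k$, as needed for dominated convergence: inside the unit disc by the larger of $1$ and the
  power, outside by $s^{-1/2}$.\<close>

lemma reg_power_upper:
  assumes k: "k > 0" and \<kappa>: "\<kappa> > 0" and s: "0 < s"
  shows "s \<le> 1 \<Longrightarrow> reg_power \<kappa> k s \<le> 2 powr (\<kappa> / 2 + \<bar>\<kappa> - 1\<bar> / 2) * max 1 (s powr ((\<kappa> - 1) / 2))"
    and "1 \<le> s \<Longrightarrow> reg_power \<kappa> k s * sqrt s \<le> 2 powr (\<kappa> / 2 + \<bar>\<kappa> - 1\<bar> / 2)"
proof -
  define d where "d = 1 / real k"
  have d: "d > 0" "d \<le> 1" using k by (auto simp: d_def divide_le_eq)
  define X where "X = (s + d) / (1 + d)"
  define a c where "a = (\<kappa> - 1) / 2" and "c = \<kappa> / (2 * real k)"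
  have c: "0 < c" "c \<le> \<kappa> / 2" using k \<kappa> by (auto simp: c_def field_simps)
  have h: "reg_power \<kappa> k s = X powr a * (2 / (1 + s ^ k)) powr c"
    by (simp add: reg_power_def X_def a_def c_def d_def)
  have X0: "X > 0" using d s by (simp add: X_def)
  have 2: "2 powr c \<le> 2 powr (\<kappa> / 2)" using c by simp
  have p2: "2 powr (\<kappa> / 2) * 2 powr \<bar>a\<bar> = 2 powr (\<kappa> / 2 + \<bar>\<kappa> - 1\<bar> / 2)" by (simp add: powr_add a_def abs_divide)
  have p1: "2 powr (\<kappa> / 2) \<le> 2 powr (\<kappa> / 2 + \<bar>\<kappa> - 1\<bar> / 2)" by simp
  { assume s1: "s \<le> 1"
    have X1: "X \<le> 1" using d s1 by (simp add: X_def)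
    have "s * d \<le> d" using s1 d(1) by simp
    then have sX: "s \<le> X" using d by (simp add: X_def field_simps)
    have Xa: "X powr a \<le> max 1 (s powr a)"
    proof (cases "a \<ge> 0")
      case True
      then have "X powr a \<le> 1 powr a" using X1 X0 by (intro powr_mono2) auto
      then show ?thesis by simp
    next
      case False
      then have "X powr a \<le> s powr a" using sX s by (intro powr_mono2') auto
      then show ?thesis by simp
    qed
    have "(2 / (1 + s ^ k)) powr c \<le> 2 powr c" using s c by (intro powr_mono2) (auto simp: divide_le_eq add_pos_nonneg)
    with 2 p1 have "(2 / (1 + s ^ k)) powr c \<le> 2 powr (\<kappa> / 2 + \<bar>\<kappa> - 1\<bar> / 2)" by linarith
    then have "X powr a * (2 / (1 + s ^ k)) powr c \<le> max 1 (s powr a) * 2 powr (\<kappa> / 2 + \<bar>\<kappa> - 1\<bar> / 2)"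
      using Xa by (intro mult_mono) auto
    then show "reg_power \<kappa> k s \<le> 2 powr (\<kappa> / 2 + \<bar>\<kappa> - 1\<bar> / 2) * max 1 (s powr ((\<kappa> - 1) / 2))"
      by (simp add: h a_def mult.commute) }
  { assume s1: "1 \<le> s"
    have "1 * d \<le> s * d" using s1 d(1) by (intro mult_right_mono) auto
    then have Xs: "X \<le> s" using d by (simp add: X_def field_simps)
    have "s * d \<le> s * 1" using s d by (intro mult_left_mono) auto
    then have sX: "s / 2 \<le> X" using d by (simp add: X_def field_simps)
    have Xa: "X powr a \<le> 2 powr \<bar>a\<bar> * s powr a"
    proof (cases "a \<ge> 0")
      case True
      then have "X powr a \<le> s powr a" using Xs X0 by (intro powr_mono2) auto
      also have "\<dots> \<le> 2 powr \<bar>a\<bar> * s powr a" using ge_one_powr_ge_zero[of 2 "\<bar>a\<bar>"] by (simp add: mult_le_cancel_right1)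
      finally show ?thesis .
    next
      case False
      then have "X powr a \<le> (s / 2) powr a" using sX s by (intro powr_mono2') auto
      also have "(s / 2) powr a = s powr a / 2 powr a" using s by (simp add: powr_divide)
      also have "\<dots> = 2 powr (- a) * s powr a" by (simp add: powr_minus_divide)
      also have "- a = \<bar>a\<bar>" using False by simp
      finally show ?thesis .
    qed
    have sk: "s ^ k > 0" using s by simp
    have "2 / (1 + t) \<le> 2 / t" if "t > 0" for t :: real using that by (simp add: field_simps)
    from this[OF sk] have "(2 / (1 + s ^ k)) powr c \<le> (2 / s ^ k) powr c"
      using sk c by (intro powr_mono2) simp_all
    also have "\<dots> = 2 powr c / (s ^ k) powr c" using s by (simp add: powr_divide)
    also have "(s ^ k) powr c = s powr (real k * c)"
      unfolding powr_realpow[OF s, of k, symmetric] by (rule powr_powr)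
    also have "real k * c = \<kappa> / 2" using k by (simp add: c_def)
    finally have "(2 / (1 + s ^ k)) powr c \<le> 2 powr (\<kappa> / 2) / s powr (\<kappa> / 2)"
      using order_trans[OF _ divide_right_mono[OF 2, of "s powr (\<kappa> / 2)"]] by simp
    then have "X powr a * (2 / (1 + s ^ k)) powr c \<le> (2 powr \<bar>a\<bar> * s powr a) * (2 powr (\<kappa> / 2) / s powr (\<kappa> / 2))"
      using Xa by (intro mult_mono) auto
    then have "reg_power \<kappa> k s * sqrt s \<le> (2 powr \<bar>a\<bar> * s powr a) * (2 powr (\<kappa> / 2) / s powr (\<kappa> / 2)) * s powr (1/2)"
      unfolding h powr_half_sqrt[OF less_imp_le[OF s]] using s by (intro mult_right_mono) simp_all
    also have "\<dots> = 2 powr (\<kappa> / 2) * 2 powr \<bar>a\<bar> * (s powr a * s powr (1/2) / s powr (\<kappa> / 2))" by (simp add: field_simps)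
    also have "s powr a * s powr (1/2) = s powr (\<kappa> / 2)" by (simp add: powr_add[symmetric] a_def field_simps)
    finally show "reg_power \<kappa> k s * sqrt s \<le> 2 powr (\<kappa> / 2 + \<bar>\<kappa> - 1\<bar> / 2)" using s unfolding p2 by simp }
qed

lemma continuous_on_reg_power: 
  assumes "k > 0" shows "continuous_on {0..} (reg_power \<kappa> k)"
proof (rule DERIV_continuous_on)
  fix s :: real assume "s \<in> {0..}"
  then show "(reg_power \<kappa> k has_real_derivative reg_power_deriv \<kappa> k s) (at s within {0..})"
    by (intro has_field_derivative_at_within[OF reg_power_has_derivative[OF assms]]) simp
qed

lemma reg_power_bounded:
  assumes k: "k > 0" and \<kappa>: "\<kappa> > 0"
  obtains M where "\<And>s. s \<ge> 0 \<Longrightarrow> reg_power \<kappa> k s \<le> M"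
proof -
  let ?K = "2 powr (\<kappa> / 2 + \<bar>\<kappa> - 1\<bar> / 2)"
  have "continuous_on {0..1} (reg_power \<kappa> k)"
    by (rule continuous_on_subset[OF continuous_on_reg_power[OF k]]) simp
  then have "compact (reg_power \<kappa> k ` {0..1})" by (rule compact_continuous_image) simp
  then have "bounded (reg_power \<kappa> k ` {0..1})" by (rule compact_imp_bounded)
  then obtain B where B: "\<And>s. s \<in> {0..1} \<Longrightarrow> norm (reg_power \<kappa> k s) \<le> B"
    unfolding bounded_iff by blast
  have "reg_power \<kappa> k s \<le> max B ?K" if s: "s \<ge> 0" for s
  proof (cases "s \<le> 1")
    case True
    then show ?thesis using B[of s] s by auto
  next
    case False
    have "reg_power \<kappa> k s * 1 \<le> reg_power \<kappa> k s * sqrt s"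
      using False reg_power_pos[OF k s, of \<kappa>] by (intro mult_left_mono) auto
    then show ?thesis using reg_power_upper(2)[OF k \<kappa>, of s] False by linarith
  qed
  then show thesis by (rule that)
qed

definition reg_map :: "real \<Rightarrow> nat \<Rightarrow> complex \<Rightarrow> complex" where
  "reg_map \<kappa> k w = reg_power \<kappa> k ((cmod w)\<^sup>2) *\<^sub>R w"

definition reg_map_deriv :: "real \<Rightarrow> nat \<Rightarrow> complex \<Rightarrow> complex \<Rightarrow> complex" where
  "reg_map_deriv \<kappa> k w v = reg_power \<kappa> k ((cmod w)\<^sup>2) *\<^sub>R v + (2 * reg_power_deriv \<kappa> k ((cmod w)\<^sup>2) * Re (cnj w * v)) *\<^sub>R w"

lemma reg_map_smooth_lipschitz:
  assumes k: "k > 0" and \<kappa>: "\<kappa> > 0"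
  obtains M where "smooth_lipschitz (reg_map \<kappa> k) (reg_map_deriv \<kappa> k) M"
proof -
  obtain M where M: "\<And>s. s \<ge> 0 \<Longrightarrow> reg_power \<kappa> k s \<le> M" using reg_power_bounded[OF k \<kappa>] by blast
  have "smooth_lipschitz (\<lambda>w. reg_power \<kappa> k ((cmod w)\<^sup>2) *\<^sub>R w)
    (\<lambda>w v. reg_power \<kappa> k ((cmod w)\<^sup>2) *\<^sub>R v + (2 * reg_power_deriv \<kappa> k ((cmod w)\<^sup>2) * Re (cnj w * v)) *\<^sub>R w) (M * (1 + (\<bar>\<kappa> - 1\<bar> + \<kappa>)))"
  proof (rule smooth_lipschitz_radial)
    fix s :: real assume s: "s \<ge> 0"
    show "(reg_power \<kappa> k has_real_derivative reg_power_deriv \<kappa> k s) (at s)"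
      by (rule reg_power_has_derivative[OF k s])
    have h: "reg_power \<kappa> k s > 0" by (rule reg_power_pos[OF k s])
    have "2 * s * \<bar>reg_power_deriv \<kappa> k s\<bar> = \<bar>2 * s * reg_power_deriv \<kappa> k s\<bar>" using s by (simp add: abs_mult)
    also have "\<dots> = reg_power \<kappa> k s * \<bar>reg_power_logderiv \<kappa> k s\<bar>" using h by (simp add: reg_power_deriv_eq[OF k] abs_mult)
    finally have "\<bar>reg_power \<kappa> k s\<bar> + 2 * s * \<bar>reg_power_deriv \<kappa> k s\<bar> = reg_power \<kappa> k s * (1 + \<bar>reg_power_logderiv \<kappa> k s\<bar>)"
      using h by (simp add: distrib_left)
    also have "\<dots> \<le> M * (1 + (\<bar>\<kappa> - 1\<bar> + \<kappa>))"
      using M[OF s] h reg_power_logderiv_bound[OF k s \<kappa>] by (intro mult_mono) auto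
    finally show "\<bar>reg_power \<kappa> k s\<bar> + 2 * s * \<bar>reg_power_deriv \<kappa> k s\<bar> \<le> M * (1 + (\<bar>\<kappa> - 1\<bar> + \<kappa>))" .
  next
    have c: "continuous_on {0..} (reg_power \<kappa> k)"
      by (rule continuous_on_reg_power[OF k])
    have "s + 1 / real k \<noteq> 0 \<and> 1 + s ^ k \<noteq> 0" if "s \<in> {0..}" for s
    proof -
      have "s + 1 / real k > 0" "1 + s ^ k > 0" using that k by (auto simp: add_nonneg_pos add_pos_nonneg)
      then show ?thesis by simp
    qed
    then show "continuous_on {0..} (reg_power_deriv \<kappa> k)"
      unfolding reg_power_deriv_def[abs_def] by (intro continuous_intros c) auto
  next
    fix S :: "complex set" and m f assume S: "open S" and f: "Ck_on m S f" and pos: "\<And>x. (0::real) \<le> f x"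
    have 1: "(f x + 1 / real k) * inverse (1 + 1 / real k) > 0" "1 + f x ^ k > 0" for x
      using pos[of x] k by (auto simp: add_nonneg_pos add_pos_nonneg intro!: mult_pos_pos)
    show "Ck_on m S (\<lambda>x. reg_power \<kappa> k (f x))"
      unfolding reg_power_def divide_inverse[of "_ + _"] divide_inverse[of 2 "1 + _"]
      by (intro Ck_on_mult Ck_on_powr Ck_on_add Ck_on_const Ck_on_inverse Ck_on_power S f)
         (use 1 in \<open>auto simp: less_imp_neq[symmetric]\<close>)
  qed
  then have "smooth_lipschitz (reg_map \<kappa> k) (reg_map_deriv \<kappa> k) (M * (1 + (\<bar>\<kappa> - 1\<bar> + \<kappa>)))"
    unfolding reg_map_def[abs_def] reg_map_deriv_def[abs_def] .
  then show thesis by (rule that)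
qed

text \<open>In polar terms, a radial map multiplies the radial part of the gradient by $h+2sh'$ and the
  angular part by $h$; here $b$ is $h'(|w|^2)$.\<close>

lemma Jacobian_radial:
  fixes w p q :: complex and h b :: real
  defines "P \<equiv> h *\<^sub>R p + (2 * b * Re (cnj w * p)) *\<^sub>R w" and "Q \<equiv> h *\<^sub>R q + (2 * b * Re (cnj w * q)) *\<^sub>R w"
  shows "Im (cnj P * Q) = h * (h + 2 * (cmod w)\<^sup>2 * b) * Im (cnj p * q)"
  unfolding P_def Q_def cmod_power2 by (simp add: power2_eq_square algebra_simps)

text \<open>The Jacobian is multiplied by the product of the radial and the angular stretching.\<close>

lemma Jacobian_reg_map:
  assumes "k > 0"
  shows "Im (cnj (reg_map_deriv \<kappa> k w p) * reg_map_deriv \<kappa> k w q)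
    = (reg_power \<kappa> k ((cmod w)\<^sup>2))\<^sup>2 * (1 + reg_power_logderiv \<kappa> k ((cmod w)\<^sup>2)) * Im (cnj p * q)"
proof -
  have "reg_power \<kappa> k ((cmod w)\<^sup>2) + 2 * (cmod w)\<^sup>2 * reg_power_deriv \<kappa> k ((cmod w)\<^sup>2)
      = reg_power \<kappa> k ((cmod w)\<^sup>2) * (1 + reg_power_logderiv \<kappa> k ((cmod w)\<^sup>2))"
    unfolding reg_power_deriv_eq[OF assms] by (simp add: distrib_left)
  then show ?thesis
    unfolding reg_map_deriv_def Jacobian_radial by (simp only: power2_eq_square mult.assoc)
qed

lemma reg_map_deriv_bound:
  assumes k: "k > 0" and \<kappa>: "\<kappa> > 0" and w: "0 < cmod w" "cmod w \<le> 1"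
  shows "cmod (reg_map_deriv \<kappa> k w v) \<le> 2 powr (\<kappa> / 2 + \<bar>\<kappa> - 1\<bar> / 2) * (1 + (\<bar>\<kappa> - 1\<bar> + \<kappa>)) * (max 1 ((cmod w)\<^sup>2 powr ((\<kappa> - 1) / 2)) * cmod v)"
proof -
  define s where "s = (cmod w)\<^sup>2"
  have s: "0 < s" "s \<le> 1" using w by (auto simp: s_def power_le_one)
  have h: "reg_power \<kappa> k s > 0" using s by (intro reg_power_pos k) simp
  have "2 * s * \<bar>reg_power_deriv \<kappa> k s\<bar> = \<bar>2 * s * reg_power_deriv \<kappa> k s\<bar>" using s by (simp add: abs_mult)
  also have "\<dots> = reg_power \<kappa> k s * \<bar>reg_power_logderiv \<kappa> k s\<bar>" using h by (simp add: reg_power_deriv_eq[OF k] abs_mult)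
  finally have e: "\<bar>reg_power \<kappa> k s\<bar> + 2 * s * \<bar>reg_power_deriv \<kappa> k s\<bar> = reg_power \<kappa> k s * (1 + \<bar>reg_power_logderiv \<kappa> k s\<bar>)"
    using h by (simp add: distrib_left)
  have "cmod (reg_map_deriv \<kappa> k w v) \<le> (\<bar>reg_power \<kappa> k s\<bar> + 2 * s * \<bar>reg_power_deriv \<kappa> k s\<bar>) * cmod v"
    unfolding reg_map_deriv_def s_def by (rule norm_radial_derivative_le)
  also have "\<dots> = reg_power \<kappa> k s * (1 + \<bar>reg_power_logderiv \<kappa> k s\<bar>) * cmod v" unfolding e ..
  also have "\<dots> \<le> 2 powr (\<kappa> / 2 + \<bar>\<kappa> - 1\<bar> / 2) * max 1 (s powr ((\<kappa> - 1) / 2)) * (1 + (\<bar>\<kappa> - 1\<bar> + \<kappa>)) * cmod v"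
    using reg_power_upper(1)[OF k \<kappa> s] reg_power_logderiv_bound[OF k less_imp_le[OF s(1)] \<kappa>] h \<kappa>
    by (intro mult_right_mono mult_mono) auto
  finally show ?thesis by (simp add: s_def mult_ac)
qed

lemma reg_map_bound:
  assumes k: "k > 0" and \<kappa>: "\<kappa> > 0"
  shows "cmod (reg_map \<kappa> k w) \<le> 2 powr (\<kappa> / 2 + \<bar>\<kappa> - 1\<bar> / 2)"
proof (cases "w = 0")
  case False
  define s where "s = (cmod w)\<^sup>2"
  have s: "s > 0" using False by (simp add: s_def)
  have e: "cmod (reg_map \<kappa> k w) = reg_power \<kappa> k s * sqrt s"
    using reg_power_pos[OF k, of s \<kappa>] s by (simp add: reg_map_def s_def)
  show ?thesis
  proof (cases "s \<le> 1")
    case True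
    have "max 1 (s powr ((\<kappa> - 1) / 2)) * sqrt s \<le> 1"
    proof -
      have "s powr ((\<kappa> - 1) / 2) * sqrt s = s powr (\<kappa> / 2)"
        using s by (simp add: powr_half_sqrt[symmetric] powr_add[symmetric] field_simps)
      also have "\<dots> \<le> 1" using s True \<kappa> by (intro powr_le1) auto
      finally show ?thesis using True by (auto simp: max_def)
    qed
    then have "2 powr (\<kappa> / 2 + \<bar>\<kappa> - 1\<bar> / 2) * (max 1 (s powr ((\<kappa> - 1) / 2)) * sqrt s) \<le> 2 powr (\<kappa> / 2 + \<bar>\<kappa> - 1\<bar> / 2) * 1"
      by (intro mult_left_mono) auto
    moreover have "reg_power \<kappa> k s * sqrt s \<le> 2 powr (\<kappa> / 2 + \<bar>\<kappa> - 1\<bar> / 2) * max 1 (s powr ((\<kappa> - 1) / 2)) * sqrt s"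
      using reg_power_upper(1)[OF k \<kappa> s True] s by (intro mult_right_mono) simp_all
    ultimately show ?thesis unfolding e mult.assoc mult_1_right by (rule order_trans[rotated])
  next
    case False
    then show ?thesis using reg_power_upper(2)[OF k \<kappa> s] by (simp add: e)
  qed
qed (simp add: reg_map_def)

section \<open>The power map on quasiregular maps\<close>

text \<open>The limit of \<^term>\<open>reg_map \<kappa> k\<close>. Outside the unit disc the cut-off makes it the projection to the circle.\<close>

definition power_map :: "real \<Rightarrow> complex \<Rightarrow> complex" where
  "power_map \<kappa> w = (if cmod w \<le> 1 then (cmod w powr (\<kappa> - 1)) *\<^sub>R w else w /\<^sub>R cmod w)"

text \<open>Here $w$ is the value of a map and $v$ a derivative of it, which will vanish unless $0<|w|<1$.\<close>

definition power_map_deriv :: "real \<Rightarrow> complex \<Rightarrow> complex \<Rightarrow> complex" where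
  "power_map_deriv \<kappa> w v = (if 0 < cmod w \<and> cmod w < 1
     then (cmod w powr (\<kappa> - 1)) *\<^sub>R v + (cmod w powr (\<kappa> - 1) * (\<kappa> - 1) / (cmod w)\<^sup>2 * Re (cnj w * v)) *\<^sub>R w
     else 0)"

lemma square_powr_half: "x \<ge> 0 \<Longrightarrow> (x\<^sup>2) powr (a / 2) = x powr a" for x :: real
proof (cases "x = 0")
  case False
  assume "x \<ge> 0"
  then have "x\<^sup>2 = x powr 2" using False by (simp add: powr_numeral)
  then show ?thesis by (simp add: powr_powr)
qed simp

lemma reg_power_tendsto:
  assumes \<kappa>: "\<kappa> > 0" and s: "0 < s" "s < 1"
  shows "(\<lambda>n. reg_power \<kappa> (Suc n) s) \<longlonglongrightarrow> s powr ((\<kappa> - 1) / 2)"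
    and "(\<lambda>n. reg_power_logderiv \<kappa> (Suc n) s) \<longlonglongrightarrow> \<kappa> - 1"
proof -
  have d: "(\<lambda>n. 1 / real (Suc n)) \<longlonglongrightarrow> 0" using LIMSEQ_inverse_real_of_nat by (simp add: inverse_eq_divide)
  have p: "(\<lambda>n. s ^ Suc n) \<longlonglongrightarrow> 0" using s by (intro LIMSEQ_Suc LIMSEQ_power_zero) simp
  have e: "(\<lambda>n. \<kappa> / (2 * real (Suc n))) \<longlonglongrightarrow> 0"
    using tendsto_mult[OF tendsto_const[of "\<kappa> / 2"] d] by simp
  have "(\<lambda>n. ((s + 1 / real (Suc n)) / (1 + 1 / real (Suc n))) powr ((\<kappa> - 1) / 2) * (2 / (1 + s ^ Suc n)) powr (\<kappa> / (2 * real (Suc n))))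
     \<longlonglongrightarrow> ((s + 0) / (1 + 0)) powr ((\<kappa> - 1) / 2) * (2 / (1 + 0)) powr 0"
    using s by (intro tendsto_mult tendsto_powr tendsto_divide tendsto_add tendsto_const d p e) auto
  then show "(\<lambda>n. reg_power \<kappa> (Suc n) s) \<longlonglongrightarrow> s powr ((\<kappa> - 1) / 2)" by (simp add: reg_power_def)
  have "(\<lambda>n. (\<kappa> - 1) * (s / (s + 1 / real (Suc n))) - \<kappa> * (s ^ Suc n / (1 + s ^ Suc n))) \<longlonglongrightarrow> (\<kappa> - 1) * (s / (s + 0)) - \<kappa> * (0 / (1 + 0))"
    using s by (intro tendsto_diff tendsto_mult tendsto_divide tendsto_add tendsto_const d p) auto
  then show "(\<lambda>n. reg_power_logderiv \<kappa> (Suc n) s) \<longlonglongrightarrow> \<kappa> - 1" using s unfolding reg_power_logderiv_def by simp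
qed

lemma reg_power_tendsto_outside:
  assumes \<kappa>: "\<kappa> > 0" and s: "1 < s"
  shows "(\<lambda>n. reg_power \<kappa> (Suc n) s) \<longlonglongrightarrow> s powr (- (1 / 2))"
proof -
  have d: "(\<lambda>n. 1 / real (Suc n)) \<longlonglongrightarrow> 0" using LIMSEQ_inverse_real_of_nat by (simp add: inverse_eq_divide)
  have e: "(\<lambda>n. \<kappa> / (2 * real (Suc n))) \<longlonglongrightarrow> 0"
    using tendsto_mult[OF tendsto_const[of "\<kappa> / 2"] d] by simp
  have X: "(\<lambda>n. ((s + 1 / real (Suc n)) / (1 + 1 / real (Suc n))) powr ((\<kappa> - 1) / 2)) \<longlonglongrightarrow> ((s + 0) / (1 + 0)) powr ((\<kappa> - 1) / 2)"
    using s by (intro tendsto_powr tendsto_divide tendsto_add tendsto_const d) auto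
  have Y: "(\<lambda>n. (2 / (1 + s ^ Suc n)) powr (\<kappa> / (2 * real (Suc n)))) \<longlonglongrightarrow> s powr (- (\<kappa> / 2))"
  proof (rule tendsto_sandwich)
    have eq: "(s ^ Suc n) powr (- (\<kappa> / (2 * real (Suc n)))) = s powr (- (\<kappa> / 2))" for n
    proof -
      have "s ^ Suc n = s powr real (Suc n)" using s by (intro powr_realpow[symmetric]) simp
      then have "(s ^ Suc n) powr (- (\<kappa> / (2 * real (Suc n)))) = s powr (real (Suc n) * (- (\<kappa> / (2 * real (Suc n)))))" by (simp only: powr_powr)
      also have "real (Suc n) * (- (\<kappa> / (2 * real (Suc n)))) = - (\<kappa> / 2)" by (simp add: field_simps del: of_nat_Suc)
      finally show ?thesis .
    qed
    have inv: "(1 / t) powr c = t powr (- c)" if "t > 0" for t c :: real using that by (simp add: powr_divide powr_minus_divide)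
    have c: "0 \<le> \<kappa> / (2 * real (Suc n))" for n using \<kappa> by simp
    have lower: "s powr (- (\<kappa> / 2)) \<le> (2 / (1 + s ^ Suc n)) powr (\<kappa> / (2 * real (Suc n)))" for n
    proof -
      have S: "s ^ Suc n \<ge> 1" using s by (intro one_le_power) simp
      have "1 / t \<le> 2 / (1 + t)" if "t \<ge> 1" for t :: real using that by (simp add: field_simps)
      from this[OF S] have "(1 / s ^ Suc n) powr (\<kappa> / (2 * real (Suc n))) \<le> (2 / (1 + s ^ Suc n)) powr (\<kappa> / (2 * real (Suc n)))"
        using S c[of n] by (intro powr_mono2) simp_all
      then show ?thesis using inv[of "s ^ Suc n"] S unfolding eq[of n, symmetric] by simp
    qed
    have upper: "(2 / (1 + s ^ Suc n)) powr (\<kappa> / (2 * real (Suc n))) \<le> 2 powr (\<kappa> / (2 * real (Suc n))) * s powr (- (\<kappa> / 2))" for n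
    proof -
      have S: "s ^ Suc n \<ge> 1" using s by (intro one_le_power) simp
      have "2 / (1 + t) \<le> 2 * (1 / t)" if "t \<ge> 1" for t :: real using that by (simp add: field_simps)
      from this[OF S] have "(2 / (1 + s ^ Suc n)) powr (\<kappa> / (2 * real (Suc n))) \<le> (2 * (1 / s ^ Suc n)) powr (\<kappa> / (2 * real (Suc n)))"
        using S c[of n] by (intro powr_mono2) simp_all
      also have "\<dots> = 2 powr (\<kappa> / (2 * real (Suc n))) * (1 / s ^ Suc n) powr (\<kappa> / (2 * real (Suc n)))" by (rule powr_mult)
      also have "(1 / s ^ Suc n) powr (\<kappa> / (2 * real (Suc n))) = s powr (- (\<kappa> / 2))" using inv[of "s ^ Suc n"] S unfolding eq[of n, symmetric] by simp
      finally show ?thesis .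
    qed
    show "\<forall>\<^sub>F n in sequentially. s powr (- (\<kappa> / 2)) \<le> (2 / (1 + s ^ Suc n)) powr (\<kappa> / (2 * real (Suc n)))"
      by (rule always_eventually) (intro allI lower)
    show "\<forall>\<^sub>F n in sequentially. (2 / (1 + s ^ Suc n)) powr (\<kappa> / (2 * real (Suc n))) \<le> 2 powr (\<kappa> / (2 * real (Suc n))) * s powr (- (\<kappa> / 2))"
      by (rule always_eventually) (intro allI upper)
    show "(\<lambda>n. s powr (- (\<kappa> / 2))) \<longlonglongrightarrow> s powr (- (\<kappa> / 2))" by (rule tendsto_const)
    have "(\<lambda>n. 2 powr (\<kappa> / (2 * real (Suc n))) * s powr (- (\<kappa> / 2))) \<longlonglongrightarrow> 2 powr 0 * s powr (- (\<kappa> / 2))"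
      by (intro tendsto_mult tendsto_powr tendsto_const e) auto
    then show "(\<lambda>n. 2 powr (\<kappa> / (2 * real (Suc n))) * s powr (- (\<kappa> / 2))) \<longlonglongrightarrow> s powr (- (\<kappa> / 2))" by simp
  qed
  have "(\<lambda>n. reg_power \<kappa> (Suc n) s) \<longlonglongrightarrow> ((s + 0) / (1 + 0)) powr ((\<kappa> - 1) / 2) * s powr (- (\<kappa> / 2))"
    unfolding reg_power_def by (rule tendsto_mult[OF X Y])
  also have "((s + 0) / (1 + 0)) powr ((\<kappa> - 1) / 2) * s powr (- (\<kappa> / 2)) = s powr (- (1 / 2))"
    by (simp add: powr_add[symmetric] field_simps)
  finally show ?thesis .
qed

lemma reg_map_tendsto:
  assumes \<kappa>: "\<kappa> > 0"
  shows "(\<lambda>n. reg_map \<kappa> (Suc n) w) \<longlonglongrightarrow> power_map \<kappa> w"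
proof (cases "w = 0")
  case True
  then show ?thesis by (simp add: reg_map_def power_map_def)
next
  case False
  then have w: "cmod w > 0" by simp
  consider "cmod w < 1" | "cmod w = 1" | "cmod w > 1" by linarith
  then show ?thesis
  proof cases
    case 1
    then have "(cmod w)\<^sup>2 < 1" by (simp add: abs_square_less_1)
    from tendsto_scaleR[OF reg_power_tendsto(1)[OF \<kappa> _ this] tendsto_const[of w]]
    show ?thesis using w 1 by (simp add: reg_map_def power_map_def square_powr_half)
  next
    case 2
    then show ?thesis by (simp add: reg_map_def power_map_def reg_power_1)
  next
    case 3
    then have "1 < (cmod w)\<^sup>2" by (simp add: one_less_power)
    from tendsto_scaleR[OF reg_power_tendsto_outside[OF \<kappa> this] tendsto_const[of w]]
    have "(\<lambda>n. reg_map \<kappa> (Suc n) w) \<longlonglongrightarrow> ((cmod w)\<^sup>2) powr (- 1 / 2) *\<^sub>R w" by (simp add: reg_map_def)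
    also have "((cmod w)\<^sup>2) powr (- 1 / 2) = cmod w powr (- 1)" by (rule square_powr_half) simp
    also have "\<dots> = inverse (cmod w)" using w by (simp add: powr_minus)
    finally show ?thesis using 3 by (simp add: power_map_def)
  qed
qed

lemma reg_map_deriv_tendsto:
  assumes \<kappa>: "\<kappa> > 0" and w: "0 < cmod w" "cmod w < 1"
  shows "(\<lambda>n. reg_map_deriv \<kappa> (Suc n) w v) \<longlonglongrightarrow> power_map_deriv \<kappa> w v"
proof -
  define s where "s = (cmod w)\<^sup>2"
  have s: "0 < s" "s < 1" using w by (auto simp: s_def abs_square_less_1)
  have eq: "2 * reg_power_deriv \<kappa> (Suc n) s = reg_power \<kappa> (Suc n) s * reg_power_logderiv \<kappa> (Suc n) s / s" for n
    using reg_power_deriv_eq[of "Suc n" s \<kappa>] s by (simp add: field_simps)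
  have "(\<lambda>n. reg_power \<kappa> (Suc n) s *\<^sub>R v + (reg_power \<kappa> (Suc n) s * reg_power_logderiv \<kappa> (Suc n) s / s * Re (cnj w * v)) *\<^sub>R w)
      \<longlonglongrightarrow> s powr ((\<kappa> - 1) / 2) *\<^sub>R v + (s powr ((\<kappa> - 1) / 2) * (\<kappa> - 1) / s * Re (cnj w * v)) *\<^sub>R w"
    using s by (intro tendsto_intros reg_power_tendsto[OF \<kappa>]) auto
  moreover have "s powr ((\<kappa> - 1) / 2) = cmod w powr (\<kappa> - 1)" unfolding s_def by (rule square_powr_half) simp
  ultimately show ?thesis using w unfolding reg_map_deriv_def power_map_deriv_def s_def[symmetric] eq by simp
qed

text \<open>For $\kappa\ge1$ the weight is bounded. For $\kappa<1$ the Jacobian integral of the regularised maps does not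
  depend on the regularisation, because the trace does not. Their Jacobians are nonnegative and for $0<|u|<1$ tend
  to $\kappa|u|^{2\kappa-2}$ times the Jacobian of $u$, so the limit is integrable, and it controls the weighted gradient.\<close>

lemma weighted_gradient_L2:
  assumes \<kappa>: "\<kappa> > 0" and X: "sobolev_limit u p q g" and g: "\<And>\<theta>. cmod (g (cis \<theta>)) = 1"
    and qr: "AE z in lebesgue_on (ball 0 1). (cmod (p z))\<^sup>2 + (cmod (q z))\<^sup>2 \<le> C * Im (cnj (p z) * q z)" and C: "C > 0"
  defines "w \<equiv> \<lambda>r z. (if 0 < cmod (u z) \<and> cmod (u z) < 1 then max 1 ((cmod (u z))\<^sup>2 powr ((\<kappa> - 1) / 2)) * cmod (r z) else 0)"
  shows "w p \<in> L2 (ball 0 1)" "w q \<in> L2 (ball 0 1)"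
proof -
  let ?M = "lebesgue_on (ball (0::complex) 1)"
  have L: "u \<in> L2 (ball 0 1)" "p \<in> L2 (ball 0 1)" "q \<in> L2 (ball 0 1)" using X by (auto simp: sobolev_limit_def)
  note [measurable] = L2D(1)[OF L(1)] L2D(1)[OF L(2)] L2D(1)[OF L(3)]
  have wm: "w r \<in> borel_measurable ?M" if [measurable]: "r \<in> borel_measurable ?M" for r
    unfolding w_def by measurable
  define J where "J z = Im (cnj (p z) * q z)" for z
  have Jm[measurable]: "J \<in> borel_measurable ?M" unfolding J_def[abs_def] by measurable
  have Ji: "integrable ?M J" unfolding J_def[abs_def] by (rule L2_integrable_Jacobian[OF L(2,3)])
  have J0: "AE z in ?M. 0 \<le> J z"
    using qr
  proof eventually_elim
    case (elim z)
    then have "0 \<le> C * J z" unfolding J_def by (rule order_trans[rotated]) (intro add_nonneg_nonneg zero_le_power2)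
    then show ?case using C by (simp add: zero_le_mult_iff)
  qed
  define a where "a = (\<kappa> - 1) / 2"
  define G where "G z = (if 0 < cmod (u z) \<and> cmod (u z) < 1 then (max 1 ((cmod (u z))\<^sup>2 powr a))\<^sup>2 * J z else 0)" for z
  have "integrable ?M G"
  proof (cases "\<kappa> \<ge> 1")
    case True
    have "norm (G z) \<le> norm (J z)" for z
    proof -
      have "(cmod (u z))\<^sup>2 powr a \<le> 1" if "cmod (u z) < 1"
        using that True by (intro powr_le1) (auto simp: a_def abs_square_le_1)
      then show ?thesis by (auto simp: G_def max_def)
    qed
    then show ?thesis
      by (intro Bochner_Integration.integrable_bound[OF Ji]) (auto simp: G_def[abs_def])
  next
    case False
    define I0 where "I0 = integral\<^sup>L ?M J"
    \<comment> \<open>for $|u|^2\ge1/k$, $k=n+1$, the shift by $1/k$ changes the power by a bounded factor only\<close>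
    define f where "f n z = (if 1 / real (Suc n) \<le> (cmod (u z))\<^sup>2 \<and> cmod (u z) < 1 then ((cmod (u z))\<^sup>2 powr a)\<^sup>2 * J z else 0)" for n z
    have fm[measurable]: "f n \<in> borel_measurable ?M" for n unfolding f_def[abs_def] by measurable
    have jac: "integral\<^sup>L ?M (\<lambda>z. (reg_power \<kappa> (Suc n) ((cmod (u z))\<^sup>2))\<^sup>2 * (1 + reg_power_logderiv \<kappa> (Suc n) ((cmod (u z))\<^sup>2)) * J z) = I0"
      "integrable ?M (\<lambda>z. (reg_power \<kappa> (Suc n) ((cmod (u z))\<^sup>2))\<^sup>2 * (1 + reg_power_logderiv \<kappa> (Suc n) ((cmod (u z))\<^sup>2)) * J z)" for n
    proof -
      obtain M where \<Phi>: "smooth_lipschitz (reg_map \<kappa> (Suc n)) (reg_map_deriv \<kappa> (Suc n)) M"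
        using reg_map_smooth_lipschitz[OF _ \<kappa>, of "Suc n"] by auto
      note XC = sobolev_limit_compose[OF X \<Phi>]
      have tr: "sobolev_limit (\<lambda>z. reg_map \<kappa> (Suc n) (u z)) (\<lambda>z. reg_map_deriv \<kappa> (Suc n) (u z) (p z)) (\<lambda>z. reg_map_deriv \<kappa> (Suc n) (u z) (q z)) g"
        using XC g by (simp add: sobolev_limit_def reg_map_def reg_power_1)
      have LC: "(\<lambda>z. reg_map_deriv \<kappa> (Suc n) (u z) (p z)) \<in> L2 (ball 0 1)" "(\<lambda>z. reg_map_deriv \<kappa> (Suc n) (u z) (q z)) \<in> L2 (ball 0 1)"
        using tr by (auto simp: sobolev_limit_def)
      show "integral\<^sup>L ?M (\<lambda>z. (reg_power \<kappa> (Suc n) ((cmod (u z))\<^sup>2))\<^sup>2 * (1 + reg_power_logderiv \<kappa> (Suc n) ((cmod (u z))\<^sup>2)) * J z) = I0"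
        using Jacobian_integral_depends_on_trace[OF tr X] unfolding I0_def J_def Jacobian_reg_map[OF zero_less_Suc] .
      show "integrable ?M (\<lambda>z. (reg_power \<kappa> (Suc n) ((cmod (u z))\<^sup>2))\<^sup>2 * (1 + reg_power_logderiv \<kappa> (Suc n) ((cmod (u z))\<^sup>2)) * J z)"
        using L2_integrable_Jacobian[OF LC] unfolding J_def Jacobian_reg_map[OF zero_less_Suc] .
    qed
    have a0: "a < 0" using False by (simp add: a_def)
    have low: "((s powr a)\<^sup>2) \<le> (2 / \<kappa> * (2 powr (- a))\<^sup>2) * ((reg_power \<kappa> (Suc n) s)\<^sup>2 * (1 + reg_power_logderiv \<kappa> (Suc n) s))"
      if s: "1 / real (Suc n) \<le> s" "s < 1" for n s
    proof -
      have s0: "s > 0" using s(1) by (rule less_le_trans[rotated]) simp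
      have X1: "(s + 1 / real (Suc n)) / (1 + 1 / real (Suc n)) \<le> 2 * s"
      proof -
        have "(s + d) / (1 + d) \<le> 2 * s" if "0 < d" "d \<le> s" for d
        proof -
          have "s + d \<le> 2 * s * 1" using that by simp
          also have "\<dots> \<le> 2 * s * (1 + d)" using that s0 by (intro mult_left_mono) auto
          finally show ?thesis using that by (simp add: divide_le_eq)
        qed
        then show ?thesis using s by simp
      qed
      have X0: "(s + 1 / real (Suc n)) / (1 + 1 / real (Suc n)) > 0" using s0 by (intro divide_pos_pos add_pos_pos) auto
      have "2 powr a * s powr a = (2 * s) powr a" using s0 by (simp add: powr_mult)
      also have "\<dots> \<le> ((s + 1 / real (Suc n)) / (1 + 1 / real (Suc n))) powr a"
        using X1 X0 a0 by (intro powr_mono2') auto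
      also have "\<dots> = \<dots> * 1" by simp
      also have "\<dots> \<le> reg_power \<kappa> (Suc n) s"
      proof -
        have t: "s ^ Suc n \<le> 1" using s0 s by (intro power_le_one) auto
        have "1 \<le> 2 / (1 + t)" if "0 \<le> t" "t \<le> 1" for t :: real using that by simp
        from this[OF _ t] have "1 \<le> (2 / (1 + s ^ Suc n)) powr (\<kappa> / (2 * real (Suc n)))"
          using s0 \<kappa> by (intro ge_one_powr_ge_zero) simp_all
        then show ?thesis unfolding reg_power_def a_def[symmetric] by (intro mult_left_mono) auto
      qed
      finally have "2 powr a * s powr a \<le> reg_power \<kappa> (Suc n) s" .
      then have "2 powr (- a) * (2 powr a * s powr a) \<le> 2 powr (- a) * reg_power \<kappa> (Suc n) s" by (intro mult_left_mono) auto
      then have h: "s powr a \<le> 2 powr (- a) * reg_power \<kappa> (Suc n) s" by (simp add: mult.assoc[symmetric] powr_add[symmetric])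
      have "\<kappa> / 2 \<le> \<kappa> / (1 + t)" if "0 \<le> t" "t \<le> 1" for t
        using that \<kappa> by (intro divide_left_mono) auto
      from this[of "s ^ Suc n"] have "\<kappa> / 2 \<le> \<kappa> / (1 + s ^ Suc n)"
        using s0 s power_le_one[of s "Suc n"] zero_less_power[OF s0, of "Suc n"] by linarith
      also have "\<dots> \<le> 1 + reg_power_logderiv \<kappa> (Suc n) s" using s0 \<kappa> False by (intro reg_power_logderiv_ge) auto
      finally have l: "\<kappa> / 2 \<le> 1 + reg_power_logderiv \<kappa> (Suc n) s" .
      have "(s powr a)\<^sup>2 \<le> (2 powr (- a) * reg_power \<kappa> (Suc n) s)\<^sup>2" using h by (intro power_mono) auto
      also have "\<dots> = (2 / \<kappa> * (2 powr (- a))\<^sup>2) * ((reg_power \<kappa> (Suc n) s)\<^sup>2 * (\<kappa> / 2))" using \<kappa> by (simp add: power_mult_distrib)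
      also have "\<dots> \<le> (2 / \<kappa> * (2 powr (- a))\<^sup>2) * ((reg_power \<kappa> (Suc n) s)\<^sup>2 * (1 + reg_power_logderiv \<kappa> (Suc n) s))"
        using l \<kappa> by (intro mult_left_mono) auto
      finally show ?thesis .
    qed
    let ?c = "2 / \<kappa> * (2 powr (- a))\<^sup>2"
    have c0: "?c \<ge> 0" using \<kappa> by simp
    have fle: "AE z in ?M. f n z \<le> ?c * ((reg_power \<kappa> (Suc n) ((cmod (u z))\<^sup>2))\<^sup>2 * (1 + reg_power_logderiv \<kappa> (Suc n) ((cmod (u z))\<^sup>2)) * J z) \<and> 0 \<le> f n z" for n
      using J0
    proof eventually_elim
      case (elim z)
      let ?s = "(cmod (u z))\<^sup>2"
      show ?case
      proof (cases "1 / real (Suc n) \<le> ?s \<and> cmod (u z) < 1")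
        case True
        then have "?s < 1" by (simp add: abs_square_less_1)
        from mult_right_mono[OF low[OF conjunct1[OF True] this] elim]
        show ?thesis using True elim by (simp add: f_def mult.assoc)
      next
        case False
        have "0 \<le> \<kappa> / (1 + ?s ^ Suc n)" using \<kappa> by (intro divide_nonneg_nonneg add_nonneg_nonneg) auto
        also have "\<dots> \<le> 1 + reg_power_logderiv \<kappa> (Suc n) ?s" using \<kappa> \<open>\<not> \<kappa> \<ge> 1\<close> by (intro reg_power_logderiv_ge) auto
        finally have "0 \<le> (reg_power \<kappa> (Suc n) ?s)\<^sup>2 * (1 + reg_power_logderiv \<kappa> (Suc n) ?s) * J z" using elim by (intro mult_nonneg_nonneg) auto
        from mult_nonneg_nonneg[OF c0 this] False show ?thesis unfolding f_def by (simp only: if_False order_refl simp_thms)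
      qed
    qed
    have fi: "integrable ?M (f n)" for n
      by (rule Bochner_Integration.integrable_bound[OF integrable_mult_right[OF jac(2)[of n], of ?c] fm], rule eventually_mono[OF fle[of n]])
         (simp only: real_norm_def, linarith)
    have fI: "integral\<^sup>L ?M (f n) \<le> ?c * I0" for n
    proof -
      have "integral\<^sup>L ?M (f n) \<le> (\<integral>z. ?c * ((reg_power \<kappa> (Suc n) ((cmod (u z))\<^sup>2))\<^sup>2 * (1 + reg_power_logderiv \<kappa> (Suc n) ((cmod (u z))\<^sup>2)) * J z) \<partial>?M)"
        by (rule integral_mono_AE[OF fi integrable_mult_right[OF jac(2)]]) (rule eventually_mono[OF fle[of n]], erule conjunct1)
      then show ?thesis unfolding Bochner_Integration.integral_mult_right_zero jac(1) .
    qed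
    have mono: "f m z \<le> f n z" if "0 \<le> J z" "m \<le> n" for m n z
    proof -
      have "1 / real (Suc n) \<le> 1 / real (Suc m)" using that(2) by (simp add: frac_le)
      then show ?thesis using that(1) by (auto simp: f_def)
    qed
    have mAE: "AE z in ?M. mono (\<lambda>n. f n z)" using J0 by eventually_elim (auto intro!: monoI mono)
    have "incseq (\<lambda>n. integral\<^sup>L ?M (f n))"
      by (intro monoI integral_mono_AE fi) (use J0 in \<open>auto elim!: eventually_mono intro: mono\<close>)
    then obtain x where x: "(\<lambda>n. integral\<^sup>L ?M (f n)) \<longlonglongrightarrow> x" using incseq_convergent[of _ "?c * I0"] fI by blast
    have G_eq: "G z = (if 0 < cmod (u z) \<and> cmod (u z) < 1 then ((cmod (u z))\<^sup>2 powr a)\<^sup>2 * J z else 0)" for z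
    proof -
      have "1 \<le> (cmod (u z))\<^sup>2 powr a" if "0 < cmod (u z)" "cmod (u z) < 1"
      proof -
        have "1 powr a \<le> (cmod (u z))\<^sup>2 powr a" using that a0 by (intro powr_mono2') (auto simp: abs_square_le_1)
        then show ?thesis by simp
      qed
      then show ?thesis by (auto simp: G_def max_def)
    qed
    have lim: "AE z in ?M. (\<lambda>n. f n z) \<longlonglongrightarrow> G z"
    proof (rule AE_I2)
      fix z
      show "(\<lambda>n. f n z) \<longlonglongrightarrow> G z"
      proof (cases "u z = 0")
        case True
        then show ?thesis by (simp add: f_def G_eq)
      next
        case False
        then have "\<forall>\<^sub>F n in sequentially. inverse (real (Suc n)) < (cmod (u z))\<^sup>2"
          using order_tendstoD(2)[OF LIMSEQ_inverse_real_of_nat, of "(cmod (u z))\<^sup>2"] by simp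
        then have "\<forall>\<^sub>F n in sequentially. f n z = G z"
          by eventually_elim (use False in \<open>simp add: f_def G_eq inverse_eq_divide\<close>)
        then show ?thesis by (rule tendsto_eventually)
      qed
    qed
    have "G \<in> borel_measurable ?M" unfolding G_def[abs_def] by measurable
    from integrable_monotone_convergence[OF fi mAE lim x this] show ?thesis .
  qed
  then have CG: "integrable ?M (\<lambda>z. C * G z)" by simp
  have *: "w r \<in> L2 (ball 0 1)" if r[measurable]: "r \<in> borel_measurable ?M"
    and le: "AE z in ?M. (cmod (r z))\<^sup>2 \<le> C * J z" for r
  proof -
    note [measurable] = wm[OF r]
    have "integrable ?M (\<lambda>z. (norm (w r z))\<^sup>2)"
    proof (rule Bochner_Integration.integrable_bound[OF CG])
      show "AE z in ?M. norm ((norm (w r z))\<^sup>2) \<le> norm (C * G z)"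
        using le
      proof eventually_elim
        case (elim z)
        show ?case
        proof (cases "0 < cmod (u z) \<and> cmod (u z) < 1")
          case True
          let ?m = "max 1 ((cmod (u z))\<^sup>2 powr a)"
          have "(norm (w r z))\<^sup>2 = ?m\<^sup>2 * (cmod (r z))\<^sup>2"
            using True by (simp add: w_def a_def power_mult_distrib abs_mult)
          also have "\<dots> \<le> ?m\<^sup>2 * (C * J z)" using elim by (intro mult_left_mono) auto
          also have "\<dots> = C * G z" using True by (simp add: G_def)
          finally show ?thesis by (simp add: abs_le_iff)
        next
          case False then show ?thesis by (auto simp: w_def)
        qed
      qed
    qed measurable
    then show ?thesis by (simp add: L2_def)
  qed
  have "AE z in ?M. (cmod (p z))\<^sup>2 \<le> C * J z" "AE z in ?M. (cmod (q z))\<^sup>2 \<le> C * J z"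
    using qr by (eventually_elim, simp only: J_def, smt (verit) zero_le_power2)+
  then show "w p \<in> L2 (ball 0 1)" "w q \<in> L2 (ball 0 1)" by (auto intro!: *)
qed

text \<open>The regularised maps converge boundedly, and their derivatives converge under the integrable majorant of
  \<open>weighted_gradient_L2\<close> for $0<|u|<1$. Elsewhere the gradient of $u$ vanishes, on the zero set by
  \<open>gradient_zero_on_zero_set\<close>.\<close>

lemma sobolev_limit_power_map:
  assumes \<kappa>: "\<kappa> > 0" and X: "sobolev_limit u p q g" and g: "\<And>\<theta>. cmod (g (cis \<theta>)) = 1"
    and qr: "AE z in lebesgue_on (ball 0 1). (cmod (p z))\<^sup>2 + (cmod (q z))\<^sup>2 \<le> C * Im (cnj (p z) * q z)" and C: "C > 0"
    and flat: "AE z in lebesgue_on (ball 0 1). 1 \<le> cmod (u z) \<longrightarrow> p z = 0 \<and> q z = 0"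
  shows "sobolev_limit (\<lambda>z. power_map \<kappa> (u z)) (\<lambda>z. power_map_deriv \<kappa> (u z) (p z)) (\<lambda>z. power_map_deriv \<kappa> (u z) (q z)) g"
proof -
  let ?M = "lebesgue_on (ball (0::complex) 1)"
  have L: "u \<in> L2 (ball 0 1)" "p \<in> L2 (ball 0 1)" "q \<in> L2 (ball 0 1)" using X by (auto simp: sobolev_limit_def)
  note [measurable] = L2D(1)[OF L(1)] L2D(1)[OF L(2)] L2D(1)[OF L(3)]
  have tr: "sobolev_limit (\<lambda>z. reg_map \<kappa> (Suc n) (u z)) (\<lambda>z. reg_map_deriv \<kappa> (Suc n) (u z) (p z)) (\<lambda>z. reg_map_deriv \<kappa> (Suc n) (u z) (q z)) g" for n
  proof -
    obtain M where \<Phi>: "smooth_lipschitz (reg_map \<kappa> (Suc n)) (reg_map_deriv \<kappa> (Suc n)) M"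
      using reg_map_smooth_lipschitz[OF _ \<kappa>, of "Suc n"] by auto
    show ?thesis
      using sobolev_limit_compose[OF X \<Phi>] g by (simp add: sobolev_limit_def reg_map_def reg_power_1)
  qed
  have LC: "(\<lambda>z. reg_map \<kappa> (Suc n) (u z)) \<in> L2 (ball 0 1)" "(\<lambda>z. reg_map_deriv \<kappa> (Suc n) (u z) (p z)) \<in> L2 (ball 0 1)"
    "(\<lambda>z. reg_map_deriv \<kappa> (Suc n) (u z) (q z)) \<in> L2 (ball 0 1)" for n
    using tr[of n] by (auto simp: sobolev_limit_def)
  let ?K = "2 powr (\<kappa> / 2 + \<bar>\<kappa> - 1\<bar> / 2)"
  have mp: "(\<lambda>z. power_map \<kappa> (u z)) \<in> borel_measurable ?M" unfolding power_map_def[abs_def] by measurable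
  have md: "(\<lambda>z. power_map_deriv \<kappa> (u z) (r z)) \<in> borel_measurable ?M" if [measurable]: "r \<in> borel_measurable ?M" for r
    unfolding power_map_deriv_def[abs_def] by measurable
  have one: "(\<lambda>z::complex. 1 :: real) \<in> L2 (ball 0 1)" by (intro continuous_on_cball_L2 continuous_on_const)
  have b0: "AE z in ?M. norm (reg_map \<kappa> (Suc n) (u z)) \<le> ?K * norm (1::real)" for n
    using reg_map_bound[OF zero_less_Suc \<kappa>] by simp
  have c0: "AE z in ?M. (\<lambda>n. reg_map \<kappa> (Suc n) (u z)) \<longlonglongrightarrow> power_map \<kappa> (u z)"
    by (intro AE_I2 reg_map_tendsto[OF \<kappa>])
  note d0 = L2_dominated_convergence[OF L2D(1)[OF LC(1)] mp one b0 c0]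
  have d: "(\<lambda>z. power_map_deriv \<kappa> (u z) (r z)) \<in> L2 (ball 0 1) \<and>
     L2_tendsto (ball 0 1) (\<lambda>n z. reg_map_deriv \<kappa> (Suc n) (u z) (r z)) (\<lambda>z. power_map_deriv \<kappa> (u z) (r z))"
    if rm: "r \<in> borel_measurable ?M" and Lr: "\<And>n. (\<lambda>z. reg_map_deriv \<kappa> (Suc n) (u z) (r z)) \<in> L2 (ball 0 1)"
      and w: "(\<lambda>z. if 0 < cmod (u z) \<and> cmod (u z) < 1 then max 1 ((cmod (u z))\<^sup>2 powr ((\<kappa> - 1) / 2)) * cmod (r z) else 0) \<in> L2 (ball 0 1)"
      and r0: "AE z in ?M. \<not> (0 < cmod (u z) \<and> cmod (u z) < 1) \<longrightarrow> r z = 0" for r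
  proof -
    let ?w = "\<lambda>z. if 0 < cmod (u z) \<and> cmod (u z) < 1 then max 1 ((cmod (u z))\<^sup>2 powr ((\<kappa> - 1) / 2)) * cmod (r z) else 0"
    have b: "AE z in ?M. norm (reg_map_deriv \<kappa> (Suc n) (u z) (r z)) \<le> ?K * (1 + (\<bar>\<kappa> - 1\<bar> + \<kappa>)) * norm (?w z)" for n
      using r0
    proof eventually_elim
      case (elim z)
      show ?case
      proof (cases "0 < cmod (u z) \<and> cmod (u z) < 1")
        case True
        then show ?thesis using reg_map_deriv_bound[OF zero_less_Suc \<kappa>, of "u z" n "r z"] by simp
      next
        case False
        then show ?thesis using elim by (auto simp: reg_map_deriv_def)
      qed
    qed
    have c: "AE z in ?M. (\<lambda>n. reg_map_deriv \<kappa> (Suc n) (u z) (r z)) \<longlonglongrightarrow> power_map_deriv \<kappa> (u z) (r z)"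
      using r0
    proof eventually_elim
      case (elim z)
      show ?case
      proof (cases "0 < cmod (u z) \<and> cmod (u z) < 1")
        case True
        then show ?thesis using reg_map_deriv_tendsto[OF \<kappa>] by blast
      next
        case False
        then have "r z = 0" using elim by blast
        moreover have "power_map_deriv \<kappa> (u z) (r z) = 0" using False unfolding power_map_deriv_def by (simp only: if_False)
        ultimately show ?thesis by (simp add: reg_map_deriv_def)
      qed
    qed
    show ?thesis using L2_dominated_convergence(1,3)[OF L2D(1)[OF Lr] md[OF rm] w b c] by blast
  qed
  have z: "AE z in ?M. \<not> (0 < cmod (u z) \<and> cmod (u z) < 1) \<longrightarrow> p z = 0" "AE z in ?M. \<not> (0 < cmod (u z) \<and> cmod (u z) < 1) \<longrightarrow> q z = 0"
    using gradient_zero_on_zero_set[OF X] flat by (eventually_elim, force)+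
  note dp = d[OF L2D(1)[OF L(2)] LC(2) weighted_gradient_L2(1)[OF \<kappa> X g qr C] z(1)]
  note dq = d[OF L2D(1)[OF L(3)] LC(3) weighted_gradient_L2(2)[OF \<kappa> X g qr C] z(2)]
  show ?thesis
    by (rule sobolev_limit_closed[OF tr d0(1) conjunct1[OF dp] conjunct1[OF dq] d0(3) conjunct2[OF dp] conjunct2[OF dq]])
qed

section \<open>Blaschke products\<close>

lemma blaschke_denominator_nonzero:
  assumes "cmod a < 1" "cmod z \<le> 1"
  shows "1 - cnj a * z \<noteq> 0"
proof
  assume "1 - cnj a * z = 0"
  then have "cmod a * cmod z = 1" by (metis complex_mod_cnj eq_iff_diff_eq_0 norm_mult norm_one)
  moreover have "cmod a * cmod z \<le> cmod a * 1" using assms by (intro mult_left_mono) auto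
  ultimately show False using assms by simp
qed

lemma blaschke_factor_norm_identity:
  "(cmod (1 - cnj a * z))\<^sup>2 - (cmod (z - a))\<^sup>2 = (1 - (cmod a)\<^sup>2) * (1 - (cmod z)\<^sup>2)"
  unfolding cmod_power2 by (simp add: power2_eq_square algebra_simps)

lemma blaschke_factor_norm:
  assumes "cmod a < 1"
  shows "cmod z < 1 \<Longrightarrow> cmod ((z - a) / (1 - cnj a * z)) < 1"
    and "cmod z = 1 \<Longrightarrow> cmod ((z - a) / (1 - cnj a * z)) = 1"
proof -
  have a: "(cmod a)\<^sup>2 < 1" using assms by (simp add: abs_square_less_1)
  { assume z: "cmod z < 1"
    have "(1 - (cmod a)\<^sup>2) * (1 - (cmod z)\<^sup>2) > 0" using a z by (intro mult_pos_pos) (auto simp: abs_square_less_1)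
    then have "(cmod (z - a))\<^sup>2 < (cmod (1 - cnj a * z))\<^sup>2" using blaschke_factor_norm_identity[of a z] by linarith
    then have "cmod (z - a) < cmod (1 - cnj a * z)" by (rule power2_less_imp_less) simp
    then show "cmod ((z - a) / (1 - cnj a * z)) < 1"
      using blaschke_denominator_nonzero[OF assms, of z] z by (simp add: norm_divide divide_less_eq) }
  { assume z: "cmod z = 1"
    have "(cmod (z - a))\<^sup>2 = (cmod (1 - cnj a * z))\<^sup>2" using blaschke_factor_norm_identity[of a z] z by simp
    then have "cmod (z - a) = cmod (1 - cnj a * z)" by (rule power2_eq_imp_eq) simp_all
    then show "cmod ((z - a) / (1 - cnj a * z)) = 1"
      using blaschke_denominator_nonzero[OF assms, of z] z by (simp add: norm_divide) }
qed

lemma blaschke_norm_circle: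
  assumes "\<And>j. j \<in> {1..D} \<Longrightarrow> a j \<in> ball 0 1" "cmod z = 1"
  shows "cmod (blaschke \<alpha> D a z) = 1"
proof -
  have "(\<Prod>j=1..D. cmod ((z - a j) / (1 - cnj (a j) * z))) = (\<Prod>j=1..D. 1)"
    using assms by (intro prod.cong refl blaschke_factor_norm(2)) auto
  then show ?thesis by (simp add: blaschke_def norm_mult prod_norm[symmetric])
qed

lemma blaschke_norm_disc:
  assumes "D \<ge> 1" "\<And>j. j \<in> {1..D} \<Longrightarrow> a j \<in> ball 0 1" "cmod z < 1"
  shows "cmod (blaschke \<alpha> D a z) < 1"
proof -
  define f where "f j = cmod ((z - a j) / (1 - cnj (a j) * z))" for j
  have f: "0 \<le> f j" "f j < 1" if "j \<in> {1..D}" for j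
    using assms(2)[OF that] assms(3) blaschke_factor_norm(1)[of "a j" z] by (auto simp: f_def)
  have "(\<Prod>j\<in>{1..D}. f j) = f 1 * (\<Prod>j\<in>{1..D} - {1}. f j)"
    using assms(1) by (intro prod.remove) auto
  also have "\<dots> \<le> f 1 * 1"
    using f assms(1) by (intro mult_left_mono prod_le_1) (auto simp: less_imp_le)
  also have "\<dots> < 1" using f(2)[of 1] assms(1) by simp
  finally show ?thesis by (simp add: blaschke_def norm_mult prod_norm[symmetric] f_def)
qed

lemma blaschke_smooth:
  assumes "\<And>j. j \<in> {1..D} \<Longrightarrow> a j \<in> ball 0 1"
  shows "smooth_to_boundary (blaschke \<alpha> D a)"
    and "z \<in> ball 0 1 \<Longrightarrow> dy (blaschke \<alpha> D a) z = \<i> * dx (blaschke \<alpha> D a) z"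
proof -
  define S where "S = (\<Inter>j\<in>{1..D}. {z. 1 - cnj (a j) * z \<noteq> 0})"
  have o: "open S" unfolding S_def
    by (intro open_INT ballI open_Collect_neq continuous_intros) auto
  have cb: "cball 0 1 \<subseteq> S"
    using assms blaschke_denominator_nonzero by (fastforce simp: S_def)
  have "Ck_on k S (blaschke \<alpha> D a)" for k
    unfolding blaschke_def[abs_def] divide_inverse
    by (intro Ck_on_mult Ck_on_const Ck_on_prod Ck_on_inverse Ck_on_diff Ck_on_linear[OF _ bounded_linear_ident] o)
       (auto simp: S_def)
  then show "smooth_to_boundary (blaschke \<alpha> D a)"
    using o cb by (auto simp: smooth_to_boundary_def smooth_on_def)
  assume z: "z \<in> ball 0 1"
  then have zS: "z \<in> S" using cb by auto
  have "blaschke \<alpha> D a holomorphic_on S"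
    unfolding blaschke_def[abs_def] by (intro holomorphic_intros) (auto simp: S_def)
  then obtain c where "(blaschke \<alpha> D a has_field_derivative c) (at z)"
    using holomorphic_on_imp_differentiable_at[OF _ o zS] by (auto simp: field_differentiable_def)
  then have "frechet_derivative (blaschke \<alpha> D a) (at z) = times c"
    using frechet_derivative_at[of "blaschke \<alpha> D a" "times c" z] by (simp add: has_field_derivative_def)
  then show "dy (blaschke \<alpha> D a) z = \<i> * dx (blaschke \<alpha> D a) z" by simp
qed

section \<open>The equality case\<close>

lemma sobolev_limit_cong:
  assumes X: "sobolev_limit u p q g" and eq: "\<And>z. z \<in> ball 0 1 \<Longrightarrow> u z = v z"
  shows "sobolev_limit v p q g"
proof -
  have 1: "(\<lambda>z. (cmod (\<psi> z - u z))\<^sup>2) z = (\<lambda>z. (cmod (\<psi> z - v z))\<^sup>2) z" if "z \<in> space (lebesgue_on (ball (0::complex) 1))" for \<psi> z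
    using eq that by (simp add: space_restrict_space)
  have int: "(\<integral>z. (cmod (\<psi> z - u z))\<^sup>2 \<partial>lebesgue_on (ball 0 1)) = (\<integral>z. (cmod (\<psi> z - v z))\<^sup>2 \<partial>lebesgue_on (ball 0 1))" for \<psi>
    by (rule Bochner_Integration.integral_cong[OF refl 1])
  have u: "u \<in> L2 (ball 0 1)" using X by (simp add: sobolev_limit_def)
  have "v \<in> borel_measurable (lebesgue_on (ball 0 1))"
    using L2D(1)[OF u] by (rule measurable_cong[THEN iffD1, rotated]) (use eq in \<open>simp add: space_restrict_space\<close>)
  moreover have "integrable (lebesgue_on (ball 0 1)) (\<lambda>z. (cmod (v z))\<^sup>2)"
    using L2D(2)[OF u] by (rule Bochner_Integration.integrable_cong[OF refl, THEN iffD1, rotated]) (use eq in \<open>simp add: space_restrict_space\<close>)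
  ultimately have "v \<in> L2 (ball 0 1)" by (simp add: L2_def)
  then show ?thesis using X unfolding sobolev_limit_def int by blast
qed

lemma power_map_deriv_inner:
  assumes "0 < cmod w" "cmod w < 1"
  shows "cnj w * power_map_deriv \<kappa> w v = of_real (cmod w powr (\<kappa> - 1)) * (cnj w * v + of_real ((\<kappa> - 1) * Re (cnj w * v)))"
proof -
  have w: "cnj w * w = of_real ((cmod w)\<^sup>2)" unfolding complex_norm_square by (rule mult.commute)
  have "cnj w * power_map_deriv \<kappa> w v = of_real (cmod w powr (\<kappa> - 1)) * (cnj w * v)
      + of_real (cmod w powr (\<kappa> - 1) * (\<kappa> - 1) / (cmod w)\<^sup>2 * Re (cnj w * v)) * (cnj w * w)"
    using assms by (simp add: power_map_deriv_def scaleR_conv_of_real algebra_simps)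
  also have "of_real (cmod w powr (\<kappa> - 1) * (\<kappa> - 1) / (cmod w)\<^sup>2 * Re (cnj w * v)) * (cnj w * w)
      = of_real (cmod w powr (\<kappa> - 1)) * of_real ((\<kappa> - 1) * Re (cnj w * v))"
    unfolding w using assms by (simp only: of_real_mult[symmetric]) simp
  finally show ?thesis by (simp only: distrib_left)
qed

text \<open>In polar terms: the $\varepsilon$-th power of the modulus rescales the radial derivative by
  $\varepsilon$, so it turns the Cauchy-Riemann equations into the equality case of the energy bound.\<close>

lemma conformal_defect_power_map:
  assumes w: "cmod w < 1" and \<epsilon>: "\<epsilon> > 0"
  shows "conformal_defect \<epsilon> (power_map \<epsilon> w) (power_map_deriv \<epsilon> w p) (power_map_deriv \<epsilon> w (\<i> * p)) = 0"
proof (cases "w = 0")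
  case True
  then show ?thesis by (simp add: conformal_defect_def power_map_def)
next
  case False
  define h where "h = cmod w powr (\<epsilon> - 1)"
  have h: "h > 0" using False by (simp add: h_def)
  have W: "power_map \<epsilon> w = of_real h * w" using w by (simp add: power_map_def h_def scaleR_conv_of_real)
  have c: "cnj (power_map \<epsilon> w) * v / of_real (cmod (power_map \<epsilon> w)) = cnj w * v / of_real (cmod w)" for v
    using h False by (simp add: W norm_mult)
  have eq: "cnj (power_map \<epsilon> w) * power_map_deriv \<epsilon> w v / of_real (cmod (power_map \<epsilon> w))
       = of_real (h / cmod w) * (cnj w * v + of_real ((\<epsilon> - 1) * Re (cnj w * v)))" for v
    unfolding c using power_map_deriv_inner[of w \<epsilon> v] False w by (simp add: h_def)
  have Re: "Re (cnj (power_map \<epsilon> w) * power_map_deriv \<epsilon> w v) / cmod (power_map \<epsilon> w) = h / cmod w * (\<epsilon> * Re (cnj w * v))" for v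
  proof -
    have "Re (cnj (power_map \<epsilon> w) * power_map_deriv \<epsilon> w v) / cmod (power_map \<epsilon> w)
        = Re (of_real (h / cmod w) * (cnj w * v + of_real ((\<epsilon> - 1) * Re (cnj w * v))))"
      unfolding eq[symmetric] by (rule Re_divide_of_real[symmetric])
    also have "Re (of_real k * (c + of_real ((\<epsilon> - 1) * Re c))) = k * (\<epsilon> * Re c)" for k c
      by (simp add: algebra_simps)
    finally show ?thesis .
  qed
  have Im: "Im (cnj (power_map \<epsilon> w) * power_map_deriv \<epsilon> w v) / cmod (power_map \<epsilon> w) = h / cmod w * Im (cnj w * v)" for v
  proof -
    have "Im (cnj (power_map \<epsilon> w) * power_map_deriv \<epsilon> w v) / cmod (power_map \<epsilon> w)
        = Im (of_real (h / cmod w) * (cnj w * v + of_real ((\<epsilon> - 1) * Re (cnj w * v))))"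
      unfolding eq[symmetric] by (rule Im_divide_of_real[symmetric])
    also have "Im (of_real k * (c + of_real ((\<epsilon> - 1) * Re c))) = k * Im c" for k c
      by simp
    finally show ?thesis .
  qed
  have i: "Re (cnj w * (\<i> * p)) = - Im (cnj w * p)" "Im (cnj w * (\<i> * p)) = Re (cnj w * p)" by simp_all
  have "(k * (\<epsilon> * x) / \<epsilon> - k * x)\<^sup>2 + (k * (\<epsilon> * - y) / \<epsilon> + k * y)\<^sup>2 = 0" for k x y :: real
    using \<epsilon> by simp
  then show ?thesis unfolding conformal_defect_def Re Im i .
qed

lemma conformal_defect_zero_iff:
  assumes \<epsilon>: "\<epsilon> > 0" and w: "w \<noteq> 0" and 0: "conformal_defect \<epsilon> w p q = 0"
  shows "Re (cnj w * p) = \<epsilon> * Im (cnj w * q)" "Re (cnj w * q) = - \<epsilon> * Im (cnj w * p)"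
proof -
  have "Re (cnj w * p) / cmod w / \<epsilon> - Im (cnj w * q) / cmod w = 0" "Re (cnj w * q) / cmod w / \<epsilon> + Im (cnj w * p) / cmod w = 0"
    using 0 unfolding conformal_defect_def by (simp_all only: sum_power2_eq_zero_iff)
  moreover have "a = \<epsilon> * b" if "a / m / \<epsilon> - b / m = 0" "m > 0" for a b m :: real
    using that \<epsilon> by (simp add: field_simps)
  moreover have "a = - \<epsilon> * b" if "a / m / \<epsilon> + b / m = 0" "m > 0" for a b m :: real
    using that \<epsilon> by (simp add: field_simps)
  ultimately show "Re (cnj w * p) = \<epsilon> * Im (cnj w * q)" "Re (cnj w * q) = - \<epsilon> * Im (cnj w * p)"
    using w by auto
qed

text \<open>In the equality case the radial part of the gradient is $\varepsilon$ times the rotated angular part, so that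
  both are controlled by the Jacobian.\<close>

lemma conformal_defect_zero_quasiregular:
  assumes \<epsilon>: "\<epsilon> > 0" and w: "w = 0 \<longrightarrow> p = 0 \<and> q = 0" and 0: "conformal_defect \<epsilon> w p q = 0"
  shows "(cmod p)\<^sup>2 + (cmod q)\<^sup>2 \<le> (1 + \<epsilon>\<^sup>2) / \<epsilon> * Im (cnj p * q)"
proof (cases "w = 0")
  case False
  note z = conformal_defect_zero_iff[OF \<epsilon> False 0]
  define m where "m = (cmod w)\<^sup>2"
  have m: "m > 0" using False by (simp add: m_def)
  define A B where "A = cnj w * p" and "B = cnj w * q"
  have nA: "m * (cmod p)\<^sup>2 = (Re A)\<^sup>2 + (Im A)\<^sup>2" "m * (cmod q)\<^sup>2 = (Re B)\<^sup>2 + (Im B)\<^sup>2"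
    unfolding cmod_power2[symmetric] by (simp_all add: A_def B_def m_def norm_mult power_mult_distrib)
  have "cnj A * B = (w * cnj w) * (cnj p * q)" by (simp add: A_def B_def)
  also have "w * cnj w = of_real m" unfolding m_def complex_norm_square ..
  finally have "Im (cnj A * B) = m * Im (cnj p * q)" by simp
  then have J: "m * Im (cnj p * q) = Re A * Im B - Im A * Re B" by simp
  have "m * ((cmod p)\<^sup>2 + (cmod q)\<^sup>2) = (1 + \<epsilon>\<^sup>2) * ((Im A)\<^sup>2 + (Im B)\<^sup>2)"
    using z unfolding distrib_left nA A_def[symmetric] B_def[symmetric] by (simp add: power2_eq_square algebra_simps)
  also have "\<dots> = (1 + \<epsilon>\<^sup>2) / \<epsilon> * (m * Im (cnj p * q))"
    using z \<epsilon> unfolding J A_def[symmetric] B_def[symmetric] by (simp add: power2_eq_square field_simps)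
  finally have "m * ((cmod p)\<^sup>2 + (cmod q)\<^sup>2) = m * ((1 + \<epsilon>\<^sup>2) / \<epsilon> * Im (cnj p * q))" by (simp only: mult.left_commute)
  then have "(cmod p)\<^sup>2 + (cmod q)\<^sup>2 = (1 + \<epsilon>\<^sup>2) / \<epsilon> * Im (cnj p * q)" using m by (simp only: mult_cancel_left) auto
  then show ?thesis by simp
qed (use w in simp)

text \<open>Conversely, the power $1/\varepsilon$ rescales the radial derivative back.\<close>

lemma conformal_defect_zero_Cauchy_Riemann:
  assumes \<epsilon>: "\<epsilon> > 0" and w: "0 < cmod w" "cmod w < 1" and 0: "conformal_defect \<epsilon> w p q = 0"
  shows "power_map_deriv (1 / \<epsilon>) w p + \<i> * power_map_deriv (1 / \<epsilon>) w q = 0"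
proof -
  have w0: "w \<noteq> 0" using w by auto
  note z = conformal_defect_zero_iff[OF \<epsilon> w0 0]
  let ?h = "of_real (cmod w powr (1 / \<epsilon> - 1)) :: complex"
  have "cnj w * (power_map_deriv (1 / \<epsilon>) w p + \<i> * power_map_deriv (1 / \<epsilon>) w q)
     = cnj w * power_map_deriv (1 / \<epsilon>) w p + \<i> * (cnj w * power_map_deriv (1 / \<epsilon>) w q)" by (simp add: algebra_simps)
  also have "\<dots> = ?h * ((cnj w * p + of_real ((1 / \<epsilon> - 1) * Re (cnj w * p))) + \<i> * (cnj w * q + of_real ((1 / \<epsilon> - 1) * Re (cnj w * q))))"
    unfolding power_map_deriv_inner[OF w] by (simp only: distrib_left mult.left_commute)
  also have "(cnj w * p + of_real ((1 / \<epsilon> - 1) * Re (cnj w * p))) + \<i> * (cnj w * q + of_real ((1 / \<epsilon> - 1) * Re (cnj w * q))) = 0"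
  proof (rule complex_eqI)
    have "Re (cnj w * p) / \<epsilon> = Im (cnj w * q)" "Re (cnj w * q) / \<epsilon> = - Im (cnj w * p)" using z \<epsilon> by (simp_all add: field_simps)
    note z' = this
    have "Re ((cnj w * p + of_real ((1 / \<epsilon> - 1) * Re (cnj w * p))) + \<i> * (cnj w * q + of_real ((1 / \<epsilon> - 1) * Re (cnj w * q))))
      = Re (cnj w * p) / \<epsilon> - Im (cnj w * q)" by (simp add: left_diff_distrib)
    then show "Re ((cnj w * p + of_real ((1 / \<epsilon> - 1) * Re (cnj w * p))) + \<i> * (cnj w * q + of_real ((1 / \<epsilon> - 1) * Re (cnj w * q)))) = Re 0"
      unfolding z' by simp
    have "Im ((cnj w * p + of_real ((1 / \<epsilon> - 1) * Re (cnj w * p))) + \<i> * (cnj w * q + of_real ((1 / \<epsilon> - 1) * Re (cnj w * q))))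
      = Im (cnj w * p) + Re (cnj w * q) / \<epsilon>" by (simp add: left_diff_distrib)
    then show "Im ((cnj w * p + of_real ((1 / \<epsilon> - 1) * Re (cnj w * p))) + \<i> * (cnj w * q + of_real ((1 / \<epsilon> - 1) * Re (cnj w * q)))) = Im 0"
      unfolding z' by simp
  qed
  finally show ?thesis using w0 by simp
qed

text \<open>The regularised maps with $\kappa=1$ approximate the projection to the closed unit disc. Their Jacobians are
  $m_nJ$, where $J\ge0$ is the Jacobian of $u$, and have the same integral as $J$. In the limit the multiplier is
  $1$ for $0<|u|<1$, but $\frac12$ for $|u|=1$ and $0$ for $|u|>1$. So $J$ vanishes on $|u|\ge1$, and the
  gradient with it.\<close>

lemma gradient_zero_outside_disc:
  assumes X: "sobolev_limit u p q g" and g: "\<And>\<theta>. cmod (g (cis \<theta>)) = 1"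
    and qr: "AE z in lebesgue_on (ball 0 1). (cmod (p z))\<^sup>2 + (cmod (q z))\<^sup>2 \<le> C * Im (cnj (p z) * q z)" and C: "C > 0"
  shows "AE z in lebesgue_on (ball 0 1). 1 \<le> cmod (u z) \<longrightarrow> p z = 0 \<and> q z = 0"
proof -
  let ?M = "lebesgue_on (ball (0::complex) 1)"
  have L: "u \<in> L2 (ball 0 1)" "p \<in> L2 (ball 0 1)" "q \<in> L2 (ball 0 1)" using X by (auto simp: sobolev_limit_def)
  note [measurable] = L2D(1)[OF L(1)] L2D(1)[OF L(2)] L2D(1)[OF L(3)]
  define J where "J z = Im (cnj (p z) * q z)" for z
  have Jm[measurable]: "J \<in> borel_measurable ?M" unfolding J_def[abs_def] by measurable
  have Ji: "integrable ?M J" unfolding J_def[abs_def] by (rule L2_integrable_Jacobian[OF L(2,3)])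
  have J0: "AE z in ?M. 0 \<le> J z"
    using qr
  proof eventually_elim
    case (elim z)
    then have "0 \<le> C * J z" unfolding J_def by (rule order_trans[rotated]) (intro add_nonneg_nonneg zero_le_power2)
    then show ?case using C by (simp add: zero_le_mult_iff)
  qed
  have Jz: "AE z in ?M. u z = 0 \<longrightarrow> J z = 0"
    using gradient_zero_on_zero_set[OF X] by eventually_elim (simp add: J_def)
  define m where "m n s = (reg_power 1 (Suc n) s)\<^sup>2 * (1 + reg_power_logderiv 1 (Suc n) s)" for n s
  define mlim where "mlim s = (if s < 1 then 1 else if s = 1 then 1 / 2 else 0 :: real)" for s :: real
  have logd: "1 + reg_power_logderiv 1 (Suc n) s = 1 / (1 + s ^ Suc n)" if "s \<ge> 0" for n s
  proof -
    have "1 - t / (1 + t) = 1 / (1 + t)" if "t \<ge> 0" for t :: real using that by (simp add: field_simps)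
    from this[of "s ^ Suc n"] that show ?thesis by (simp add: reg_power_logderiv_def)
  qed
  have mb: "0 \<le> m n s \<and> m n s \<le> 4" if s: "s \<ge> 0" for n s
  proof -
    have sk: "s ^ Suc n \<ge> 0" using s by simp
    have fr: "0 \<le> 1 / (1 + t) \<and> 1 / (1 + t) \<le> 1" "0 \<le> 2 / (1 + t) \<and> 2 / (1 + t) \<le> 2" if "t \<ge> 0" for t :: real using that by (auto simp: divide_le_eq)
    have X: "(s + 1 / real (Suc n)) / (1 + 1 / real (Suc n)) > 0" using s by (intro divide_pos_pos add_nonneg_pos add_pos_pos) auto
    have "t powr ((1 - 1) / 2) = 1" if "t > 0" for t :: real using that by simp
    from this[OF X] have "reg_power 1 (Suc n) s = (2 / (1 + s ^ Suc n)) powr (1 / (2 * real (Suc n)))"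
      unfolding reg_power_def by (simp only: mult_1)
    also have "\<dots> \<le> 2 powr (1 / (2 * real (Suc n)))" using fr(2)[OF sk] by (intro powr_mono2) auto
    also have "\<dots> \<le> 2 powr 1" by (intro powr_mono) auto
    finally have h: "reg_power 1 (Suc n) s \<le> 2" by simp
    have h0: "reg_power 1 (Suc n) s > 0" by (rule reg_power_pos) (use s in auto)
    have "(reg_power 1 (Suc n) s)\<^sup>2 \<le> 2\<^sup>2" using h h0 by (intro power_mono) auto
    then have "(reg_power 1 (Suc n) s)\<^sup>2 * (1 / (1 + s ^ Suc n)) \<le> 4 * 1" using fr(1)[OF sk] by (intro mult_mono) auto
    then show ?thesis using fr(1)[OF sk] unfolding m_def logd[OF s] by simp
  qed
  have ml: "(\<lambda>n. m n s) \<longlonglongrightarrow> mlim s" if s: "s > 0" for s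
  proof -
    consider "s < 1" | "s = 1" | "s > 1" by linarith
    then show ?thesis
    proof cases
      case 1
      have "(\<lambda>n. m n s) \<longlonglongrightarrow> (s powr ((1 - 1) / 2))\<^sup>2 * (1 + (1 - 1))"
        unfolding m_def by (intro tendsto_intros reg_power_tendsto s 1) auto
      then show ?thesis using 1 s by (simp add: mlim_def)
    next
      case 2
      then show ?thesis by (simp add: m_def mlim_def reg_power_1 reg_power_logderiv_def)
    next
      case 3
      have "(\<lambda>n. inverse (s ^ n)) \<longlonglongrightarrow> 0" using 3 by (rule LIMSEQ_inverse_realpow_zero)
      from LIMSEQ_Suc[OF this] have i0: "(\<lambda>n. inverse (s ^ Suc n)) \<longlonglongrightarrow> 0" .
      have z: "(\<lambda>n. 1 / (1 + s ^ Suc n)) \<longlonglongrightarrow> 0"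
      proof (rule tendsto_sandwich[OF _ _ tendsto_const i0])
        have "0 \<le> 1 / (1 + t) \<and> 1 / (1 + t) \<le> inverse t" if "t > 0" for t :: real using that by (simp add: field_simps)
        from this[OF zero_less_power[OF s]]
        show "\<forall>\<^sub>F n in sequentially. 0 \<le> 1 / (1 + s ^ Suc n)" "\<forall>\<^sub>F n in sequentially. 1 / (1 + s ^ Suc n) \<le> inverse (s ^ Suc n)"
          by (intro always_eventually allI; blast)+
      qed
      have "(\<lambda>n. m n s) \<longlonglongrightarrow> (s powr (- (1 / 2)))\<^sup>2 * 0"
        unfolding m_def logd[OF less_imp_le[OF s]] by (intro tendsto_mult tendsto_power reg_power_tendsto_outside z 3) auto
      then show ?thesis using 3 by (simp add: mlim_def)
    qed
  qed
  have jac: "integral\<^sup>L ?M (\<lambda>z. m n ((cmod (u z))\<^sup>2) * J z) = integral\<^sup>L ?M J"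
    "(\<lambda>z. m n ((cmod (u z))\<^sup>2) * J z) \<in> borel_measurable ?M" for n
  proof -
    obtain M where \<Phi>: "smooth_lipschitz (reg_map 1 (Suc n)) (reg_map_deriv 1 (Suc n)) M"
      using reg_map_smooth_lipschitz[of "Suc n" 1] by auto
    have tr: "sobolev_limit (\<lambda>z. reg_map 1 (Suc n) (u z)) (\<lambda>z. reg_map_deriv 1 (Suc n) (u z) (p z)) (\<lambda>z. reg_map_deriv 1 (Suc n) (u z) (q z)) g"
      using sobolev_limit_compose[OF X \<Phi>] g by (simp add: sobolev_limit_def reg_map_def reg_power_1)
    have LC: "(\<lambda>z. reg_map_deriv 1 (Suc n) (u z) (p z)) \<in> L2 (ball 0 1)" "(\<lambda>z. reg_map_deriv 1 (Suc n) (u z) (q z)) \<in> L2 (ball 0 1)"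
      using tr by (auto simp: sobolev_limit_def)
    show "integral\<^sup>L ?M (\<lambda>z. m n ((cmod (u z))\<^sup>2) * J z) = integral\<^sup>L ?M J"
      using Jacobian_integral_depends_on_trace[OF tr X] unfolding m_def J_def Jacobian_reg_map[OF zero_less_Suc] .
    show "(\<lambda>z. m n ((cmod (u z))\<^sup>2) * J z) \<in> borel_measurable ?M"
      using borel_measurable_integrable[OF L2_integrable_Jacobian[OF LC]] unfolding m_def J_def Jacobian_reg_map[OF zero_less_Suc] .
  qed
  have lm: "(\<lambda>z. mlim ((cmod (u z))\<^sup>2) * J z) \<in> borel_measurable ?M" unfolding mlim_def[abs_def] by measurable
  have i4: "integrable ?M (\<lambda>z. 4 * \<bar>J z\<bar>)" using Ji by simp
  have lAE: "AE z in ?M. (\<lambda>n. m n ((cmod (u z))\<^sup>2) * J z) \<longlonglongrightarrow> mlim ((cmod (u z))\<^sup>2) * J z"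
    using Jz
  proof eventually_elim
    case (elim z)
    show ?case
    proof (cases "u z = 0")
      case True then show ?thesis using elim by simp
    next
      case False then show ?thesis by (intro tendsto_mult tendsto_const ml) simp
    qed
  qed
  have bAE: "AE z in ?M. norm (m n ((cmod (u z))\<^sup>2) * J z) \<le> 4 * \<bar>J z\<bar>" for n
  proof (rule AE_I2)
    fix z
    have "\<bar>m n ((cmod (u z))\<^sup>2)\<bar> * \<bar>J z\<bar> \<le> 4 * \<bar>J z\<bar>" using mb[of "(cmod (u z))\<^sup>2" n] by (intro mult_right_mono) auto
    then show "norm (m n ((cmod (u z))\<^sup>2) * J z) \<le> 4 * \<bar>J z\<bar>" by (simp add: abs_mult)
  qed
  have "(\<lambda>n. integral\<^sup>L ?M (\<lambda>z. m n ((cmod (u z))\<^sup>2) * J z)) \<longlonglongrightarrow> integral\<^sup>L ?M (\<lambda>z. mlim ((cmod (u z))\<^sup>2) * J z)"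
    by (rule integral_dominated_convergence[OF lm jac(2) i4 lAE bAE])
  then have Ieq: "integral\<^sup>L ?M J = integral\<^sup>L ?M (\<lambda>z. mlim ((cmod (u z))\<^sup>2) * J z)" unfolding jac(1) by (simp add: LIMSEQ_const_iff)
  have li: "integrable ?M (\<lambda>z. mlim ((cmod (u z))\<^sup>2) * J z)" by (rule integrable_dominated_convergence[OF lm jac(2) i4 lAE bAE])
  have "integral\<^sup>L ?M (\<lambda>z. J z - mlim ((cmod (u z))\<^sup>2) * J z) = 0" using Ieq Ji li by simp
  moreover have "AE z in ?M. 0 \<le> J z - mlim ((cmod (u z))\<^sup>2) * J z" using J0 by eventually_elim (auto simp: mlim_def)
  ultimately have "AE z in ?M. J z - mlim ((cmod (u z))\<^sup>2) * J z = 0"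
    using Ji li by (subst (asm) integral_nonneg_eq_0_iff_AE) auto
  then show ?thesis using qr
  proof eventually_elim
    case (elim z)
    show ?case
    proof
      assume "1 \<le> cmod (u z)"
      then have "1 \<le> (cmod (u z))\<^sup>2" by (rule one_le_power)
      then have "J z = 0" using elim(1) by (auto simp: mlim_def split: if_splits)
      then have "(cmod (p z))\<^sup>2 + (cmod (q z))\<^sup>2 \<le> 0" using elim(2) by (simp add: J_def)
      then show "p z = 0 \<and> q z = 0" by (simp add: sum_power2_le_zero_iff)
    qed
  qed
qed

text \<open>For a map with zero trace the Jacobian integrates to zero, so the Dirichlet integral is the
  integral of $|v_x+iv_y|^2$.\<close>

lemma Cauchy_Riemann_zero_trace:
  assumes X: "sobolev_limit v p q (\<lambda>z. 0)" and cr: "AE z in lebesgue_on (ball 0 1). p z + \<i> * q z = 0"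
  shows "AE z in lebesgue_on (ball 0 1). v z = 0"
proof -
  let ?M = "lebesgue_on (ball (0::complex) 1)"
  have L: "p \<in> L2 (ball 0 1)" "q \<in> L2 (ball 0 1)" using X by (auto simp: sobolev_limit_def)
  note [measurable] = L2D(1)[OF L(1)] L2D(1)[OF L(2)]
  have "smooth_to_boundary (\<lambda>z. 0)" unfolding smooth_to_boundary_def smooth_on_def
    by (intro exI[of _ UNIV]) (simp add: Ck_on_const)
  from sobolev_limit_smooth[OF this, of "\<lambda>z. 0"] have Z: "sobolev_limit (\<lambda>z. 0) (\<lambda>z. 0) (\<lambda>z. 0) (\<lambda>z. 0)" by simp
  have "(\<integral>z. Im (cnj (p z) * q z) \<partial>?M) = 0"
    using Jacobian_integral_depends_on_trace[OF X Z] by simp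
  moreover have "(\<integral>z. (cmod (p z))\<^sup>2 + (cmod (q z))\<^sup>2 \<partial>?M) = (\<integral>z. 2 * Im (cnj (p z) * q z) \<partial>?M)"
  proof (rule integral_cong_AE)
    show "AE z in ?M. (cmod (p z))\<^sup>2 + (cmod (q z))\<^sup>2 = 2 * Im (cnj (p z) * q z)"
      using cr
    proof eventually_elim
      case (elim z)
      then have "p z = - (\<i> * q z)" by (simp add: eq_neg_iff_add_eq_0)
      then show ?case unfolding cmod_power2 by (simp add: power2_eq_square)
    qed
  qed measurable
  ultimately have "(\<integral>z. (cmod (p z))\<^sup>2 + (cmod (q z))\<^sup>2 \<partial>?M) = 0" unfolding Bochner_Integration.integral_mult_right_zero by simp
  then have "AE z in ?M. (cmod (p z))\<^sup>2 + (cmod (q z))\<^sup>2 = 0"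
    using L2D(2)[OF L(1)] L2D(2)[OF L(2)] by (subst (asm) integral_nonneg_eq_0_iff_AE) auto
  then have "AE z in ?M. p z = 0 \<and> q z = 0" by eventually_elim (simp add: sum_power2_eq_zero_iff)
  from zero_gradient_zero_trace[OF X this] show ?thesis .
qed

section \<open>The unique minimizer\<close>

lemma U_map_eq_power_map:
  assumes "cmod (F z) < 1"
  shows "U_map \<epsilon> F z = power_map \<epsilon> (F z)"
  using assms by (simp add: U_map_def power_map_def powr_diff scaleR_conv_of_real)

text \<open>Where $|F|<1$ the branch $|w|>1$ is excluded, because the power map has modulus one there.\<close>

lemma power_map_inverse:
  assumes \<epsilon>: "\<epsilon> > 0" and eq: "power_map (1 / \<epsilon>) w = F z" and F: "cmod (F z) < 1"
  shows "w = U_map \<epsilon> F z"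
proof (cases "w = 0")
  case True
  then have "F z = 0" using eq by (simp add: power_map_def)
  then show ?thesis using True by (simp add: U_map_def)
next
  case False
  have "cmod w \<le> 1"
  proof (rule ccontr)
    assume "\<not> cmod w \<le> 1"
    then have "cmod (F z) = 1" using eq[symmetric] False by (simp add: power_map_def)
    then show False using F by simp
  qed
  then have Fz: "F z = (cmod w powr (1 / \<epsilon> - 1)) *\<^sub>R w" using eq by (simp add: power_map_def)
  have h: "cmod w powr (1 / \<epsilon> - 1) > 0" using False by simp
  have n: "cmod (F z) = cmod w powr (1 / \<epsilon>)" using False by (simp add: Fz powr_diff)
  have F0: "F z \<noteq> 0" using Fz h False by simp
  have "cmod (F z) powr \<epsilon> = cmod w" using \<epsilon> False by (simp add: n powr_powr)
  moreover have "F z / of_real (cmod (F z)) = w / of_real (cmod w)"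
  proof -
    have "(of_real k * w) / of_real (cmod (of_real k * w)) = w / of_real (cmod w)" if "k > 0" for k :: real
      using that by (simp add: norm_mult)
    from this[OF h] show ?thesis unfolding Fz scaleR_conv_of_real .
  qed
  ultimately show ?thesis using F0 False by (simp add: U_map_def)
qed

theorem proposition3p5:
  fixes D :: nat and \<alpha> \<epsilon> :: real and a :: "nat \<Rightarrow> complex" and F g :: "complex \<Rightarrow> complex"
  assumes "D \<ge> 1"
    and "\<And>j. j \<in> {1..D} \<Longrightarrow> a j \<in> ball 0 1"
    and "F = blaschke \<alpha> D a"
    and "\<And>z. z \<in> sphere 0 1 \<Longrightarrow> g z = F z"
    and "\<epsilon> > 0"
  shows "is_arg_min (energy \<epsilon>) (\<lambda>u. u \<in> H1_bdry g) (U_map \<epsilon> F) \<and>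
    (\<forall>u. is_arg_min (energy \<epsilon>) (\<lambda>u. u \<in> H1_bdry g) u
       \<longrightarrow> (AE z in lebesgue_on (ball 0 1). u z = U_map \<epsilon> F z))"
proof -
  let ?M = "lebesgue_on (ball (0::complex) 1)"
  note \<epsilon> = assms(5)
  have Fsm: "smooth_to_boundary F" and FCR: "\<And>z. z \<in> ball 0 1 \<Longrightarrow> dy F z = \<i> * dx F z"
    unfolding assms(3) using blaschke_smooth[OF assms(2)] by auto
  have F1: "cmod (F z) < 1" if "z \<in> ball 0 1" for z
    unfolding assms(3) using blaschke_norm_disc[OF assms(1,2)] that by simp
  have gF: "g (cis \<theta>) = F (cis \<theta>)" for \<theta> by (rule assms(4)) simp
  have g1: "cmod (g (cis \<theta>)) = 1" for \<theta>
    unfolding gF assms(3) by (rule blaschke_norm_circle[OF assms(2)]) auto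
  have XF: "sobolev_limit F (dx F) (dy F) g" by (rule sobolev_limit_smooth[OF Fsm gF])
  have Fqr: "AE z in ?M. (cmod (dx F z))\<^sup>2 + (cmod (dy F z))\<^sup>2 \<le> 2 * Im (cnj (dx F z) * dy F z)"
  proof (rule AE_I2)
    fix z assume "z \<in> space ?M"
    then have "dy F z = \<i> * dx F z" using FCR by (simp add: space_restrict_space)
    then show "(cmod (dx F z))\<^sup>2 + (cmod (dy F z))\<^sup>2 \<le> 2 * Im (cnj (dx F z) * dy F z)"
      unfolding cmod_power2 by (simp add: power2_eq_square)
  qed
  have Fflat: "AE z in ?M. 1 \<le> cmod (F z) \<longrightarrow> dx F z = 0 \<and> dy F z = 0"
    using F1 by (intro AE_I2) (force simp: space_restrict_space)
  define P Q where "P z = power_map_deriv \<epsilon> (F z) (dx F z)" and "Q z = power_map_deriv \<epsilon> (F z) (dy F z)" for z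
  have "sobolev_limit (\<lambda>z. power_map \<epsilon> (F z)) P Q g"
    unfolding P_def[abs_def] Q_def[abs_def] by (rule sobolev_limit_power_map[OF \<epsilon> XF g1 Fqr _ Fflat]) simp
  then have XU: "sobolev_limit (U_map \<epsilon> F) P Q g"
    by (rule sobolev_limit_cong) (simp add: U_map_eq_power_map F1 del: mem_ball)
  have member: "u \<in> H1_bdry g \<longleftrightarrow> has_trace u g" for u by (auto simp: H1_bdry_def has_trace_def)
  have UH: "U_map \<epsilon> F \<in> H1_bdry g" unfolding member by (rule sobolev_limit_imp_has_trace[OF XU])
  have "(\<integral>z. conformal_defect \<epsilon> (U_map \<epsilon> F z) (P z) (Q z) \<partial>?M) = (\<integral>z. 0 \<partial>?M)"
  proof (rule Bochner_Integration.integral_cong[OF refl])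
    fix z assume "z \<in> space ?M"
    then have z: "z \<in> ball 0 1" by (simp add: space_restrict_space)
    show "conformal_defect \<epsilon> (U_map \<epsilon> F z) (P z) (Q z) = 0"
      unfolding P_def Q_def FCR[OF z] U_map_eq_power_map[of F z, OF F1[OF z]] by (rule conformal_defect_power_map[OF F1[OF z] \<epsilon>])
  qed
  then have EU: "energy \<epsilon> (U_map \<epsilon> F) = 2 / \<epsilon> * (\<integral>z. Im (cnj (P z) * Q z) \<partial>?M)"
    unfolding energy_eq(2)[OF XU \<epsilon>] by simp
  have Eu: "energy \<epsilon> u = energy \<epsilon> (U_map \<epsilon> F) + (\<integral>z. conformal_defect \<epsilon> (u z) (p z) (q z) \<partial>?M)"
    if "sobolev_limit u p q g" for u p q
    unfolding EU energy_eq(2)[OF that \<epsilon>] Jacobian_integral_depends_on_trace[OF that XU] ..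
  have min: "energy \<epsilon> (U_map \<epsilon> F) \<le> energy \<epsilon> u" if uH: "u \<in> H1_bdry g" for u
  proof -
    obtain p q where "sobolev_limit u p q g" by (rule has_trace_imp_sobolev_limit[OF uH[unfolded member]])
    from Eu[OF this] show ?thesis by (simp add: conformal_defect_nonneg)
  qed
  have "is_arg_min (energy \<epsilon>) (\<lambda>u. u \<in> H1_bdry g) (U_map \<epsilon> F)"
    unfolding is_arg_min_def using UH min by (auto simp: not_less)
  moreover have "AE z in ?M. u z = U_map \<epsilon> F z" if u: "is_arg_min (energy \<epsilon>) (\<lambda>u. u \<in> H1_bdry g) u" for u
  proof -
    have uH: "u \<in> H1_bdry g" and le: "energy \<epsilon> u \<le> energy \<epsilon> (U_map \<epsilon> F)"
      using u UH by (auto simp: is_arg_min_def not_less)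
    obtain p q where X: "sobolev_limit u p q g" by (rule has_trace_imp_sobolev_limit[OF uH[unfolded member]])
    have "(\<integral>z. conformal_defect \<epsilon> (u z) (p z) (q z) \<partial>?M) \<ge> 0" by (simp add: conformal_defect_nonneg)
    then have "(\<integral>z. conformal_defect \<epsilon> (u z) (p z) (q z) \<partial>?M) = 0" using Eu[OF X] le by linarith
    then have def0: "AE z in ?M. conformal_defect \<epsilon> (u z) (p z) (q z) = 0"
      using integral_nonneg_eq_0_iff_AE[OF energy_eq(1)[OF X \<epsilon>]] conformal_defect_nonneg by simp
    have C: "(1 + \<epsilon>\<^sup>2) / \<epsilon> > 0" using \<epsilon> by (intro divide_pos_pos add_pos_nonneg) auto
    have qr: "AE z in ?M. (cmod (p z))\<^sup>2 + (cmod (q z))\<^sup>2 \<le> (1 + \<epsilon>\<^sup>2) / \<epsilon> * Im (cnj (p z) * q z)"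
      using def0 gradient_zero_on_zero_set[OF X] by eventually_elim (rule conformal_defect_zero_quasiregular[OF \<epsilon>])
    note flat = gradient_zero_outside_disc[OF X g1 qr C]
    define R S where "R z = power_map_deriv (1 / \<epsilon>) (u z) (p z)" and "S z = power_map_deriv (1 / \<epsilon>) (u z) (q z)" for z
    have "sobolev_limit (\<lambda>z. power_map (1 / \<epsilon>) (u z)) R S g"
      unfolding R_def[abs_def] S_def[abs_def] using \<epsilon> by (intro sobolev_limit_power_map[OF _ X g1 qr C flat]) simp
    from sobolev_limit_diff[OF this XF]
    have V: "sobolev_limit (\<lambda>z. power_map (1 / \<epsilon>) (u z) - F z) (\<lambda>z. R z - dx F z) (\<lambda>z. S z - dy F z) (\<lambda>z. 0)" by simp
    have in_disc: "AE z in ?M. z \<in> ball 0 1" by (intro AE_I2) (simp add: space_restrict_space)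
    have "AE z in ?M. (R z - dx F z) + \<i> * (S z - dy F z) = 0"
      using def0 in_disc
    proof eventually_elim
      case (elim z)
      have "R z + \<i> * S z = 0"
      proof (cases "0 < cmod (u z) \<and> cmod (u z) < 1")
        case True
        then show ?thesis unfolding R_def S_def by (intro conformal_defect_zero_Cauchy_Riemann[OF \<epsilon> _ _ elim(1)]) auto
      next
        case False
        then show ?thesis unfolding R_def S_def power_map_deriv_def by (simp only: if_False) simp
      qed
      then show ?case using FCR[OF elim(2)] by (simp add: algebra_simps)
    qed
    from Cauchy_Riemann_zero_trace[OF V this]
    have "AE z in ?M. power_map (1 / \<epsilon>) (u z) - F z = 0" .
    then show ?thesis using in_disc
    proof eventually_elim
      case (elim z)
      then show ?case using power_map_inverse[OF \<epsilon>, of "u z" F z] F1[of z] by simp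
    qed
  qed
  ultimately show ?thesis by blast
qed

end
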